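(* Let $\Gamma=(\Omega,I,J,g,q)$ be a finite zero-sum stochastic game, with limit value $v^*$. Then there exists an adapted profile $(\sigma_n,\rho_n)_{n\ge1}$ of $\Gamma$ that satisfies the constant payoff property, i.e. such that for all $t\in(0,1)$ and all $\omega\in\Omega$, $$\lim_{n\to+\infty}\mathbb{E}^\omega_{\sigma_n,\rho_n}\left[\frac{1}{tn}\sum_{m=1}^{\lceil tn\rceil}g_m\right]=v^*(\omega).$$
   Context: **Stochastic game.** A finite zero-sum stochastic game is a tuple $\Gamma=(\Omega,I,J,g,q)$ with $\Omega$ (states), $I$ (Player 1's actions), $J$ (Player 2's actions) nonempty finite sets, $g:\Omega\times I\times J\to\mathbb{R}$ the payoff function and $q:\Omega\times I\times J\to\Delta(\Omega)$ the transition function, where $\Delta(A)$ is the set of probability distributions on a finite set $A$. From an initial state $\omega_1=\omega$, at each stage $m\ge 1$ the players simultaneously and independently choose $i_m\in I$, $j_m\in J$; the stage payoff is $g_m:=g(\omega_m,i_m,j_m)$ to Player 1 and $-g_m$ to Player 2; $\omega_{m+1}$ is drawn from $q(\omega_m,i_m,j_m)$; players observe $(\omega_{m+1},i_m,j_m)$. **Strategies.** Let $H_m:=(\Omega\times I\times J)^{m-1}\times\Omega$. A strategy of Player 1 is a collection $\sigma=(\sigma_m)_{m\ge1}$ of maps $\sigma_m:H_m\to\Delta(I)$; a strategy of Player 2 is a collection $\rho=(\rho_m)_{m\ge 1}$ of maps $\rho_m:H_m\to\Delta(J)$. The sets of strategies are $\Sigma$ and $T$. A stationary strategy depends only on the current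 state (a map $x:\Omega\to\Delta(I)$, resp. $y:\Omega\to\Delta(J)$). $\mathbb{E}^\omega_{\sigma,\rho}$ is the expectation for the probability induced on $(\Omega\times I\times J)^{\mathbb{N}}$ by initial state $\omega$ and the pair $(\sigma,\rho)$. **$n$-stage game.** $\gamma_n^\omega(\sigma,\rho)=\mathbb{E}^\omega_{\sigma,\rho}\left(\frac1n\sum_{m=1}^n g_m\right)$, with value $v_n(\omega)=\max_{\sigma\in\Sigma}\min_{\rho\in T}\gamma_n^\omega(\sigma,\rho)=\min_{\rho\in T}\max_{\sigma\in\Sigma}\gamma_n^\omega(\sigma,\rho)$. **$\lambda$-discounted game** ($\lambda\in(0,1]$). $\gamma_\lambda^\omega(\sigma,\rho)=\mathbb{E}^\omega_{\sigma,\rho}\left(\sum_{m\ge1}\lambda(1-\lambda)^{m-1}g_m\right)$, with value $v_\lambda(\omega)=\max_\sigma\min_\rho\gamma_\lambda^\omega(\sigma,\rho)=\min_\rho\max_\sigma\gamma_\lambda^\omega(\sigma,\rho)$. $\sigma$ (resp. $\rho$) is optimal in $\Gamma_\lambda$ if for every $\omega$, $\gamma_\lambda^\omega(\sigma,\rho')\ge v_\lambda(\omega)$ for all $\rho'\in T$ (resp. $\gamma_\lambda^\omega(\sigma',\rho)\le v_\lambda(\omega)$ for all $\sigma'\in\Sigma$). **Limit value.** By a theorem of Bewley and Kohlberg, for finite stochastic games $v_n$ (as $n\to+\infty$) and $v_\lambda$ (as $\lambda\to0$) converge to the same limit $v^*:\Omega\to\mathbb{R}$, called the limit value. **Discounted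 optimal stationary profile.** A family of pairs of stationary strategies $(x_\lambda,y_\lambda)_{\lambda\in(0,1]}$ such that for each $\lambda\in(0,1]$, $x_\lambda$ and $y_\lambda$ are optimal in $\Gamma_\lambda$. **Adapted profile.** A family of strategy pairs $(\sigma_n,\rho_n)_{n\ge1}$ is an adapted profile if there exist a discounted optimal stationary profile $(x_\lambda,y_\lambda)_\lambda$ and a sequence of positive integers $(a_n)_{n\ge1}$ with $a_n/n\to0$ such that for all $n\ge1$ and every stage $m\in\{1,\dots,n\}$, $\sigma_n$ plays $x_{\lambda^n_{k(m)}}$ and $\rho_n$ plays $y_{\lambda^n_{k(m)}}$ at stage $m$ (i.e. the mixed actions $x_{\lambda^n_{k(m)}}(\omega_m)$ and $y_{\lambda^n_{k(m)}}(\omega_m)$), where $k(m)=\left\lfloor\frac{m-1}{a_n}\right\rfloor$ and $\lambda^n_k=\frac{1}{n-ka_n}$ for integers $k\ge0$ with $ka_n<n$. (Behaviour after stage $n$ is irrelevant.) *)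

theory Defs
  imports "HOL-Probability.Probability"
begin

record ('w, 'i, 'j) stochastic_game =
  payoff :: "'w \<Rightarrow> 'i \<Rightarrow> 'j \<Rightarrow> real"
  transition :: "'w \<Rightarrow> 'i \<Rightarrow> 'j \<Rightarrow> 'w pmf"

text \<open>The set of histories before stage \<open>m\<close> is represented by the pairs of a list of length \<open>m - 1\<close>
  (the past triples, oldest first) and the current state. Since the length of the list determines
  the stage, one function on all such pairs is the same as a sequence of maps, one for each stage.\<close>

type_synonym ('w, 'i, 'j, 'a) strategy = "('w \<times> 'i \<times> 'j) list \<Rightarrow> 'w \<Rightarrow> 'a pmf"

definition stationary :: "('w \<Rightarrow> 'a pmf) \<Rightarrow> ('w, 'i, 'j, 'a) strategy" where
  "stationary x = (\<lambda>h s. x s)"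

text \<open>A play is a function \<open>p :: nat \<Rightarrow> 'w \<times> 'i \<times> 'j\<close>, whose coordinate \<open>k\<close> holds the state and the
  actions of stage \<open>k + 1\<close>. Given the coordinates below \<open>k\<close>, the following is the law of coordinate
  \<open>k\<close>.\<close>

definition stage_law ::
  "('w, 'i, 'j) stochastic_game \<Rightarrow> 'w \<Rightarrow> ('w, 'i, 'j, 'i) strategy \<Rightarrow> ('w, 'i, 'j, 'j) strategy
    \<Rightarrow> nat \<Rightarrow> (nat \<Rightarrow> 'w \<times> 'i \<times> 'j) \<Rightarrow> ('w \<times> 'i \<times> 'j) pmf" where
  "stage_law \<Gamma> \<omega> \<sigma> \<rho> k p =
     bind_pmf (if k = 0 then return_pmf \<omega> else case p (k - 1) of (s, i, j) \<Rightarrow> transition \<Gamma> s i j)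
       (\<lambda>s. map_pmf (\<lambda>(i, j). (s, i, j))
              (pair_pmf (\<sigma> (map p [0..<k]) s) (\<rho> (map p [0..<k]) s)))"

lemma Ionescu_Tulcea_stage_law:
  fixes \<Gamma> :: "('w::finite, 'i::finite, 'j::finite) stochastic_game"
  shows "Ionescu_Tulcea (\<lambda>k p. measure_pmf (stage_law \<Gamma> \<omega> \<sigma> \<rho> k p)) (\<lambda>_. count_space UNIV)"
proof
  fix k :: nat
  have eq: "PiM {0..<k} (\<lambda>_. count_space (UNIV :: ('w \<times> 'i \<times> 'j) set))
      = count_space (PiE {0..<k} (\<lambda>_. UNIV))"
    by (rule count_space_PiM_finite) (auto intro: countable_finite)
  show "(\<lambda>p. measure_pmf (stage_law \<Gamma> \<omega> \<sigma> \<rho> k p))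
      \<in> PiM {0..<k} (\<lambda>_. count_space UNIV) \<rightarrow>\<^sub>M subprob_algebra (count_space UNIV)"
    unfolding eq by (auto simp: measure_pmf_in_subprob_algebra)
qed

text \<open>The probability on the set of plays (with the product sigma-algebra) which the Ionescu-Tulcea
  theorem associates with these conditional laws.\<close>

definition play_measure ::
  "('w::finite, 'i::finite, 'j::finite) stochastic_game \<Rightarrow> 'w
    \<Rightarrow> ('w, 'i, 'j, 'i) strategy \<Rightarrow> ('w, 'i, 'j, 'j) strategy
    \<Rightarrow> (nat \<Rightarrow> 'w \<times> 'i \<times> 'j) measure" where
  "play_measure \<Gamma> \<omega> \<sigma> \<rho> =
     projective_family.lim UNIV
       (Ionescu_Tulcea.CI (\<lambda>k p. measure_pmf (stage_law \<Gamma> \<omega> \<sigma> \<rho> k p)) (\<lambda>_. count_space UNIV))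
       (\<lambda>_. count_space UNIV)"

lemma sets_play_measure: "sets (play_measure \<Gamma> \<omega> \<sigma> \<rho>) = sets (PiM UNIV (\<lambda>_. count_space UNIV))"
proof -
  interpret Ionescu_Tulcea "\<lambda>k p. measure_pmf (stage_law \<Gamma> \<omega> \<sigma> \<rho> k p)" "\<lambda>_. count_space UNIV"
    by (rule Ionescu_Tulcea_stage_law)
  show ?thesis unfolding play_measure_def by (rule PF.sets_lim)
qed

lemma distr_play_measure:
  assumes "finite K"
  shows "distr (play_measure \<Gamma> \<omega> \<sigma> \<rho>) (PiM K (\<lambda>_. count_space UNIV)) (\<lambda>p. restrict p K)
    = Ionescu_Tulcea.CI (\<lambda>k p. measure_pmf (stage_law \<Gamma> \<omega> \<sigma> \<rho> k p)) (\<lambda>_. count_space UNIV) K"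
proof -
  interpret Ionescu_Tulcea "\<lambda>k p. measure_pmf (stage_law \<Gamma> \<omega> \<sigma> \<rho> k p)" "\<lambda>_. count_space UNIV"
    by (rule Ionescu_Tulcea_stage_law)
  show ?thesis unfolding play_measure_def using assms by (rule distr_lim)
qed

lemma prob_space_play_measure: "prob_space (play_measure \<Gamma> \<omega> \<sigma> \<rho>)"
proof -
  interpret Ionescu_Tulcea "\<lambda>k p. measure_pmf (stage_law \<Gamma> \<omega> \<sigma> \<rho> k p)" "\<lambda>_. count_space UNIV"
    by (rule Ionescu_Tulcea_stage_law)
  have "prob_space (CI {})" by (rule PF.prob_space_P) auto
  then have "prob_space (distr (play_measure \<Gamma> \<omega> \<sigma> \<rho>) (PiM {} (\<lambda>_. count_space UNIV))
      (\<lambda>p. restrict p {}))"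
    by (simp only: distr_play_measure finite.emptyI)
  then show ?thesis
    by (rule prob_space_distrD[rotated])
       (auto simp: measurable_cong_sets[OF sets_play_measure refl] intro!: measurable_restrict)
qed

text \<open>The payoff of stage \<open>m \<ge> 1\<close>.\<close>

definition stage_payoff ::
  "('w, 'i, 'j) stochastic_game \<Rightarrow> nat \<Rightarrow> (nat \<Rightarrow> 'w \<times> 'i \<times> 'j) \<Rightarrow> real" where
  "stage_payoff \<Gamma> m p = (case p (m - 1) of (s, i, j) \<Rightarrow> payoff \<Gamma> s i j)"

definition nstage_payoff ::
  "('w::finite, 'i::finite, 'j::finite) stochastic_game \<Rightarrow> nat \<Rightarrow> 'w
    \<Rightarrow> ('w, 'i, 'j, 'i) strategy \<Rightarrow> ('w, 'i, 'j, 'j) strategy \<Rightarrow> real" where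
  "nstage_payoff \<Gamma> n \<omega> \<sigma> \<rho> =
     (\<integral>p. 1 / real n * (\<Sum>m=1..n. stage_payoff \<Gamma> m p) \<partial>play_measure \<Gamma> \<omega> \<sigma> \<rho>)"

text \<open>In the series, \<open>k\<close> stands for \<open>m - 1\<close>, where \<open>m \<ge> 1\<close> is the stage.\<close>

definition discounted_payoff ::
  "('w::finite, 'i::finite, 'j::finite) stochastic_game \<Rightarrow> real \<Rightarrow> 'w
    \<Rightarrow> ('w, 'i, 'j, 'i) strategy \<Rightarrow> ('w, 'i, 'j, 'j) strategy \<Rightarrow> real" where
  "discounted_payoff \<Gamma> l \<omega> \<sigma> \<rho> =
     (\<integral>p. (\<Sum>k. l * (1 - l) ^ k * stage_payoff \<Gamma> (Suc k) p) \<partial>play_measure \<Gamma> \<omega> \<sigma> \<rho>)"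

text \<open>Payoffs are bounded, so the suprema and infima below are those of bounded sets of reals; they
  are attained, and exchanging them gives the same number (the minmax theorem).\<close>

definition nstage_value ::
  "('w::finite, 'i::finite, 'j::finite) stochastic_game \<Rightarrow> nat \<Rightarrow> 'w \<Rightarrow> real" where
  "nstage_value \<Gamma> n \<omega> = (SUP \<sigma>. INF \<rho>. nstage_payoff \<Gamma> n \<omega> \<sigma> \<rho>)"

definition discounted_value ::
  "('w::finite, 'i::finite, 'j::finite) stochastic_game \<Rightarrow> real \<Rightarrow> 'w \<Rightarrow> real" where
  "discounted_value \<Gamma> l \<omega> = (SUP \<sigma>. INF \<rho>. discounted_payoff \<Gamma> l \<omega> \<sigma> \<rho>)"

definition optimal1 ::
  "('w::finite, 'i::finite, 'j::finite) stochastic_game \<Rightarrow> real \<Rightarrow> ('w, 'i, 'j, 'i) strategy \<Rightarrow> bool" where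
  "optimal1 \<Gamma> l \<sigma> \<longleftrightarrow> (\<forall>\<omega> \<rho>'. discounted_payoff \<Gamma> l \<omega> \<sigma> \<rho>' \<ge> discounted_value \<Gamma> l \<omega>)"

definition optimal2 ::
  "('w::finite, 'i::finite, 'j::finite) stochastic_game \<Rightarrow> real \<Rightarrow> ('w, 'i, 'j, 'j) strategy \<Rightarrow> bool" where
  "optimal2 \<Gamma> l \<rho> \<longleftrightarrow> (\<forall>\<omega> \<sigma>'. discounted_payoff \<Gamma> l \<omega> \<sigma>' \<rho> \<le> discounted_value \<Gamma> l \<omega>)"

text \<open>The common limit of the two families of values, which exists by the theorem of Bewley and
  Kohlberg.\<close>

definition limit_value :: "('w::finite, 'i::finite, 'j::finite) stochastic_game \<Rightarrow> 'w \<Rightarrow> real" where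
  "limit_value \<Gamma> = (THE v. \<forall>\<omega>. (\<lambda>n. nstage_value \<Gamma> n \<omega>) \<longlonglongrightarrow> v \<omega> \<and>
                            ((\<lambda>l. discounted_value \<Gamma> l \<omega>) \<longlongrightarrow> v \<omega>) (at_right 0))"

text \<open>Only the values of \<open>x\<close> and \<open>y\<close> at discount rates in \<open>(0, 1]\<close> matter.\<close>

definition discounted_optimal_profile ::
  "('w::finite, 'i::finite, 'j::finite) stochastic_game
    \<Rightarrow> (real \<Rightarrow> 'w \<Rightarrow> 'i pmf) \<Rightarrow> (real \<Rightarrow> 'w \<Rightarrow> 'j pmf) \<Rightarrow> bool" where
  "discounted_optimal_profile \<Gamma> x y \<longleftrightarrow>
     (\<forall>l\<in>{0<..1}. optimal1 \<Gamma> l (stationary (x l)) \<and> optimal2 \<Gamma> l (stationary (y l)))"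

text \<open>The discount rate \<open>1 / (n - k a)\<close> used in the \<open>k\<close>-th block of \<open>a\<close> stages of the \<open>n\<close>-stage game.\<close>

definition block_rate :: "nat \<Rightarrow> nat \<Rightarrow> nat \<Rightarrow> real" where
  "block_rate n a k = 1 / (real n - real k * real a)"

definition adapted_profile ::
  "('w::finite, 'i::finite, 'j::finite) stochastic_game
    \<Rightarrow> (nat \<Rightarrow> ('w, 'i, 'j, 'i) strategy) \<Rightarrow> (nat \<Rightarrow> ('w, 'i, 'j, 'j) strategy) \<Rightarrow> bool" where
  "adapted_profile \<Gamma> \<sigma> \<rho> \<longleftrightarrow>
     (\<exists>x y a. discounted_optimal_profile \<Gamma> x y \<and>
        (\<forall>n\<ge>1. a n \<ge> 1) \<and> (\<lambda>n. real (a n) / real n) \<longlonglongrightarrow> 0 \<and>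
        (\<forall>n\<ge>1. \<forall>m\<in>{1..n}. \<forall>h s. length h = m - 1 \<longrightarrow>
           \<sigma> n h s = x (block_rate n (a n) ((m - 1) div a n)) s \<and>
           \<rho> n h s = y (block_rate n (a n) ((m - 1) div a n)) s))"

definition constant_payoff_property ::
  "('w::finite, 'i::finite, 'j::finite) stochastic_game
    \<Rightarrow> (nat \<Rightarrow> ('w, 'i, 'j, 'i) strategy) \<Rightarrow> (nat \<Rightarrow> ('w, 'i, 'j, 'j) strategy) \<Rightarrow> bool" where
  "constant_payoff_property \<Gamma> \<sigma> \<rho> \<longleftrightarrow>
     (\<forall>t\<in>{0<..<1}. \<forall>\<omega>.
        (\<lambda>n. \<integral>p. 1 / (t * real n) * (\<Sum>m=1..nat \<lceil>t * real n\<rceil>. stage_payoff \<Gamma> m p)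
               \<partial>play_measure \<Gamma> \<omega> (\<sigma> n) (\<rho> n))
          \<longlonglongrightarrow> limit_value \<Gamma> \<omega>)"

end

theory Submission
  imports Defs "HOL-Computational_Algebra.Polynomial_Factorial" "HOL-Computational_Algebra.Field_as_Ring"
begin

text \<open>
  Write \<open>v\<^sub>l\<close> for the discounted value and \<open>Q\<close> for the transition operator of an optimal stationary
  pair. By multilinearity of determinants and Cramer's rule, \<open>z = v\<^sub>l k\<close> is where a matrix game with
  entries polynomial in \<open>l\<close> and \<open>z\<close> changes sign, so \<open>v\<^sub>l k\<close> is an algebraic function of \<open>l\<close>.
  A bounded algebraic function is differentiable and monotone near \<open>0\<close>, and \<open>d\<^sub>l = l v\<^sub>l'\<close> tends to \<open>0\<close>.
  Hence \<open>v\<^sub>l\<close> converges, and telescoping along the rates \<open>1 / n, 1 / (n - 1), \<dots>\<close> gives the same limit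
  for the values of the \<open>n\<close>-stage games.

  Limits of optimal pairs as the rate decreases to \<open>l\<close> form an optimal pair for which the Shapley
  equation may be differentiated in \<open>l\<close> with \<open>Q\<close> fixed, that is \<open>v\<^sub>l - Q v\<^sub>l = d\<^sub>l - (1 - l) Q d\<^sub>l\<close>.
  Summed over a block of at most \<open>1 / l\<close> stages at the rate \<open>l\<close>, this moves the expectation of the
  value by a constant times \<open>\<parallel>d\<^sub>l\<parallel>\<close> only. Taking blocks so long that their number times
  \<open>\<parallel>d\<^sub>l\<parallel>\<close> vanishes keeps the expected value constant, and the Shapley equation turns this into
  constant payoffs.
\<close>

text \<open>Algebraicity is used for more than convergence. A block at rate \<open>l\<close> may
  last \<open>1 / l\<close> stages, and over such a stretch the expected value moves by an amount of
  the order of \<open>l\<close> times the derivative of the value in \<open>l\<close>; this product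
  itself has to vanish. The optimal pair is selected at each rate separately, and no regularity of
  the pair in \<open>l\<close> is asked for. The matrix game has the pure stationary strategies as
  actions. Mixed stationary strategies enter it as product distributions, because the determinant is
  linear in each row and each row depends on the actions at one state only. Block lengths are a
  compromise. If \<open>\<eta> n\<close> bounds the error at all rates up to
  \<open>1 / sqrt n\<close>, then \<open>a n / n\<close> and \<open>n / a n * \<eta> n\<close> must
  both vanish; a length of about \<open>n * sqrt (\<eta> n)\<close> makes both of order
  \<open>sqrt (\<eta> n)\<close>, up to rounding. Rates above \<open>1 / sqrt n\<close> belong to
  blocks that begin with fewer than \<open>sqrt n\<close> stages left, and for large
  \<open>n\<close> the horizon \<open>t * n\<close> with \<open>t < 1\<close> stops before
  them.\<close>

section \<open>Expectations along a play\<close>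

text \<open>The coordinates from \<open>k\<close> on are \<open>undefined\<close>, as they are for \<open>restrict p {0..<k}\<close>.\<close>

fun history_law ::
  "('w, 'i, 'j) stochastic_game \<Rightarrow> 'w \<Rightarrow> ('w, 'i, 'j, 'i) strategy \<Rightarrow> ('w, 'i, 'j, 'j) strategy
    \<Rightarrow> nat \<Rightarrow> (nat \<Rightarrow> 'w \<times> 'i \<times> 'j) pmf" where
  "history_law \<Gamma> \<omega> \<sigma> \<rho> 0 = return_pmf (\<lambda>_. undefined)"
| "history_law \<Gamma> \<omega> \<sigma> \<rho> (Suc k) =
     bind_pmf (history_law \<Gamma> \<omega> \<sigma> \<rho> k) (\<lambda>p. map_pmf (\<lambda>t. p(k := t)) (stage_law \<Gamma> \<omega> \<sigma> \<rho> k p))"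

lemma PiM_count_space_finite:
  "PiM {0..<k::nat} (\<lambda>_. count_space (UNIV :: ('w::finite \<times> 'i::finite \<times> 'j::finite) set))
      = count_space (PiE {0..<k} (\<lambda>_. UNIV))"
  by (rule count_space_PiM_finite) (auto intro: countable_finite)

text \<open>All spaces of stage outcomes are finite, so the first \<open>k\<close> kernels of the
  Ionescu-Tulcea construction can be replayed inside \<open>pmf\<close>. Every later expectation of
  a single stage is computed there.\<close>

lemma distr_play_measure_history_law:
  fixes \<Gamma> :: "('w::finite, 'i::finite, 'j::finite) stochastic_game"
  shows "distr (play_measure \<Gamma> \<omega> \<sigma> \<rho>) (count_space UNIV) (\<lambda>p. restrict p {0..<k})
    = measure_pmf (history_law \<Gamma> \<omega> \<sigma> \<rho> k)"
proof -
  interpret Ionescu_Tulcea "\<lambda>k p. measure_pmf (stage_law \<Gamma> \<omega> \<sigma> \<rho> k p)" "\<lambda>_. count_space UNIV"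
    by (rule Ionescu_Tulcea_stage_law)
  have C: "(\<integral>\<^sup>+p. f p \<partial>C 0 k (\<lambda>_. undefined)) = (\<integral>\<^sup>+p. f p \<partial>history_law \<Gamma> \<omega> \<sigma> \<rho> k)" for f k
  proof (induction k arbitrary: f)
    case 0
    then show ?case
      by (auto simp: PiM_empty nn_integral_return)
  next
    case (Suc k)
    have "(\<integral>\<^sup>+p. f p \<partial>C 0 (Suc k) (\<lambda>_. undefined))
        = (\<integral>\<^sup>+p. (\<integral>\<^sup>+q. f q \<partial>eP k p) \<partial>C 0 k (\<lambda>_. undefined))"
      unfolding C.simps add_0
    proof (rule nn_integral_bind[where B="PiM {0..<Suc k} (\<lambda>_. count_space UNIV)"])
      show "f \<in> borel_measurable (PiM {0..<Suc k} (\<lambda>_. count_space UNIV))"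
        unfolding PiM_count_space_finite by simp
      show "eP k \<in> measurable (C 0 k (\<lambda>_. undefined)) (subprob_algebra (PiM {0..<Suc k} (\<lambda>_. count_space
        UNIV)))"
        using measurable_eP[of k] by (subst measurable_cong_sets[OF sets_C refl]) (auto simp: space_PiM)
    qed
    also have "\<dots> = (\<integral>\<^sup>+p. (\<integral>\<^sup>+t. f (p(k := t)) \<partial>stage_law \<Gamma> \<omega> \<sigma> \<rho> k p) \<partial>C 0 k (\<lambda>_. undefined))"
    proof (rule nn_integral_cong)
      fix p assume "p \<in> space (C 0 k (\<lambda>_. undefined))"
      then have "p \<in> space (PiM {0..<k} (\<lambda>_. count_space UNIV))"
        by (subst (asm) space_C) (auto simp: space_PiM)
      then show "(\<integral>\<^sup>+q. f q \<partial>eP k p) = (\<integral>\<^sup>+t. f (p(k := t)) \<partial>stage_law \<Gamma> \<omega> \<sigma> \<rho> k p)"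
        by (rule nn_integral_eP) (simp add: PiM_count_space_finite)
    qed
    also have "\<dots> = (\<integral>\<^sup>+p. f p \<partial>history_law \<Gamma> \<omega> \<sigma> \<rho> (Suc k))"
      by (simp add: Suc.IH)
    finally show ?case .
  qed
  \<comment> \<open>\<open>CI\<close> is built from the shortest initial segment that contains the
    index set; here the index set is that segment.\<close>
  have upto: "up_to {0..<k} = k"
    by (rule antisym) (auto simp: up_to_iff up_to_iff_Ico intro: up_to_less, metis atLeastLessThan_iff
      finite_atLeastLessThan linorder_not_less order_refl up_to_iff zero_le)
  have meas: "(\<lambda>p. restrict p {0..<k}) \<in> measurable (play_measure \<Gamma> \<omega> \<sigma> \<rho>) (PiM {0..<k} (\<lambda>_. count_space
    UNIV))"
    by (auto simp: measurable_cong_sets[OF sets_play_measure refl] intro!: measurable_restrict)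
  \<comment> \<open>The product space consists of extensional functions only. The inclusion carries
    its law to the space of all functions, where \<open>history_law\<close> lives.\<close>
  have incl: "(\<lambda>p. p) \<in> measurable (PiM {0..<k} (\<lambda>_. count_space (UNIV::('w \<times> 'i \<times> 'j) set)))
    (count_space UNIV)"
    unfolding PiM_count_space_finite by simp
  have spC: "space (C 0 k (\<lambda>_. undefined)) = PiE {0..<k} (\<lambda>_. UNIV)"
    by (subst space_C) (auto simp: space_PiM)
  have "distr (play_measure \<Gamma> \<omega> \<sigma> \<rho>) (count_space UNIV) (\<lambda>p. restrict p {0..<k})
     = distr (distr (play_measure \<Gamma> \<omega> \<sigma> \<rho>) (PiM {0..<k} (\<lambda>_. count_space UNIV)) (\<lambda>p. restrict p
       {0..<k})) (count_space UNIV) (\<lambda>p. p)"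
    by (subst distr_distr[OF incl meas]) (simp add: comp_def)
  also have "\<dots> = distr (CI {0..<k}) (count_space UNIV) (\<lambda>p. p)"
    by (subst distr_play_measure) auto
  also have "\<dots> = measure_pmf (history_law \<Gamma> \<omega> \<sigma> \<rho> k)"
  proof (rule measure_eqI)
    fix A assume "A \<in> sets (distr (CI {0..<k}) (count_space UNIV) (\<lambda>p. p))"
    have mr: "(\<lambda>f. restrict f {0..<k}) \<in> measurable (C 0 k (\<lambda>_. undefined)) (PiM {0..<k} (\<lambda>_.
      count_space UNIV))"
      by (subst measurable_cong_sets[OF sets_C refl]) (auto simp: space_PiM intro!: measurable_restrict)
    have "emeasure (distr (CI {0..<k}) (count_space UNIV) (\<lambda>p. p)) A
        = emeasure (C 0 k (\<lambda>_. undefined)) (A \<inter> PiE {0..<k} (\<lambda>_. UNIV))"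
    proof -
      have r: "restrict f {0..<k} = f" if "f \<in> PiE {0..<k} (\<lambda>_. UNIV :: ('w \<times> 'i \<times> 'j) set)" for f
        using that by (auto simp: PiE_iff extensional_restrict)
      have "CI {0..<k} = distr (C 0 k (\<lambda>_. undefined)) (PiM {0..<k} (\<lambda>_. count_space UNIV)) (\<lambda>f. f)"
        unfolding CI_def upto by (rule distr_cong) (auto simp: spC r)
      moreover have "(\<lambda>f. f) \<in> measurable (C 0 k (\<lambda>_. undefined)) (PiM {0..<k} (\<lambda>_. count_space (UNIV ::
        ('w \<times> 'i \<times> 'j) set)))"
        by (subst measurable_cong_sets[OF sets_C refl]) (auto simp: space_PiM)
      ultimately show ?thesis
        using incl by (simp add: emeasure_distr distr_distr comp_def spC measurable_compose[OF _ incl])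
    qed
    also have "\<dots> = (\<integral>\<^sup>+p. indicator A p \<partial>C 0 k (\<lambda>_. undefined))"
    proof -
      have "A \<inter> PiE {0..<k} (\<lambda>_. UNIV) \<in> sets (C 0 k (\<lambda>_. undefined))"
        by (subst sets_C) (auto simp: space_PiM PiM_count_space_finite)
      then show ?thesis
        by (subst nn_integral_indicator[symmetric], assumption, intro nn_integral_cong)
          (simp add: spC indicator_def)
    qed
    also have "\<dots> = emeasure (measure_pmf (history_law \<Gamma> \<omega> \<sigma> \<rho> k)) A"
      by (simp add: C)
    finally show "emeasure (distr (CI {0..<k}) (count_space UNIV) (\<lambda>p. p)) A
      = emeasure (measure_pmf (history_law \<Gamma> \<omega> \<sigma> \<rho> k)) A" .
  qed simp
  finally show ?thesis .
qed

section \<open>Expectations of functions of a single stage\<close>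

definition stage_expectation ::
  "('w::finite, 'i::finite, 'j::finite) stochastic_game \<Rightarrow> 'w \<Rightarrow> ('w, 'i, 'j, 'i) strategy
    \<Rightarrow> ('w, 'i, 'j, 'j) strategy \<Rightarrow> nat \<Rightarrow> ('w \<times> 'i \<times> 'j \<Rightarrow> real) \<Rightarrow> real" where
  "stage_expectation \<Gamma> \<omega> \<sigma> \<rho> k u = (\<integral>p. u (p k) \<partial>play_measure \<Gamma> \<omega> \<sigma> \<rho>)"

lemma integrable_stage [simp]:
  fixes u :: "'w::finite \<times> 'i::finite \<times> 'j::finite \<Rightarrow> real"
  shows "integrable (play_measure \<Gamma> \<omega> \<sigma> \<rho>) (\<lambda>p. u (p k))"
proof -
  interpret prob_space "play_measure \<Gamma> \<omega> \<sigma> \<rho>" by (rule prob_space_play_measure)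
  show ?thesis
  proof (rule integrable_const_bound)
    show "AE p in play_measure \<Gamma> \<omega> \<sigma> \<rho>. norm (u (p k)) \<le> Max (range (\<lambda>t. norm (u t)))"
      by (auto intro!: AE_I2 Max_ge)
    show "(\<lambda>p. u (p k)) \<in> borel_measurable (play_measure \<Gamma> \<omega> \<sigma> \<rho>)"
      unfolding measurable_cong_sets[OF sets_play_measure refl]
      by (rule measurable_compose[OF measurable_component_singleton[where i=k]]) auto
  qed
qed

lemma stage_expectation_add:
  "stage_expectation \<Gamma> \<omega> \<sigma> \<rho> k (\<lambda>t. u t + v t)
    = stage_expectation \<Gamma> \<omega> \<sigma> \<rho> k u + stage_expectation \<Gamma> \<omega> \<sigma> \<rho> k v"
  unfolding stage_expectation_def by (rule Bochner_Integration.integral_add) auto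

lemma stage_expectation_diff:
  "stage_expectation \<Gamma> \<omega> \<sigma> \<rho> k (\<lambda>t. u t - v t)
    = stage_expectation \<Gamma> \<omega> \<sigma> \<rho> k u - stage_expectation \<Gamma> \<omega> \<sigma> \<rho> k v"
  unfolding stage_expectation_def by (rule Bochner_Integration.integral_diff) auto

lemma stage_expectation_cmult:
  "stage_expectation \<Gamma> \<omega> \<sigma> \<rho> k (\<lambda>t. c * u t) = c * stage_expectation \<Gamma> \<omega> \<sigma> \<rho> k u"
  unfolding stage_expectation_def by simp

lemma stage_expectation_const:
  "stage_expectation \<Gamma> \<omega> \<sigma> \<rho> k (\<lambda>t. c) = c"
  unfolding stage_expectation_def by (simp add: prob_space.prob_space[OF prob_space_play_measure])

lemma stage_expectation_mono:
  "(\<And>t. u t \<le> v t) \<Longrightarrow> stage_expectation \<Gamma> \<omega> \<sigma> \<rho> k u \<le> stage_expectation \<Gamma> \<omega> \<sigma> \<rho> k v"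
  unfolding stage_expectation_def by (rule integral_mono) auto

lemma stage_expectation_abs_le:
  assumes "\<And>t. \<bar>u t\<bar> \<le> c"
  shows "\<bar>stage_expectation \<Gamma> \<omega> \<sigma> \<rho> k u\<bar> \<le> c"
proof -
  have "- c \<le> u t" "u t \<le> c" for t using assms[of t] by auto
  then show ?thesis
    using stage_expectation_mono[of u "\<lambda>_. c" \<Gamma> \<omega> \<sigma> \<rho> k]
      stage_expectation_mono[of "\<lambda>_. - c" u \<Gamma> \<omega> \<sigma> \<rho> k]
    by (simp add: stage_expectation_const)
qed

lemma stage_expectation_history_law:
  "stage_expectation \<Gamma> \<omega> \<sigma> \<rho> k u = (\<integral>p. u (p k) \<partial>history_law \<Gamma> \<omega> \<sigma> \<rho> (Suc k))"
proof -
  have m: "(\<lambda>p. restrict p {0..<Suc k}) \<in> measurable (play_measure \<Gamma> \<omega> \<sigma> \<rho>) (count_space UNIV)"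
  proof -
    have "(\<lambda>p. restrict p {0..<Suc k}) \<in> measurable (play_measure \<Gamma> \<omega> \<sigma> \<rho>) (PiM {0..<Suc k} (\<lambda>_.
      count_space UNIV))"
      by (auto simp: measurable_cong_sets[OF sets_play_measure refl] intro!: measurable_restrict)
    then show ?thesis
      by (rule measurable_compose) (simp add: PiM_count_space_finite)
  qed
  show ?thesis
    unfolding stage_expectation_def distr_play_measure_history_law[symmetric]
    by (subst integral_distr[OF m]) auto
qed

definition state_law :: "('w, 'i, 'j) stochastic_game \<Rightarrow> 'w \<Rightarrow> nat \<Rightarrow> (nat \<Rightarrow> 'w \<times> 'i \<times> 'j) \<Rightarrow> 'w pmf" where
  "state_law \<Gamma> \<omega> k p =
     (if k = 0 then return_pmf \<omega> else case p (k - 1) of (s, i, j) \<Rightarrow> transition \<Gamma> s i j)"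

text \<open>Integrating out coordinate \<open>k\<close> leaves an expectation over the past in which
  the two mixed actions appear explicitly, so that an inequality for a one-shot game can be applied
  under the integral.\<close>

lemma stage_expectation_unfold:
  fixes \<Gamma> :: "('w::finite, 'i::finite, 'j::finite) stochastic_game"
  shows "stage_expectation \<Gamma> \<omega> \<sigma> \<rho> k u =
    (\<integral>p. (\<Sum>s\<in>UNIV. pmf (state_law \<Gamma> \<omega> k p) s *
       (\<Sum>i\<in>UNIV. \<Sum>j\<in>UNIV. pmf (\<sigma> (map p [0..<k]) s) i * pmf (\<rho> (map p [0..<k]) s) j * u (s, i, j)))
     \<partial>history_law \<Gamma> \<omega> \<sigma> \<rho> k)"
proof -
  have fin: "finite (set_pmf (history_law \<Gamma> \<omega> \<sigma> \<rho> k))" for k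
    by (induction k) auto
  have *: "(\<integral>t. u t \<partial>stage_law \<Gamma> \<omega> \<sigma> \<rho> k p) = (\<Sum>s\<in>UNIV. pmf (state_law \<Gamma> \<omega> k p) s *
       (\<Sum>i\<in>UNIV. \<Sum>j\<in>UNIV. pmf (\<sigma> (map p [0..<k]) s) i * pmf (\<rho> (map p [0..<k]) s) j * u (s, i, j)))" for p
    unfolding stage_law_def state_law_def[symmetric]
    apply (subst pmf_expectation_bind[where A=UNIV])
    apply (auto simp: integral_measure_pmf_real[where A=UNIV] sum.cartesian_product pmf_pair intro!:
      sum.cong)
    done
  have "(\<integral>p. u (p k) \<partial>history_law \<Gamma> \<omega> \<sigma> \<rho> (Suc k))
     = (\<integral>p. (\<integral>q. u (q k) \<partial>map_pmf (\<lambda>t. p(k := t)) (stage_law \<Gamma> \<omega> \<sigma> \<rho> k p)) \<partial>history_law \<Gamma> \<omega> \<sigma> \<rho> k)"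
    unfolding history_law.simps 
    by (subst pmf_expectation_bind[OF fin _ order_refl])
      (auto simp: integral_measure_pmf[OF fin])
  also have "\<dots> = (\<integral>p. (\<integral>t. u t \<partial>stage_law \<Gamma> \<omega> \<sigma> \<rho> k p) \<partial>history_law \<Gamma> \<omega> \<sigma> \<rho> k)"
    by simp
  finally show ?thesis unfolding stage_expectation_history_law * .
qed

lemma stage_expectation_state:
  fixes \<Gamma> :: "('w::finite, 'i::finite, 'j::finite) stochastic_game"
  shows "stage_expectation \<Gamma> \<omega> \<sigma> \<rho> k (\<lambda>t. \<phi> (fst t)) =
    (\<integral>p. (\<Sum>s\<in>UNIV. pmf (state_law \<Gamma> \<omega> k p) s * \<phi> s) \<partial>history_law \<Gamma> \<omega> \<sigma> \<rho> k)"
  unfolding stage_expectation_unfold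
  by (simp add: sum_distrib_right[symmetric] sum_distrib_left[symmetric] sum_pmf_eq_1)

lemma stage_expectation_0: "stage_expectation \<Gamma> \<omega> \<sigma> \<rho> 0 (\<lambda>t. \<phi> (fst t)) = \<phi> \<omega>"
  by (simp add: stage_expectation_state state_law_def indicator_def if_distrib[of "\<lambda>x. x * _"] cong:
    if_cong)

lemma stage_expectation_Suc:
  fixes \<Gamma> :: "('w::finite, 'i::finite, 'j::finite) stochastic_game"
  shows "stage_expectation \<Gamma> \<omega> \<sigma> \<rho> (Suc k) (\<lambda>t. \<phi> (fst t)) =
    stage_expectation \<Gamma> \<omega> \<sigma> \<rho> k (\<lambda>(s, i, j). \<Sum>s'\<in>UNIV. pmf (transition \<Gamma> s i j) s' * \<phi> s')"
  unfolding stage_expectation_state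
  by (subst stage_expectation_history_law) (auto simp: state_law_def intro!:
    Bochner_Integration.integral_cong split: prod.split)

lemma integrable_history_law:
  assumes "\<And>p. \<bar>f p :: real\<bar> \<le> B"
  shows "integrable (measure_pmf (history_law \<Gamma> \<omega> \<sigma> \<rho> k)) f"
  by (rule measure_pmf.integrable_const_bound[where B=B]) (auto simp: assms)

text \<open>The passage from one-shot games to plays: an inequality that holds after every history
  of length \<open>k\<close> survives averaging over histories and states.\<close>

lemma stage_expectation_one_step:
  fixes \<Gamma> :: "('w::finite, 'i::finite, 'j::finite) stochastic_game"
  assumes "\<And>h s. length h = k \<Longrightarrow>
    \<psi> s \<le> (\<Sum>i\<in>UNIV. \<Sum>j\<in>UNIV. pmf (\<sigma> h s) i * pmf (\<rho> h s) j * u (s, i, j))"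
  shows "stage_expectation \<Gamma> \<omega> \<sigma> \<rho> k (\<lambda>t. \<psi> (fst t)) \<le> stage_expectation \<Gamma> \<omega> \<sigma> \<rho> k u"
proof -
  define F where "F p s
    = (\<Sum>i\<in>UNIV. \<Sum>j\<in>UNIV. pmf (\<sigma> (map p [0..<k]) s) i * pmf (\<rho> (map p [0..<k]) s) j * u (s, i, j))" for p s
  define M where "M = (\<Sum>t\<in>UNIV. \<bar>u t\<bar>)"
  have b1: "\<bar>F p s\<bar> \<le> M" for p s
  proof -
    have "\<bar>F p s\<bar> \<le> (\<Sum>i\<in>UNIV. \<Sum>j\<in>UNIV. \<bar>u (s, i, j)\<bar>)"
      unfolding F_def
      by (rule order_trans[OF sum_abs sum_mono[OF order_trans[OF sum_abs sum_mono]]])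
        (auto simp: abs_mult pmf_nonneg pmf_le_1 intro!: mult_left_le_one_le mult_le_one)
    also have "\<dots> \<le> (\<Sum>s\<in>UNIV. \<Sum>i\<in>UNIV. \<Sum>j\<in>UNIV. \<bar>u (s, i, j)\<bar>)"
      by (rule member_le_sum[where f="\<lambda>s. \<Sum>i\<in>UNIV. \<Sum>j\<in>UNIV. \<bar>u (s, i, j)\<bar>"]) (auto intro: sum_nonneg)
    also have "\<dots> = M"
      unfolding M_def by (simp add: sum.cartesian_product case_prod_beta flip: UNIV_Times_UNIV)
    finally show ?thesis .
  qed
  have avg: "\<bar>\<Sum>s\<in>UNIV. pmf (state_law \<Gamma> \<omega> k p) s * f s\<bar> \<le> B" if "\<And>s. \<bar>f s\<bar> \<le> B" for f p B
  proof -
    have "\<bar>\<Sum>s\<in>UNIV. pmf (state_law \<Gamma> \<omega> k p) s * f s\<bar> \<le> (\<Sum>s\<in>UNIV. pmf (state_law \<Gamma> \<omega> k p) s * B)"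
      by (rule order_trans[OF sum_abs sum_mono]) (auto simp: abs_mult that mult_left_mono)
    then show ?thesis by (simp add: sum_distrib_right[symmetric] sum_pmf_eq_1)
  qed
  show ?thesis
    unfolding stage_expectation_state stage_expectation_unfold[of _ _ _ _ _ u] F_def[symmetric]
  proof (rule integral_mono)
    show "integrable (measure_pmf (history_law \<Gamma> \<omega> \<sigma> \<rho> k)) (\<lambda>p. \<Sum>s\<in>UNIV. pmf (state_law \<Gamma> \<omega> k p) s * \<psi> s)"
      by (rule integrable_history_law[where B="Max (range (\<lambda>s. \<bar>\<psi> s\<bar>))"]) (auto intro!: avg Max_ge)
    show "integrable (measure_pmf (history_law \<Gamma> \<omega> \<sigma> \<rho> k)) (\<lambda>p. \<Sum>s\<in>UNIV. pmf (state_law \<Gamma> \<omega> k p) s * F p s)"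
      by (rule integrable_history_law[where B=M]) (auto intro!: avg b1)
    show "(\<Sum>s\<in>UNIV. pmf (state_law \<Gamma> \<omega> k p) s * \<psi> s) \<le> (\<Sum>s\<in>UNIV. pmf (state_law \<Gamma> \<omega> k p) s * F p s)" for p
      by (rule sum_mono) (auto intro!: mult_left_mono assms simp: F_def)
  qed
qed

section \<open>Matrix games and the Shapley equation\<close>

lemma continuous_on_Max_finite:
  fixes f :: "'i \<Rightarrow> 'a::topological_space \<Rightarrow> real"
  assumes "finite I" "I \<noteq> {}" "\<And>i. i \<in> I \<Longrightarrow> continuous_on S (f i)"
  shows "continuous_on S (\<lambda>x. Max ((\<lambda>i. f i x) ` I))"
  using assms
proof (induction I rule: finite_ne_induct)
  case (insert i I)
  then show ?case
    by (simp add: continuous_on_max)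
qed simp

lemma pmf_of_weights:
  fixes a :: "'a::finite \<Rightarrow> real"
  assumes "\<And>i. 0 \<le> a i" "(\<Sum>i\<in>UNIV. a i) = 1"
  obtains x :: "'a pmf" where "\<And>i. pmf x i = a i"
proof
  have "(\<integral>\<^sup>+i. ennreal (a i) \<partial>count_space UNIV) = ennreal (\<Sum>i\<in>UNIV. a i)"
    by (simp add: nn_integral_count_space_finite sum_ennreal assms)
  then show "pmf (embed_pmf a) i = a i" for i
    by (intro pmf_embed_pmf) (auto simp: assms)
qed

text \<open>Let \<open>v\<close> be the least value, on the convex hull of the columns, of the
  largest coordinate. A point where it is attained gives the mixed column. A hyperplane separating
  the hull from the open orthant strictly below \<open>v\<close> has a nonnegative normal, and this
  normal, rescaled to total mass one, is the mixed row.\<close>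

lemma matrix_game_minmax:
  fixes A :: "'i::finite \<Rightarrow> 'j::finite \<Rightarrow> real"
  obtains v :: real and x :: "'i pmf" and y :: "'j pmf"
  where "\<And>j. v \<le> (\<Sum>i\<in>UNIV. pmf x i * A i j)" "\<And>i. (\<Sum>j\<in>UNIV. pmf y j * A i j) \<le> v"
proof -
  define col where "col j = (\<chi> i. A i j)" for j
  define C where "C = convex hull (range col)"
  define m where "m u = Max (range (\<lambda>i. u $ i))" for u :: "real^'i"
  have "compact C" unfolding C_def by (intro compact_convex_hull finite_imp_compact) simp
  moreover have "C \<noteq> {}" unfolding C_def by simp
  moreover have "continuous_on C m" unfolding m_def
    by (rule continuous_on_Max_finite[where f="\<lambda>i u. u $ i"])
      (auto intro: continuous_on_component continuous_on_id)
  ultimately obtain c where c: "c \<in> C" "\<And>u. u \<in> C \<Longrightarrow> m c \<le> m u"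
    using continuous_attains_inf[of C m] by auto
  define v where "v = m c"
  have "\<exists>w. (\<forall>j. 0 \<le> w j) \<and> (\<Sum>j\<in>UNIV. w j) = 1 \<and> (\<Sum>j\<in>UNIV. w j *\<^sub>R col j) = c"
  proof -
    have "C = {y. \<exists>w. (\<forall>x\<in>range col. 0 \<le> w x) \<and> sum w (range col) = 1 \<and> (\<Sum>x\<in>range col. w x *\<^sub>R x) = y}"
      unfolding C_def by (rule convex_hull_finite) simp
    with c(1) obtain w where w: "\<And>x. x \<in> range col \<Longrightarrow>
      0 \<le> w x" "sum w (range col) = 1" "(\<Sum>x\<in>range col. w x *\<^sub>R x) = c"
      by auto
    \<comment> \<open>Equal columns are one point of the hull; the weight of that point is shared
      equally among them.\<close>
    define w' where "w' j = w (col j) / card {j'. col j' = col j}" for j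
    have pos: "card {j'. col j' = col j} > 0" for j by (auto simp: card_gt_0_iff)
    have "(\<Sum>j\<in>UNIV. w' j *\<^sub>R f (col j))
      = (\<Sum>x\<in>range col. w x *\<^sub>R f x)" for f :: "(real, 'i) vec \<Rightarrow> 'b::real_vector"
    proof -
      have "(\<Sum>j\<in>UNIV. w' j *\<^sub>R f (col j)) = (\<Sum>x\<in>range col. \<Sum>j\<in>{j\<in>UNIV. col j = x}. w' j *\<^sub>R f (col j))"
        by (rule sum.image_gen) simp
      also have "\<dots> = (\<Sum>x\<in>range col. w x *\<^sub>R f x)"
      proof (rule sum.cong[OF refl])
        fix x assume "x \<in> range col"
        then obtain j0 where j0: "x = col j0" by auto
        have "(\<Sum>j\<in>{j\<in>UNIV. col j = x}. w' j *\<^sub>R f (col j)) = (\<Sum>j\<in>{j. col j = x}. (w x / card {j'. col j'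
          = x}) *\<^sub>R f x)"
          by (rule sum.cong) (auto simp: w'_def)
        also have "\<dots> = w x *\<^sub>R f x"
          using pos[of j0] by (auto simp: j0 sum_constant_scaleR)
        finally show "(\<Sum>j\<in>{j\<in>UNIV. col j = x}. w' j *\<^sub>R f (col j)) = w x *\<^sub>R f x" .
      qed
      finally show ?thesis .
    qed
    note eq = this
    show ?thesis
      using eq[of "\<lambda>_. 1::real"] eq[of "\<lambda>x. x"] w
      by (intro exI[of _ w']) (auto simp: w'_def)
  qed
  then obtain w where w: "\<And>j. 0 \<le> w j" "(\<Sum>j\<in>UNIV. w j) = 1" "(\<Sum>j\<in>UNIV. w j *\<^sub>R col j) = c"
    by auto
  obtain y :: "'j pmf" where y: "\<And>j. pmf y j = w j" using pmf_of_weights[of w] w by metis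
  have y_le: "(\<Sum>j\<in>UNIV. pmf y j * A i j) \<le> v" for i
  proof -
    have "(\<Sum>j\<in>UNIV. pmf y j * A i j) = c $ i"
      by (simp add: w(3)[symmetric] y col_def)
    also have "\<dots> \<le> v" unfolding v_def m_def by (rule Max_ge) auto
    finally show ?thesis .
  qed
  define D where "D = {u::real^'i. \<forall>i. u $ i < v}"
  have "convex D"
    unfolding D_def by (rule convexI) (auto intro!: convex_bound_lt)
  moreover have "D \<noteq> {}" unfolding D_def
    by (auto intro!: exI[of _ "\<chi> i. v - 1"])
  moreover have "D \<inter> C = {}"
  proof (safe; goal_cases)
    case (1 u)
    have "m u < v" using 1(1) unfolding D_def m_def by (subst Max_less_iff) auto
    with c(2)[OF 1(2)] show ?case by (simp add: v_def)
  qed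
  moreover have "convex C" "C \<noteq> {}" unfolding C_def by auto
  ultimately obtain a b where a: "a \<noteq> 0" "\<And>u. u \<in> D \<Longrightarrow> a \<bullet> u \<le> b" "\<And>u. u \<in> C \<Longrightarrow> b \<le> a \<bullet> u"
    using separating_hyperplane_sets[of D C] by blast
  have nonneg: "0 \<le> a $ i" for i
  proof (rule ccontr)
    assume neg: "\<not> 0 \<le> a $ i"
    define e :: "real^'i" where "e = (\<chi> i. v - 1)"
    \<comment> \<open>The orthant is unbounded downwards in direction \<open>i\<close>. With this
      step length, a negative coordinate \<open>a $ i\<close> would raise the linear form to at
      least \<open>b + 1\<close>.\<close>
    define t where "t = (\<bar>b - a \<bullet> e\<bar> + 1) / (- (a $ i))"
    have t: "t > 0" unfolding t_def using neg by (intro divide_pos_pos) auto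
    have "e - t *\<^sub>R axis i 1 \<in> D"
      using t by (auto simp: D_def e_def axis_def)
    then have "a \<bullet> (e - t *\<^sub>R axis i 1) \<le> b" by (rule a)
    moreover have "t * a $ i = - (\<bar>b - a \<bullet> e\<bar> + 1)"
      using neg by (simp add: t_def field_simps)
    then have "a \<bullet> (e - t *\<^sub>R axis i 1) = a \<bullet> e + \<bar>b - a \<bullet> e\<bar> + 1"
      by (simp add: inner_diff_right inner_axis)
    ultimately show False by linarith
  qed
  define S where "S = (\<Sum>i\<in>UNIV. a $ i)"
  have "S > 0"
  proof -
    obtain i where "a $ i \<noteq> 0" using a(1) by (auto simp: vec_eq_iff)
    then have "a $ i > 0" using nonneg[of i] by auto
    then show ?thesis unfolding S_def using nonneg
      by (intro sum_pos2[of _ i]) auto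
  qed
  have bv: "S * v \<le> b"
  proof (rule field_le_epsilon)
    fix e :: real assume "e > 0"
    define u :: "real^'i" where "u = (\<chi> i. v - e / S)"
    have "u \<in> D" using \<open>e > 0\<close> \<open>S > 0\<close> by (auto simp: D_def u_def)
    then have "a \<bullet> u \<le> b" by (rule a)
    moreover have "a \<bullet> u = S * v - e"
    proof -
      have "a \<bullet> u = S * (v - e / S)"
        unfolding inner_vec_def u_def S_def by (simp only: sum_distrib_right) simp
      then show ?thesis using \<open>S > 0\<close> by (simp add: right_diff_distrib)
    qed
    ultimately show "S * v \<le> b + e" by simp
  qed
  have "(\<Sum>i\<in>UNIV. a $ i / S) = 1"
    using \<open>S > 0\<close> by (simp add: sum_divide_distrib[symmetric] S_def)
  then obtain x :: "'i pmf" where x: "\<And>i. pmf x i = a $ i / S"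
    using pmf_of_weights[of "\<lambda>i. a $ i / S"] nonneg \<open>S > 0\<close> by auto
  have x_ge: "v \<le> (\<Sum>i\<in>UNIV. pmf x i * A i j)" for j
  proof -
    have "col j \<in> C" unfolding C_def by (rule hull_inc) simp
    then have "b \<le> a \<bullet> col j" by (rule a)
    also have "\<dots> = S * (\<Sum>i\<in>UNIV. pmf x i * A i j)"
      using \<open>S > 0\<close> by (simp add: inner_vec_def col_def x sum_distrib_left)
    finally show ?thesis using bv \<open>S > 0\<close> by (meson mult_le_cancel_left_pos order_trans)
  qed
  show ?thesis using x_ge y_le by (rule that)
qed

lemma sum_pmf_UNIV [simp]: "(\<Sum>i\<in>UNIV. pmf (x :: 'a::finite pmf) i) = 1"
  by (rule sum_pmf_eq_1) auto

lemma pmf_avg_mono: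
  "(\<And>i. f i \<le> g i) \<Longrightarrow> (\<Sum>i\<in>UNIV. pmf (x :: 'a::finite pmf) i * f i) \<le> (\<Sum>i\<in>UNIV. pmf x i * g i)"
  by (intro sum_mono mult_left_mono) auto

lemma pmf_avg_const [simp]: "(\<Sum>i\<in>UNIV. pmf (x :: 'a::finite pmf) i * c) = c"
  by (simp add: sum_distrib_right[symmetric])

lemma pmf_avg_abs_le:
  assumes "\<And>i. \<bar>f i\<bar> \<le> c"
  shows "\<bar>\<Sum>i\<in>UNIV. pmf (x :: 'a::finite pmf) i * f i\<bar> \<le> c"
  using pmf_avg_mono[of f "\<lambda>_. c" x] pmf_avg_mono[of "\<lambda>_. - c" f x] assms
  by (simp add: abs_le_iff minus_le_iff pmf_avg_const[of x "- c", simplified])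

section \<open>Saddle points and values of matrix games\<close>

definition bilinear_payoff :: "('i::finite \<Rightarrow> 'j::finite \<Rightarrow> real) \<Rightarrow> 'i pmf \<Rightarrow> 'j pmf \<Rightarrow> real" where
  "bilinear_payoff A x y = (\<Sum>i\<in>UNIV. \<Sum>j\<in>UNIV. pmf x i * pmf y j * A i j)"

lemma bilinear_payoff_rows: "bilinear_payoff A x y = (\<Sum>i\<in>UNIV. pmf x i * (\<Sum>j\<in>UNIV. pmf y j * A i j))"
  by (simp add: bilinear_payoff_def sum_distrib_left mult.assoc)

lemma bilinear_payoff_columns: "bilinear_payoff A x y = (\<Sum>j\<in>UNIV. pmf y j * (\<Sum>i\<in>UNIV. pmf x i * A i j))"
  unfolding bilinear_payoff_def
  by (subst sum.swap) (simp add: sum_distrib_left mult_ac)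

lemma bilinear_payoff_add: "bilinear_payoff (\<lambda>i j. A i j + B i j) x y
  = bilinear_payoff A x y + bilinear_payoff B x y"
  by (simp add: bilinear_payoff_def algebra_simps sum.distrib)

lemma bilinear_payoff_cmult: "bilinear_payoff (\<lambda>i j. c * A i j) x y = c * bilinear_payoff A x y"
  by (simp add: bilinear_payoff_def sum_distrib_left mult_ac)

lemma bilinear_payoff_abs_le: "(\<And>i j. \<bar>A i j\<bar> \<le> c) \<Longrightarrow> \<bar>bilinear_payoff A x y\<bar> \<le> c"
  unfolding bilinear_payoff_rows by (intro pmf_avg_abs_le)

definition saddle :: "('i::finite \<Rightarrow> 'j::finite \<Rightarrow> real) \<Rightarrow> real \<Rightarrow> 'i pmf \<Rightarrow> 'j pmf \<Rightarrow> bool" where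
  "saddle A v x y \<longleftrightarrow> (\<forall>j. v \<le> (\<Sum>i\<in>UNIV. pmf x i * A i j)) \<and> (\<forall>i. (\<Sum>j\<in>UNIV. pmf y j * A i j) \<le> v)"

lemma saddle_exists: "\<exists>v x y. saddle A v x y"
  using matrix_game_minmax[of A] unfolding saddle_def by metis

lemma saddle_le: "saddle A v x y \<Longrightarrow> v \<le> bilinear_payoff A x y'"
  unfolding bilinear_payoff_columns saddle_def
  using pmf_avg_mono[of "\<lambda>_. v" "\<lambda>j. \<Sum>i\<in>UNIV. pmf x i * A i j" y'] by simp

lemma saddle_ge: "saddle A v x y \<Longrightarrow> bilinear_payoff A x' y \<le> v"
  unfolding bilinear_payoff_rows saddle_def
  using pmf_avg_mono[of "\<lambda>i. \<Sum>j\<in>UNIV. pmf y j * A i j" "\<lambda>_. v" x'] by simp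

text \<open>The optimal row strategy of one game is played against the optimal column strategy of
  the other. The same device later compares the local games at two different rates.\<close>

lemma saddle_value_mono:
  assumes "saddle A v x y" "saddle B w x' y'" "\<And>i j. A i j \<le> B i j + e"
  shows "v \<le> w + e"
proof -
  have "v \<le> bilinear_payoff A x y'" by (rule saddle_le) fact
  also have "\<dots> \<le> bilinear_payoff (\<lambda>i j. B i j + e) x y'"
    unfolding bilinear_payoff_rows by (intro pmf_avg_mono assms)
  also have "\<dots> = bilinear_payoff B x y' + e"
    unfolding bilinear_payoff_add by (simp add: bilinear_payoff_rows)
  also have "bilinear_payoff B x y' \<le> w" by (rule saddle_ge) fact
  finally show ?thesis by simp
qed

text \<open>The choice is harmless: \<open>saddle_value_mono\<close> with \<open>A = B\<close> and
  \<open>e = 0\<close>, used both ways, shows that all saddle values of one matrix agree.\<close>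

definition game_value :: "('i::finite \<Rightarrow> 'j::finite \<Rightarrow> real) \<Rightarrow> real" where
  "game_value A = (SOME v. \<exists>x y. saddle A v x y)"

lemma game_value: "\<exists>x y. saddle A (game_value A) x y"
  unfolding game_value_def using someI_ex[OF saddle_exists[of A]] .

lemma game_value_diff_le:
  assumes "\<And>i j. \<bar>A i j - B i j\<bar> \<le> e"
  shows "\<bar>game_value A - game_value B\<bar> \<le> e"
proof -
  obtain x y x' y' where s: "saddle A (game_value A) x y" "saddle B (game_value B) x' y'"
    using game_value by metis
  have "A i j \<le> B i j + e" "B i j \<le> A i j + e" for i j using assms[of i j] by auto
  from saddle_value_mono[OF s this(1)] saddle_value_mono[OF s(2,1) this(2)]
  show ?thesis by simp
qed

lemma game_value_abs_le:
  assumes "\<And>i j. \<bar>A i j\<bar> \<le> e"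
  shows "\<bar>game_value A\<bar> \<le> e"
proof -
  obtain x y where "saddle A (game_value A) x y" using game_value by blast
  then have "game_value A = bilinear_payoff A x y"
    by (intro antisym saddle_le saddle_ge)
  then show ?thesis using bilinear_payoff_abs_le[OF assms] by simp
qed

section \<open>Shapley's one-shot games and their common fixed point\<close>

definition next_value :: "('w::finite, 'i, 'j) stochastic_game \<Rightarrow> ('w \<Rightarrow> real) \<Rightarrow> 'w \<Rightarrow> 'i \<Rightarrow> 'j \<Rightarrow> real" where
  "next_value \<Gamma> v s i j = (\<Sum>s'\<in>UNIV. pmf (transition \<Gamma> s i j) s' * v s')"

definition local_game :: "('w::finite, 'i, 'j) stochastic_game \<Rightarrow> real \<Rightarrow> ('w \<Rightarrow> real) \<Rightarrow> 'w \<Rightarrow> 'i \<Rightarrow> 'j \<Rightarrow>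
  real" where
  "local_game \<Gamma> l v s i j = l * payoff \<Gamma> s i j + (1 - l) * next_value \<Gamma> v s i j"

definition shapley_solution ::
  "('w::finite, 'i::finite, 'j::finite) stochastic_game \<Rightarrow> real \<Rightarrow> ('w \<Rightarrow> real)
    \<Rightarrow> ('w \<Rightarrow> 'i pmf) \<Rightarrow> ('w \<Rightarrow> 'j pmf) \<Rightarrow> bool" where
  "shapley_solution \<Gamma> l v x y \<longleftrightarrow> (\<forall>s. saddle (local_game \<Gamma> l v s) (v s) (x s) (y s))"

definition payoff_bound :: "('w::finite, 'i::finite, 'j::finite) stochastic_game \<Rightarrow> real" where
  "payoff_bound \<Gamma> = Max (range (\<lambda>(s, i, j). \<bar>payoff \<Gamma> s i j\<bar>))"

lemma payoff_bound: "\<bar>payoff \<Gamma> s i j\<bar> \<le> payoff_bound \<Gamma>"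
  unfolding payoff_bound_def by (rule Max_ge) (auto intro: image_eqI[of _ _ "(s, i, j)"])

lemma payoff_bound_nonneg: "0 \<le> payoff_bound \<Gamma>"
  using payoff_bound[of \<Gamma> undefined undefined undefined] by linarith

text \<open>The Shapley operator maps the cube of vectors bounded by the largest payoff into itself
  and is nonexpansive in each coordinate, hence continuous. Brouwer's theorem gives the fixed point,
  for \<open>l = 0\<close> as well.\<close>

lemma shapley_solution_exists:
  fixes \<Gamma> :: "('w::finite, 'i::finite, 'j::finite) stochastic_game"
  assumes "0 \<le> l" "l \<le> 1"
  shows "\<exists>v x y. shapley_solution \<Gamma> l v x y"
proof -
  define c where "c = payoff_bound \<Gamma>"
  define B where "B = {u::real^'w. \<forall>s. \<bar>u $ s\<bar> \<le> c}"
  have Bbox: "B = cbox (\<chi> s. - c) (\<chi> s. c)"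
    by (auto simp: B_def mem_box_cart abs_le_iff minus_le_iff)
  define T where "T u = (\<chi> s. game_value (local_game \<Gamma> l (\<lambda>s. u $ s) s))" for u :: "real^'w"
  have diff: "\<bar>T u $ s - T u' $ s\<bar> \<le> dist u u'" for u u' s
    unfolding T_def vec_lambda_beta
  proof (rule game_value_diff_le)
    fix i j
    have "local_game \<Gamma> l (($) u) s i j - local_game \<Gamma> l (($) u') s i j
      = (1 - l) * (\<Sum>s'\<in>UNIV. pmf (transition \<Gamma> s i j) s' * (u $ s' - u' $ s'))"
      by (simp add: local_game_def next_value_def algebra_simps sum_subtractf)
    also have "\<bar>\<dots>\<bar> \<le> (1 - l) * dist u u'"
      unfolding abs_mult using assms
      by (auto intro!: mult_mono pmf_avg_abs_le simp: dist_norm)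
        (metis component_le_norm_cart vector_minus_component)
    also have "\<dots> \<le> dist u u'"
      using assms by (intro mult_left_le_one_le) auto
    finally show "\<bar>local_game \<Gamma> l (($) u) s i j - local_game \<Gamma> l (($) u') s i j\<bar> \<le> dist u u'" .
  qed
  have "continuous_on B (\<lambda>u. \<chi> s. T u $ s)"
  proof (rule continuous_on_vec_lambda)
    fix s
    show "continuous_on B (\<lambda>u. T u $ s)"
    proof (rule continuous_onI)
      fix u and e :: real assume "0 < e"
      then show "\<exists>d>0. \<forall>u'\<in>B. dist u' u < d \<longrightarrow> dist (T u' $ s) (T u $ s) \<le> e"
        using diff[of _ s u]
          by (intro exI[of _ e]) (auto simp: dist_real_def intro: order_trans less_imp_le)
    qed
  qed
  then have "continuous_on B T" by simp
  moreover have "T \<in> B \<rightarrow> B"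
  proof
    fix u assume u: "u \<in> B"
    have "\<bar>local_game \<Gamma> l (($) u) s i j\<bar> \<le> c" for s i j
    proof -
      have "\<bar>local_game \<Gamma> l (($) u) s i j\<bar> \<le> l * c + (1 - l) * c"
        unfolding local_game_def next_value_def
        using assms u payoff_bound[of \<Gamma> s i j]
        by (intro order_trans[OF abs_triangle_ineq] add_mono)
          (auto simp: abs_mult c_def B_def intro!: mult_left_mono pmf_avg_abs_le)
      then show ?thesis by (simp add: algebra_simps)
    qed
    then show "T u \<in> B"
      by (auto simp: B_def T_def intro: game_value_abs_le)
  qed
  moreover have "B \<noteq> {}" using payoff_bound_nonneg[of \<Gamma>] by (auto simp: B_def c_def intro!: exI[of _ 0])
  moreover have "compact B" "convex B" unfolding Bbox by auto
  ultimately obtain u where u: "u \<in> B" "T u = u"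
    using brouwer[of B T] by blast
  have "\<exists>x y. saddle (local_game \<Gamma> l (($) u) s) (u $ s) x y" for s
  proof -
    have "game_value (local_game \<Gamma> l (($) u) s) = u $ s"
      using u(2) by (simp add: T_def vec_eq_iff)
    with game_value[of "local_game \<Gamma> l (($) u) s"] show ?thesis by simp
  qed
  then show ?thesis unfolding shapley_solution_def by metis
qed

section \<open>Discounted payoffs\<close>

abbreviation (input) expected_value ::
  "('w::finite, 'i::finite, 'j::finite) stochastic_game \<Rightarrow> 'w \<Rightarrow> ('w, 'i, 'j, 'i) strategy
    \<Rightarrow> ('w, 'i, 'j, 'j) strategy \<Rightarrow> nat \<Rightarrow> ('w \<Rightarrow> real) \<Rightarrow> real" where
  "expected_value \<Gamma> \<omega> \<sigma> \<rho> k \<phi> \<equiv> stage_expectation \<Gamma> \<omega> \<sigma> \<rho> k (\<lambda>t. \<phi> (fst t))"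

abbreviation (input) expected_payoff ::
  "('w::finite, 'i::finite, 'j::finite) stochastic_game \<Rightarrow> 'w \<Rightarrow> ('w, 'i, 'j, 'i) strategy
    \<Rightarrow> ('w, 'i, 'j, 'j) strategy \<Rightarrow> nat \<Rightarrow> real" where
  "expected_payoff \<Gamma> \<omega> \<sigma> \<rho> k \<equiv> stage_expectation \<Gamma> \<omega> \<sigma> \<rho> k (\<lambda>(s, i, j). payoff \<Gamma> s i j)"

lemma expected_payoff_abs_le: "\<bar>expected_payoff \<Gamma> \<omega> \<sigma> \<rho> k\<bar> \<le> payoff_bound \<Gamma>"
  by (rule stage_expectation_abs_le) (auto simp: payoff_bound)

lemma expected_value_Suc:
  "expected_value \<Gamma> \<omega> \<sigma> \<rho> (Suc k) \<phi> = stage_expectation \<Gamma> \<omega> \<sigma> \<rho> k (\<lambda>(s, i, j). next_value \<Gamma> \<phi> s i j)"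
  unfolding stage_expectation_Suc next_value_def ..

text \<open>The coefficients are left free because three recursions pass through here:
  \<open>l\<close> and \<open>1 - l\<close> for discounted play, \<open>1\<close> and the number of
  stages left for the \<open>n\<close>-stage game, \<open>0\<close> and \<open>1\<close> for the
  drift of a function of the state.\<close>

lemma one_step_ge:
  fixes \<Gamma> :: "('w::finite, 'i::finite, 'j::finite) stochastic_game"
  assumes "\<And>h s. length h = k \<Longrightarrow>
    \<psi> s \<le> bilinear_payoff (\<lambda>i j. a * payoff \<Gamma> s i j + b * next_value \<Gamma> \<phi> s i j) (\<sigma> h s) (\<rho> h s)"
  shows "expected_value \<Gamma> \<omega> \<sigma> \<rho> k \<psi>
    \<le> a * expected_payoff \<Gamma> \<omega> \<sigma> \<rho> k + b * expected_value \<Gamma> \<omega> \<sigma> \<rho> (Suc k) \<phi>"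
proof -
  have "expected_value \<Gamma> \<omega> \<sigma> \<rho> k \<psi> \<le> stage_expectation \<Gamma> \<omega> \<sigma> \<rho> k
      (\<lambda>t. a * (case t of (s, i, j) \<Rightarrow> payoff \<Gamma> s i j) + b * (case t of (s, i, j) \<Rightarrow> next_value \<Gamma> \<phi> s i j))"
    by (rule stage_expectation_one_step) (use assms in \<open>auto simp: bilinear_payoff_def\<close>)
  then show ?thesis
    by (simp only: stage_expectation_add stage_expectation_cmult expected_value_Suc)
qed

lemma one_step_le:
  fixes \<Gamma> :: "('w::finite, 'i::finite, 'j::finite) stochastic_game"
  assumes "\<And>h s. length h = k \<Longrightarrow>
    bilinear_payoff (\<lambda>i j. a * payoff \<Gamma> s i j + b * next_value \<Gamma> \<phi> s i j) (\<sigma> h s) (\<rho> h s) \<le> \<psi> s"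
  shows "a * expected_payoff \<Gamma> \<omega> \<sigma> \<rho> k + b * expected_value \<Gamma> \<omega> \<sigma> \<rho> (Suc k) \<phi>
    \<le> expected_value \<Gamma> \<omega> \<sigma> \<rho> k \<psi>"
proof -
  have "- \<psi> s \<le> bilinear_payoff (\<lambda>i j. (- a) * payoff \<Gamma> s i j + (- b) * next_value \<Gamma> \<phi> s i j) (\<sigma> h s) (\<rho>
    h s)"
    if "length h = k" for h s
    using assms[OF that, of s] unfolding bilinear_payoff_add bilinear_payoff_cmult by simp
  then have "stage_expectation \<Gamma> \<omega> \<sigma> \<rho> k (\<lambda>t. - \<psi> (fst t))
    \<le> (- a) * expected_payoff \<Gamma> \<omega> \<sigma> \<rho> k + (- b) * expected_value \<Gamma> \<omega> \<sigma> \<rho> (Suc k) \<phi>"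
    by (rule one_step_ge[where \<psi>="\<lambda>s. - \<psi> s"])
  then show ?thesis
    using stage_expectation_cmult[of \<Gamma> \<omega> \<sigma> \<rho> k "-1" "\<lambda>t. \<psi> (fst t)"] by simp
qed

lemma one_step_eq:
  fixes \<Gamma> :: "('w::finite, 'i::finite, 'j::finite) stochastic_game"
  assumes "\<And>h s. length h = k \<Longrightarrow>
    bilinear_payoff (\<lambda>i j. a * payoff \<Gamma> s i j + b * next_value \<Gamma> \<phi> s i j) (\<sigma> h s) (\<rho> h s) = \<psi> s"
  shows "a * expected_payoff \<Gamma> \<omega> \<sigma> \<rho> k + b * expected_value \<Gamma> \<omega> \<sigma> \<rho> (Suc k) \<phi>
    = expected_value \<Gamma> \<omega> \<sigma> \<rho> k \<psi>"
  by (intro antisym one_step_le one_step_ge) (auto simp: assms)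

lemma stage_payoff_integral: "(\<integral>p. stage_payoff \<Gamma> (Suc k) p \<partial>play_measure \<Gamma> \<omega> \<sigma> \<rho>)
  = expected_payoff \<Gamma> \<omega> \<sigma> \<rho> k"
  unfolding stage_expectation_def stage_payoff_def by simp

lemma integrable_stage_payoff [simp]: "integrable (play_measure \<Gamma> \<omega> \<sigma> \<rho>) (\<lambda>p. stage_payoff \<Gamma> m p)"
  unfolding stage_payoff_def by (rule integrable_stage)

lemma integral_sum_stage_payoff:
  "(\<integral>p. c * (\<Sum>m=1..n. stage_payoff \<Gamma> m p) \<partial>play_measure \<Gamma> \<omega> \<sigma> \<rho>)
    = c * (\<Sum>k<n. expected_payoff \<Gamma> \<omega> \<sigma> \<rho> k)"
proof -
  have "(\<Sum>m=1..n. stage_payoff \<Gamma> m p) = (\<Sum>k<n. stage_payoff \<Gamma> (Suc k) p)" for p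
    by (rule sum.reindex_bij_witness[of _ Suc "\<lambda>m. m - 1"]) auto
  then show ?thesis
    by (simp add: stage_payoff_integral)
qed

lemma nstage_payoff_eq:
  "nstage_payoff \<Gamma> n \<omega> \<sigma> \<rho> = (\<Sum>k<n. expected_payoff \<Gamma> \<omega> \<sigma> \<rho> k) / n"
  unfolding nstage_payoff_def integral_sum_stage_payoff by simp

lemma stage_payoff_abs_le: "\<bar>stage_payoff \<Gamma> m p\<bar> \<le> payoff_bound \<Gamma>"
  unfolding stage_payoff_def by (auto simp: payoff_bound split: prod.split)

lemma summable_discounted:
  assumes "0 < l" "l \<le> 1" "\<And>k. \<bar>a k\<bar> \<le> (c::real)"
  shows "summable (\<lambda>k. \<bar>l * (1 - l) ^ k * a k\<bar>)" "summable (\<lambda>k. l * (1 - l) ^ k * a k)"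
proof -
  have bound: "\<bar>l * (1 - l) ^ k * a k\<bar> \<le> l * c * (1 - l) ^ k" for k
  proof -
    have "\<bar>l * (1 - l) ^ k * a k\<bar> = l * (1 - l) ^ k * \<bar>a k\<bar>"
      using assms(1,2) by (simp add: abs_mult)
    also have "\<dots> \<le> l * (1 - l) ^ k * c"
      using assms(1,2) by (intro mult_left_mono assms(3)) auto
    finally show ?thesis by (simp add: mult_ac)
  qed
  have "summable (\<lambda>k. l * c * (1 - l) ^ k)"
    using assms(1,2) by (intro summable_mult summable_geometric) auto
  then show "summable (\<lambda>k. \<bar>l * (1 - l) ^ k * a k\<bar>)"
    by (rule summable_comparison_test'[where N=0]) (simp only: real_norm_def abs_idempotent bound)
  then show "summable (\<lambda>k. l * (1 - l) ^ k * a k)"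
    by (rule summable_rabs_cancel)
qed

lemma discounted_payoff_eq:
  assumes l: "0 < l" "l \<le> 1"
  shows "discounted_payoff \<Gamma> l \<omega> \<sigma> \<rho> = (\<Sum>k. l * (1 - l) ^ k * expected_payoff \<Gamma> \<omega> \<sigma> \<rho> k)"
proof -
  interpret prob_space "play_measure \<Gamma> \<omega> \<sigma> \<rho>" by (rule prob_space_play_measure)
  have "discounted_payoff \<Gamma> l \<omega> \<sigma> \<rho>
    = (\<Sum>k. \<integral>p. l * (1 - l) ^ k * stage_payoff \<Gamma> (Suc k) p \<partial>play_measure \<Gamma> \<omega> \<sigma> \<rho>)"
    unfolding discounted_payoff_def
  proof (rule integral_suminf)
    show "AE p in play_measure \<Gamma> \<omega> \<sigma> \<rho>. summable (\<lambda>k. norm (l * (1 - l) ^ k * stage_payoff \<Gamma> (Suc k) p))"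
      by (rule AE_I2) (simp only: real_norm_def summable_discounted(1)[OF l stage_payoff_abs_le])
    have "(\<integral>p. \<bar>stage_payoff \<Gamma> (Suc k) p\<bar> \<partial>play_measure \<Gamma> \<omega> \<sigma> \<rho>)
      \<le> (\<integral>p. payoff_bound \<Gamma> \<partial>play_measure \<Gamma> \<omega> \<sigma> \<rho>)" for k
      by (intro integral_mono) (auto simp: stage_payoff_abs_le)
    then have *: "\<bar>\<integral>p. \<bar>stage_payoff \<Gamma> (Suc k) p\<bar> \<partial>play_measure \<Gamma> \<omega> \<sigma> \<rho>\<bar> \<le> payoff_bound \<Gamma>" for k
      by (simp add: prob_space)
    show "summable (\<lambda>k. \<integral>p. norm (l * (1 - l) ^ k * stage_payoff \<Gamma> (Suc k) p) \<partial>play_measure \<Gamma> \<omega> \<sigma> \<rho>)"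
      using summable_discounted(2)[OF l *] l by (simp add: abs_mult)
  qed simp
  then show ?thesis by (simp add: stage_payoff_integral)
qed

text \<open>Unrolling the recursion \<open>n\<close> times leaves the remainder
  \<open>(1 - l) ^ n * b n\<close>, which vanishes since \<open>b\<close> is bounded. In the
  applications \<open>b k\<close> is an expected continuation value.\<close>

lemma discounted_sum_ge:
  fixes a b :: "nat \<Rightarrow> real"
  assumes l: "0 < l" "l \<le> 1" and a: "\<And>k. \<bar>a k\<bar> \<le> A" and b: "\<And>k. \<bar>b k\<bar> \<le> B"
    and step: "\<And>k. b k \<le> l * a k + (1 - l) * b (Suc k)"
  shows "b 0 \<le> (\<Sum>k. l * (1 - l) ^ k * a k)"
proof -
  have "b 0 \<le> (\<Sum>k<n. l * (1 - l) ^ k * a k) + (1 - l) ^ n * b n" for n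
  proof (induction n)
    case (Suc n)
    have "(1 - l) ^ n * b n \<le> (1 - l) ^ n * (l * a n + (1 - l) * b (Suc n))"
      using l by (intro mult_left_mono step) auto
    with Suc show ?case by (simp add: algebra_simps)
  qed simp
  moreover have "(\<lambda>n. (1 - l) ^ n * b n) \<longlonglongrightarrow> 0"
  proof (rule tendsto_rabs_zero_cancel, rule tendsto_sandwich)
    show "\<forall>\<^sub>F n in sequentially. 0 \<le> \<bar>(1 - l) ^ n * b n\<bar>" by simp
    show "\<forall>\<^sub>F n in sequentially. \<bar>(1 - l) ^ n * b n\<bar> \<le> (1 - l) ^ n * B"
      using l b by (auto simp: abs_mult intro!: always_eventually mult_left_mono)
    show "(\<lambda>n. (1 - l) ^ n * B) \<longlonglongrightarrow> 0"
      using l by (auto intro!: tendsto_eq_intros LIMSEQ_power_zero)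
  qed simp
  then have "(\<lambda>n. (\<Sum>k<n. l * (1 - l) ^ k * a k) + (1 - l) ^ n * b n) \<longlonglongrightarrow> (\<Sum>k. l * (1 - l) ^ k * a k) + 0"
    by (intro tendsto_add summable_LIMSEQ summable_discounted(2)[OF l a])
  ultimately show ?thesis
    using LIMSEQ_le_const by fastforce
qed

lemma expected_value_abs_le: "\<bar>expected_value \<Gamma> \<omega> \<sigma> \<rho> k v\<bar> \<le> Max (range (\<lambda>s. \<bar>v s\<bar>))"
  by (rule stage_expectation_abs_le) (auto intro: Max_ge)

text \<open>The reply \<open>\<rho>\<close> may depend on the whole past: the saddle inequality at
  the current state holds against whatever mixed action \<open>\<rho>\<close> prescribes
  there.\<close>

lemma shapley_solution_guarantee1:
  assumes s: "shapley_solution \<Gamma> l v x y" and l: "0 < l" "l \<le> 1"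
  shows "v \<omega> \<le> discounted_payoff \<Gamma> l \<omega> (stationary x) \<rho>"
proof -
  have "expected_value \<Gamma> \<omega> (stationary x) \<rho> k v \<le>
    l * expected_payoff \<Gamma> \<omega> (stationary x) \<rho> k + (1 - l) * expected_value \<Gamma> \<omega> (stationary x) \<rho> (Suc k)
      v" for k
    by (rule one_step_ge)
      (use s in \<open>auto simp: shapley_solution_def stationary_def local_game_def[symmetric] intro!:
        saddle_le\<close>)
  then have "expected_value \<Gamma> \<omega> (stationary x) \<rho> 0 v
    \<le> (\<Sum>k. l * (1 - l) ^ k * expected_payoff \<Gamma> \<omega> (stationary x) \<rho> k)"
    by (rule discounted_sum_ge[where b="\<lambda>k. expected_value \<Gamma> \<omega> (stationary x) \<rho> k v",
        OF l expected_payoff_abs_le expected_value_abs_le])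
  then show ?thesis unfolding discounted_payoff_eq[OF l] stage_expectation_0 .
qed

lemma shapley_solution_guarantee2:
  assumes s: "shapley_solution \<Gamma> l v x y" and l: "0 < l" "l \<le> 1"
  shows "discounted_payoff \<Gamma> l \<omega> \<sigma> (stationary y) \<le> v \<omega>"
proof -
  have "l * expected_payoff \<Gamma> \<omega> \<sigma> (stationary y) k + (1 - l) * expected_value \<Gamma> \<omega> \<sigma> (stationary y) (Suc k) v
      \<le> expected_value \<Gamma> \<omega> \<sigma> (stationary y) k v" for k
    by (rule one_step_le)
      (use s in \<open>auto simp: shapley_solution_def stationary_def local_game_def[symmetric] intro!:
        saddle_ge\<close>)
  then have step: "- expected_value \<Gamma> \<omega> \<sigma> (stationary y) k v
    \<le> l * (- expected_payoff \<Gamma> \<omega> \<sigma> (stationary y) k)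
      + (1 - l) * (- expected_value \<Gamma> \<omega> \<sigma> (stationary y) (Suc k) v)" for k
    by (simp add: algebra_simps)
  have "- expected_value \<Gamma> \<omega> \<sigma> (stationary y) 0 v
    \<le> (\<Sum>k. l * (1 - l) ^ k * (- expected_payoff \<Gamma> \<omega> \<sigma> (stationary y) k))"
    by (rule discounted_sum_ge[where b="\<lambda>k. - expected_value \<Gamma> \<omega> \<sigma> (stationary y) k v", OF l _ _ step])
      (unfold abs_minus_cancel, rule expected_payoff_abs_le, rule expected_value_abs_le)
  also have "\<dots> = - (\<Sum>k. l * (1 - l) ^ k * expected_payoff \<Gamma> \<omega> \<sigma> (stationary y) k)"
    using suminf_minus[OF summable_discounted(2)[OF l expected_payoff_abs_le]] by simp
  finally show ?thesis unfolding discounted_payoff_eq[OF l] stage_expectation_0 by simp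
qed

lemma SUP_INF_ge:
  fixes P :: "'a \<Rightarrow> 'b \<Rightarrow> real"
  assumes "\<And>a b. \<bar>P a b\<bar> \<le> C" "\<And>b. c \<le> P a0 b"
  shows "c \<le> (SUP a. INF b. P a b)"
proof -
  have bdd: "bdd_below (range (P a))" for a
    using assms(1)[of a] by (intro bdd_belowI[of _ "- C"]) (auto simp: abs_le_iff minus_le_iff)
  have "(INF b. P a b) \<le> C" for a
    using cINF_lower[OF bdd[of a], of undefined] assms(1)[of a undefined] by simp
  then have "bdd_above (range (\<lambda>a. INF b. P a b))" by (intro bdd_aboveI[of _ C]) auto
  then show ?thesis
    by (rule cSUP_upper2[where x=a0]) (auto intro!: cINF_greatest assms)
qed

lemma SUP_INF_le:
  fixes P :: "'a \<Rightarrow> 'b \<Rightarrow> real"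
  assumes "\<And>a b. \<bar>P a b\<bar> \<le> C" "\<And>a. P a b0 \<le> c"
  shows "(SUP a. INF b. P a b) \<le> c"
proof (rule cSUP_least)
  fix a
  have "bdd_below (range (P a))"
    using assms(1)[of a] by (intro bdd_belowI[of _ "- C"]) (auto simp: abs_le_iff minus_le_iff)
  then show "(INF b. P a b) \<le> c"
    by (rule cINF_lower2[where x=b0]) (auto intro: assms)
qed simp

lemma discounted_payoff_abs_le:
  assumes l: "0 < l" "l \<le> 1"
  shows "\<bar>discounted_payoff \<Gamma> l \<omega> \<sigma> \<rho>\<bar> \<le> payoff_bound \<Gamma>"
proof -
  define c where "c = payoff_bound \<Gamma>"
  define a where "a k = expected_payoff \<Gamma> \<omega> \<sigma> \<rho> k" for k
  have a: "\<bar>a k\<bar> \<le> c" for k unfolding c_def a_def by (rule expected_payoff_abs_le)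
  have c: "0 \<le> c" unfolding c_def by (rule payoff_bound_nonneg)
  have step: "- c \<le> l * e k + (1 - l) * - c" if "\<And>k. \<bar>e k\<bar> \<le> c" for e and k :: nat
  proof -
    have "l * - c \<le> l * e k" using that[of k] l by (intro mult_left_mono) auto
    then show ?thesis by (simp add: algebra_simps)
  qed
  have lower: "- c \<le> (\<Sum>k. l * (1 - l) ^ k * a k)"
    by (rule discounted_sum_ge[where b="\<lambda>_. - c", OF l a _ step[OF a], of c]) (use c in auto)
  have a': "\<bar>- a k\<bar> \<le> c" for k using a by simp
  have "- c \<le> (\<Sum>k. l * (1 - l) ^ k * - a k)"
  proof (rule discounted_sum_ge[where b="\<lambda>_. - c" and a="\<lambda>k. - a k" and A=c and B=c, OF l a'])
    show "- c \<le> l * - a k + (1 - l) * - c" for k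
      by (rule step[where e="\<lambda>k. - a k", OF a'])
  qed (use c in simp)
  with lower show ?thesis
    unfolding discounted_payoff_eq[OF l] c_def[symmetric] a_def[symmetric]
    using suminf_minus[OF summable_discounted(2)[OF l a]] by (simp add: abs_le_iff)
qed

text \<open>The two guarantees enclose the sup-inf over all strategies between \<open>v\<close> and
  \<open>v\<close>. In particular the solution \<open>v\<close> is unique for each rate in
  \<open>(0, 1]\<close>.\<close>

lemma shapley_solution_discounted_value:
  assumes s: "shapley_solution \<Gamma> l v x y" and l: "0 < l" "l \<le> 1"
  shows "discounted_value \<Gamma> l = v"
proof
  fix \<omega>
  show "discounted_value \<Gamma> l \<omega> = v \<omega>"
    unfolding discounted_value_def
  proof (rule antisym)
    show "(SUP \<sigma>. INF \<rho>. discounted_payoff \<Gamma> l \<omega> \<sigma> \<rho>) \<le> v \<omega>"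
      by (rule SUP_INF_le) (rule discounted_payoff_abs_le[OF l], rule shapley_solution_guarantee2[OF s l])
    show "v \<omega> \<le> (SUP \<sigma>. INF \<rho>. discounted_payoff \<Gamma> l \<omega> \<sigma> \<rho>)"
      by (rule SUP_INF_ge) (rule discounted_payoff_abs_le[OF l], rule shapley_solution_guarantee1[OF s l])
  qed
qed

lemma shapley_solution_optimal:
  assumes s: "shapley_solution \<Gamma> l v x y" and l: "0 < l" "l \<le> 1"
  shows "optimal1 \<Gamma> l (stationary x)" "optimal2 \<Gamma> l (stationary y)"
  unfolding optimal1_def optimal2_def shapley_solution_discounted_value[OF s l]
  using shapley_solution_guarantee1[OF s l] shapley_solution_guarantee2[OF s l] by auto

lemma shapley_solution_abs_le:
  assumes s: "shapley_solution \<Gamma> l v x y" and l: "0 < l" "l \<le> 1"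
  shows "\<bar>v \<omega>\<bar> \<le> payoff_bound \<Gamma>"
proof -
  have "v \<omega> = discounted_payoff \<Gamma> l \<omega> (stationary x) (stationary y)"
    by (intro antisym shapley_solution_guarantee1[OF s l] shapley_solution_guarantee2[OF s l])
  then show ?thesis using discounted_payoff_abs_le[OF l] by simp
qed

section \<open>Bounded algebraic functions\<close>

text \<open>The coefficients of \<open>P\<close> are polynomials in \<open>l\<close>.\<close>

definition poly2 :: "real poly poly \<Rightarrow> real \<Rightarrow> real \<Rightarrow> real" where
  "poly2 P l z = poly (poly P [:z:]) l"

lemma poly2_simps [simp]:
  "poly2 0 l z = 0" "poly2 1 l z = 1" "poly2 (P + Q) l z = poly2 P l z + poly2 Q l z"
  "poly2 (P - Q) l z = poly2 P l z - poly2 Q l z" "poly2 (- P) l z = - poly2 P l z"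
  "poly2 (P * Q) l z = poly2 P l z * poly2 Q l z" "poly2 [:c:] l z = poly c l"
  "poly2 (smult c P) l z = poly c l * poly2 P l z" "poly2 (pCons c P) l z = poly c l + z * poly2 P l z"
  by (simp_all add: poly2_def)

lemma poly2_sum: "poly2 (\<Sum>x\<in>A. f x) l z = (\<Sum>x\<in>A. poly2 (f x) l z)"
  by (induction A rule: infinite_finite_induct) auto

lemma poly2_prod: "poly2 (\<Prod>x\<in>A. f x) l z = (\<Prod>x\<in>A. poly2 (f x) l z)"
  by (induction A rule: infinite_finite_induct) auto

lemma poly2_pderiv: "((\<lambda>z. poly2 P l z) has_real_derivative poly2 (pderiv P) l z) (at z)"
proof (induction P)
  case (pCons c P)
  show ?case
    unfolding poly2_simps pderiv_pCons
    by (rule derivative_eq_intros pCons.IH refl | simp)+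
qed simp

lemma isCont_poly2:
  assumes "isCont f l"
  shows "isCont (\<lambda>l. poly2 P l (f l)) l"
proof (induction P)
  case (pCons c P)
  then show ?case using assms by (auto intro!: continuous_intros poly_isCont)
qed simp

text \<open>Bezout's identity over the field of rational functions in \<open>l\<close>, with
  denominators cleared. A combination \<open>G\<close> of least degree in \<open>z\<close> divides
  both \<open>P\<close> and \<open>Q\<close> up to factors that are polynomials in \<open>l\<close>.
  If \<open>P\<close> involves \<open>z\<close>, then \<open>P\<close> cannot divide
  \<open>G\<close>, since it would then divide \<open>Q\<close>; so it divides the cofactor of
  \<open>G\<close>, which leaves \<open>G\<close> with degree zero in \<open>z\<close>.\<close>

lemma prime_bezout:
  fixes P Q :: "real poly poly"
  assumes P: "prime_elem P" and Q: "\<not> P dvd Q"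
  shows "\<exists>A B R. R \<noteq> 0 \<and> A * P + B * Q = [:R:]"
proof -
  define I where "I = {A * P + B * Q | A B. A * P + B * Q \<noteq> 0}"
  have "P \<in> I" unfolding I_def mem_Collect_eq
    by (rule exI[of _ 1], rule exI[of _ 0]) (use P in \<open>auto simp: prime_elem_def\<close>)
  then obtain G where G: "G \<in> I" "\<And>H. H \<in> I \<Longrightarrow> degree G \<le> degree H"
    using ex_has_least_nat[of "\<lambda>G. G \<in> I" P degree] by auto
  obtain A B where AB: "G = A * P + B * Q" and G0: "G \<noteq> 0" using G(1) unfolding I_def by auto
  \<comment> \<open>Pseudo-division scales \<open>F\<close> by a nonzero polynomial in
    \<open>l\<close>. The remainder is again a combination of \<open>P\<close> and \<open>Q\<close>,
    of smaller degree than \<open>G\<close>, hence zero.\<close>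
  have ex: "\<exists>c S. c \<noteq> 0 \<and> smult c F = G * S" if F: "\<exists>A B. F = A * P + B * Q" for F
  proof -
    define R where "R = pseudo_mod F G"
    obtain a q where aq: "a \<noteq> 0" "smult a F = G * q + R" "R = 0 \<or> degree R < degree G"
      using pseudo_mod[OF G0, of F] unfolding R_def by auto
    obtain A' B' where F': "F = A' * P + B' * Q" using F by auto
    have "R = smult a F - G * q" using aq by simp
    also have "\<dots> = (smult a A' - A * q) * P + (smult a B' - B * q) * Q"
      unfolding F' AB by (simp add: algebra_simps smult_add_right)
    finally have "R = 0"
      using G(2)[of R] aq(3) unfolding I_def by fastforce
    with aq show ?thesis by auto
  qed
  have "\<exists>A B. P = A * P + B * Q" "\<exists>A B. Q = A * P + B * Q"
    by (rule exI[of _ 1], rule exI[of _ 0], simp) (rule exI[of _ 0], rule exI[of _ 1], simp)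
  from ex[OF this(1)] ex[OF this(2)] obtain c S d T
    where c: "c \<noteq> 0" "smult c P = G * S" and d: "d \<noteq> 0" "smult d Q = G * T" by auto
  show ?thesis
  proof (cases "degree P = 0")
    case True
    then obtain R where "P = [:R:]" by (metis degree_eq_zeroE)
    with P show ?thesis by (intro exI[of _ 1] exI[of _ 0] exI[of _ R]) (auto simp: prime_elem_def)
  next
    case False
    have ndvd: "\<not> P dvd [:e:]" if "e \<noteq> 0" for e
      using False dvd_imp_degree_le[of P "[:e:]"] that by auto
    have "\<not> P dvd G"
    proof
      assume "P dvd G"
      then have "P dvd [:d:] * Q" using d(2) by simp
      then show False using prime_elem_dvd_multD[OF P] ndvd[OF d(1)] Q by blast
    qed
    moreover have "P dvd G * S" using c(2) by (metis dvd_smult dvd_refl)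
    ultimately have "P dvd S" using prime_elem_dvd_multD[OF P] by blast
    then obtain U where U: "S = P * U" by auto
    have "P \<noteq> 0" using P by auto
    have "[:c:] * P = (G * U) * P" using c(2) U by (simp add: mult_ac)
    then have GU: "G * U = [:c:]" using \<open>P \<noteq> 0\<close> mult_right_cancel[of P "[:c:]" "G * U"] by auto
    then have "U \<noteq> 0" using c(1) by auto
    then have "degree G + degree U = 0" using degree_mult_eq[OF G0, of U] GU by simp
    then obtain R where "G = [:R:]" by (metis add_eq_0_iff_both_eq_0 degree_eq_zeroE)
    with G0 AB show ?thesis by (metis pCons_0_0)
  qed
qed

lemma eventually_at_right_0_iff:
  "eventually P (at_right (0::real)) \<longleftrightarrow> (\<exists>e>0. \<forall>l. 0 < l \<and> l < e \<longrightarrow> P l)"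
  unfolding eventually_at_right[OF zero_less_one] by auto

lemma eventually_poly_nonzero:
  assumes "(R :: real poly) \<noteq> 0"
  shows "\<forall>\<^sub>F l in at_right 0. poly R l \<noteq> 0"
proof -
  have "\<forall>\<^sub>F l in at 0. poly R l \<noteq> 0"
    using poly_roots_finite[OF assms] islimpt_finite[of "{l. poly R l = 0}" 0]
    by (auto simp: islimpt_iff_eventually eventually_at_filter frequently_def)
  then show ?thesis by (simp add: eventually_at_split)
qed

text \<open>At a common zero the Bezout combination makes a fixed nonzero polynomial in
  \<open>l\<close> vanish, and such a polynomial has no zeros in a punctured neighbourhood of
  \<open>0\<close>.\<close>

lemma prime_eventually_no_common_zero:
  assumes "prime_elem P" "\<not> P dvd Q"
  shows "\<forall>\<^sub>F l in at_right 0. \<forall>z. poly2 P l z = 0 \<longrightarrow> poly2 Q l z \<noteq> 0"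
proof -
  obtain A B R where R: "R \<noteq> 0" "A * P + B * Q = [:R:]" using prime_bezout[OF assms] by auto
  have "poly2 (A * P + B * Q) l z = poly R l" for l z unfolding R(2) by simp
  then have *: "poly2 A l z * poly2 P l z + poly2 B l z * poly2 Q l z = poly R l" for l z by simp
  show ?thesis
    using eventually_poly_nonzero[OF R(1)]
  proof eventually_elim
    case (elim l)
    then show ?case using *[of l] by (auto, metis add_0 mult_zero_right)
  qed
qed

text \<open>Near \<open>0\<close>, the zero sets of the prime factors of \<open>P\<close> along \<open>f\<close> are closed, disjoint, and cover an
  interval, so that only one of them is not empty.\<close>

lemma algebraic_prime:
  fixes f :: "real \<Rightarrow> real"
  assumes P: "P \<noteq> 0" "\<And>l. 0 < l \<Longrightarrow> l \<le> 1 \<Longrightarrow> poly2 P l (f l) = 0"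
    and cont: "\<And>l. 0 < l \<Longrightarrow> l < 1 \<Longrightarrow> isCont f l"
  shows "\<exists>p. prime_elem p \<and> (\<forall>\<^sub>F l in at_right 0. poly2 p l (f l) = 0)"
proof -
  define F where "F = prime_factors P"
  have F: "finite F" "\<And>p. p \<in> F \<Longrightarrow> prime_elem p"
    unfolding F_def by (auto dest: in_prime_factors_imp_prime)
  have "\<forall>p\<in>F. \<forall>q\<in>F - {p}. \<forall>\<^sub>F l in at_right 0. \<forall>z. poly2 p l z = 0 \<longrightarrow> poly2 q l z \<noteq> 0"
  proof (intro ballI prime_eventually_no_common_zero F)
    fix p q assume "p \<in> F" "q \<in> F - {p}"
    then show "\<not> p dvd q"
      using primes_dvd_imp_eq[of p q] unfolding F_def by (auto dest: in_prime_factors_imp_prime)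
  qed
  then have "\<forall>\<^sub>F l in at_right 0. \<forall>p\<in>F. \<forall>q\<in>F - {p}. \<forall>z. poly2 p l z = 0 \<longrightarrow> poly2 q l z \<noteq> 0"
    using F(1) by (simp add: eventually_ball_finite_distrib)
  then obtain e0 where e0: "e0 > 0" "\<And>l p q z. 0 < l \<Longrightarrow> l < e0 \<Longrightarrow> p \<in> F \<Longrightarrow> q \<in> F \<Longrightarrow> p \<noteq> q \<Longrightarrow>
      poly2 p l z = 0 \<Longrightarrow> poly2 q l z \<noteq> 0"
    unfolding eventually_at_right_0_iff by blast
  define e where "e = min e0 1"
  define S where "S = {0<..<e}"
  have S: "connected S" "S \<noteq> {}" "e > 0" unfolding S_def e_def using e0(1)
    by (auto simp: min_def intro: dense)
  have contp: "continuous_on S (\<lambda>l. poly2 p l (f l))" for p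
    by (intro continuous_at_imp_continuous_on ballI isCont_poly2 cont) (auto simp: S_def e_def)
  have ex: "\<exists>p\<in>F. poly2 p l (f l) = 0" if "l \<in> S" for l
  proof -
    have "poly2 P l (f l) = 0" using that by (intro P) (auto simp: S_def e_def)
    \<comment> \<open>The product of the prime factors equals \<open>P\<close> only up to a unit;
      divisibility is enough to transport the zero.\<close>
    moreover have "P dvd prod_mset (prime_factorization P)"
      using prod_mset_prime_factorization_weak[OF P(1)] by (metis associatedD2)
    then obtain u where "prod_mset (prime_factorization P) = P * u" by auto
    ultimately have "poly2 (prod_mset (prime_factorization P)) l (f l) = 0" by simp
    moreover have "poly2 (prod_mset M) l (f l) = 0 \<Longrightarrow> \<exists>p\<in>#M. poly2 p l (f l) = 0" for M
      by (induction M) auto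
    ultimately show ?thesis unfolding F_def by auto
  qed
  obtain l0 where l0: "l0 \<in> S" using S(2) by auto
  then obtain p where p: "p \<in> F" "poly2 p l0 (f l0) = 0" using ex by auto
  define Z where "Z q = {l \<in> S. poly2 q l (f l) = 0}" for q
  have Z: "closedin (top_of_set S) (Z q)" for q
  proof -
    have "Z q = S \<inter> (\<lambda>l. poly2 q l (f l)) -` {0}" unfolding Z_def by auto
    then show ?thesis using continuous_closedin_preimage[OF contp, of "{0}"] by simp
  qed
  define W where "W = \<Union>(Z ` (F - {p}))"
  have "closedin (top_of_set S) W" unfolding W_def
    by (rule closedin_Union) (use F(1) Z in auto)
  moreover have "S \<subseteq> Z p \<union> W" using ex unfolding Z_def W_def by blast
  moreover have "Z p \<inter> W = {}"
    unfolding Z_def W_def using e0(2)[OF _ _ p(1)] by (auto simp: S_def e_def)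
  moreover have "Z p \<noteq> {}" using l0 p by (auto simp: Z_def)
  ultimately have "W = {}"
    using S(1) Z[of p] unfolding connected_closedin by blast
  then have "S \<subseteq> Z p" using \<open>S \<subseteq> Z p \<union> W\<close> by simp
  then have "\<forall>\<^sub>F l in at_right 0. poly2 p l (f l) = 0"
    unfolding eventually_at_right_0_iff using S(3) by (intro exI[of _ e]) (auto simp: Z_def S_def)
  then show ?thesis using F(2)[OF p(1)] by blast
qed

text \<open>Caratheodory's form of the partial derivative in \<open>l\<close>, which is the one of
  \<open>map_poly pderiv P\<close>. The second argument \<open>f l\<close> moves along with
  \<open>l\<close>, so the slope function \<open>g\<close> must absorb it and remain continuous at
  \<open>l0\<close>.\<close>

lemma poly2_difference_first:
  assumes "isCont f l0"
  shows "\<exists>g. isCont g l0 \<and> g l0 = poly2 (map_poly pderiv P) l0 (f l0) \<and>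
    (\<forall>l. poly2 P l (f l) - poly2 P l0 (f l) = g l * (l - l0))"
proof (induction P)
  case 0
  show ?case by (rule exI[of _ "\<lambda>_. 0"]) auto
next
  case (pCons c P)
  obtain g where g: "isCont g l0" "g l0 = poly2 (map_poly pderiv P) l0 (f l0)"
    "\<And>l. poly2 P l (f l) - poly2 P l0 (f l) = g l * (l - l0)" using pCons.IH by auto
  obtain k where k: "\<And>l. poly c l - poly c l0 = k l * (l - l0)" "isCont k l0" "k l0 = poly (pderiv c) l0"
    using poly_DERIV[of c l0] unfolding CARAT_DERIV by auto
  have "poly2 (pCons c P) l (f l) - poly2 (pCons c P) l0 (f l) = (k l + f l * g l) * (l - l0)" for l
    using k(1)[of l] arg_cong[OF g(3)[of l], of "\<lambda>x. f l * x"] by (simp add: algebra_simps)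
  then show ?case
    using g k assms by (intro exI[of _ "\<lambda>l. k l + f l * g l"]) (auto simp: map_poly_pCons)
qed

text \<open>Implicit differentiation along a continuous branch that is already given. The increment
  of \<open>P\<close> splits into \<open>g l * (l - l0)\<close> and
  \<open>h (f l) * (f l - f l0)\<close>; their sum is zero, and \<open>h (f l)\<close> stays away
  from zero near \<open>l0\<close>.\<close>

lemma algebraic_has_derivative:
  assumes cont: "isCont f l0" and zero: "\<forall>\<^sub>F l in nhds l0. poly2 P l (f l) = 0"
    and Pz: "poly2 (pderiv P) l0 (f l0) \<noteq> 0"
  shows "(f has_real_derivative - poly2 (map_poly pderiv P) l0 (f l0) / poly2 (pderiv P) l0 (f l0)) (at l0)"
proof -
  obtain g where g: "isCont g l0" "g l0 = poly2 (map_poly pderiv P) l0 (f l0)"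
    "\<And>l. poly2 P l (f l) - poly2 P l0 (f l) = g l * (l - l0)"
    using poly2_difference_first[OF cont] by blast
  obtain h where h: "\<And>z. poly2 P l0 z - poly2 P l0 (f l0) = h z * (z - f l0)" "isCont h (f l0)"
      "h (f l0) = poly2 (pderiv P) l0 (f l0)"
    using poly2_pderiv[of P l0 "f l0"] unfolding CARAT_DERIV by auto
  have hf: "isCont (\<lambda>l. h (f l)) l0" using isCont_o2[OF cont h(2)] .
  have z0: "poly2 P l0 (f l0) = 0" using eventually_nhds_x_imp_x[OF zero] .
  have "\<forall>\<^sub>F l in at l0. h (f l) \<noteq> 0"
    using hf Pz unfolding h(3)[symmetric] isCont_def by (rule tendsto_imp_eventually_ne)
  moreover have "\<forall>\<^sub>F l in at l0. poly2 P l (f l) = 0"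
    using zero by (simp add: eventually_at_filter eventually_mono)
  moreover have "\<forall>\<^sub>F l in at l0. l \<noteq> l0" by (simp add: eventually_at_filter)
  ultimately have "\<forall>\<^sub>F l in at l0. - g l / h (f l) = (f l - f l0) / (l - l0)"
  proof eventually_elim
    case (elim l)
    have "g l * (l - l0) + h (f l) * (f l - f l0) = 0"
      using g(3)[of l] h(1)[of "f l"] elim z0 by simp
    then show ?case using elim by (simp add: field_simps)
  qed
  moreover have "((\<lambda>l. - g l / h (f l)) \<longlongrightarrow> - g l0 / h (f l0)) (at l0)"
    using g(1) hf Pz unfolding isCont_def h(3)[symmetric] by (intro tendsto_intros)
  ultimately show ?thesis
    unfolding has_field_derivative_iff g(2)[symmetric] h(3)[symmetric]
    by (rule Lim_transform_eventually[rotated])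
qed

text \<open>Otherwise \<open>f l - c * ln l\<close> would be nondecreasing, which would force
  \<open>f\<close> to \<open>-\<infinity>\<close> at \<open>0\<close>.\<close>

lemma not_log_derivative_ge:
  fixes f f' :: "real \<Rightarrow> real"
  assumes e: "0 < e" and d: "\<And>l. 0 < l \<Longrightarrow> l < e \<Longrightarrow> (f has_real_derivative f' l) (at l)"
    and b: "\<And>l. 0 < l \<Longrightarrow> l < e \<Longrightarrow> \<bar>f l\<bar> \<le> C" and c: "0 < c"
  shows "\<not> (\<forall>l. 0 < l \<and> l < e \<longrightarrow> c \<le> l * f' l)"
proof
  assume *: "\<forall>l. 0 < l \<and> l < e \<longrightarrow> c \<le> l * f' l"
  define u where "u = e / 2"
  have u: "0 < u" "u < e" using e by (auto simp: u_def)
  have C: "0 \<le> C" using b[OF u] by simp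
  \<comment> \<open>Chosen so that \<open>c * ln l\<close> lies \<open>2 * C + 1\<close> below
    \<open>c * ln u\<close>, while \<open>f\<close> can change by at most
    \<open>2 * C\<close>.\<close>
  define l where "l = u * exp (- (2 * C + 1) / c)"
  have l: "0 < l" "l < u" using u C c by (auto simp: l_def divide_neg_pos)
  have "f l - c * ln l \<le> f u - c * ln u"
  proof (rule DERIV_nonneg_imp_nondecreasing[where f="\<lambda>l. f l - c * ln l"])
    fix x assume x: "l \<le> x" "x \<le> u"
    then have x': "0 < x" "x < e" using l u by auto
    then have "0 \<le> f' x - c * (1 / x)" using *[rule_format, of x] by (simp add: field_simps)
    moreover have "((\<lambda>l. f l - c * ln l) has_real_derivative f' x - c * (1 / x)) (at x)"
      using x' by (auto intro!: derivative_eq_intros d simp: field_simps)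
    ultimately show "\<exists>y. ((\<lambda>l. f l - c * ln l) has_real_derivative y) (at x) \<and> 0 \<le> y" by blast
  qed (use l in simp)
  moreover have "ln l = ln u - (2 * C + 1) / c" using u c by (simp add: l_def ln_mult field_simps)
  then have "c * ln l = c * ln u - (2 * C + 1)" using c by (simp add: field_simps)
  moreover have "\<bar>f l\<bar> \<le> C" "\<bar>f u\<bar> \<le> C" using b l u by auto
  ultimately show False by linarith
qed

lemma continuous_nonvanishing_sign:
  fixes w :: "real \<Rightarrow> real"
  assumes "continuous_on S w" "connected S" "\<And>l. l \<in> S \<Longrightarrow> w l \<noteq> c"
  shows "(\<forall>l\<in>S. w l > c) \<or> (\<forall>l\<in>S. w l < c)"
proof (rule ccontr)
  assume "\<not> ?thesis"
  then obtain a b where "a \<in> S" "b \<in> S" "w a \<le> c" "c \<le> w b" by (auto simp: not_less)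
  then have "c \<in> w ` S"
    using connectedD_interval[OF connected_continuous_image[OF assms(1,2)], of "w a" "w b" c] by auto
  then show False using assms(3) by auto
qed

text \<open>For every constant \<open>c\<close>, \<open>l f' l = c\<close> is a polynomial equation in \<open>l\<close> and \<open>f l\<close>, which near \<open>0\<close> holds
  always or never. Hence \<open>l f' l\<close> has a limit, which is \<open>0\<close> since \<open>f\<close> would otherwise grow like \<open>ln l\<close>.\<close>

theorem bounded_algebraic_function:
  fixes f :: "real \<Rightarrow> real"
  assumes P: "P \<noteq> 0" "\<And>l. 0 < l \<Longrightarrow> l \<le> 1 \<Longrightarrow> poly2 P l (f l) = 0"
    and cont: "\<And>l. 0 < l \<Longrightarrow> l < 1 \<Longrightarrow> isCont f l"
    and bound: "\<And>l. 0 < l \<Longrightarrow> l < 1 \<Longrightarrow> \<bar>f l\<bar> \<le> C"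
  obtains e f' L where "0 < e" "e \<le> 1" "\<And>l. 0 < l \<Longrightarrow> l < e \<Longrightarrow> (f has_real_derivative f' l) (at l)"
    "((\<lambda>l. l * f' l) \<longlongrightarrow> 0) (at_right 0)" "(f \<longlongrightarrow> L) (at_right 0)"
proof -
  obtain p where p: "prime_elem p" "\<forall>\<^sub>F l in at_right 0. poly2 p l (f l) = 0"
    using algebraic_prime[OF P cont] by auto
  have deg: "degree p \<noteq> 0"
  proof
    assume "degree p = 0"
    then obtain c where c: "p = [:c:]" by (metis degree_eq_zeroE)
    then have "c \<noteq> 0" using p(1) by (auto simp: prime_elem_def)
    from eventually_conj[OF eventually_poly_nonzero[OF this] p(2)]
    have "\<forall>\<^sub>F l in at_right (0::real). False" unfolding c by simp
    then show False by simp
  qed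
  \<comment> \<open>By degree in \<open>z\<close>. Hence the curve has no vertical tangent or
    singular point on the graph of \<open>f\<close> near \<open>0\<close>, and \<open>f\<close> can
    be differentiated implicitly.\<close>
  have "\<not> p dvd pderiv p"
  proof
    assume "p dvd pderiv p"
    moreover have "pderiv p \<noteq> 0" using deg by (simp add: pderiv_eq_0_iff)
    ultimately have "degree p \<le> degree (pderiv p)" by (rule dvd_imp_degree_le)
    then show False using deg by (simp add: degree_pderiv)
  qed
  from prime_eventually_no_common_zero[OF p(1) this] p(2)
  have "\<forall>\<^sub>F l in at_right 0. poly2 p l (f l) = 0 \<and> poly2 (pderiv p) l (f l) \<noteq> 0"
    by eventually_elim auto
  then obtain e0 where e0: "e0 > 0" "\<And>l. 0 < l \<Longrightarrow> l < e0 \<Longrightarrow> poly2 p l (f l) = 0"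
    "\<And>l. 0 < l \<Longrightarrow> l < e0 \<Longrightarrow> poly2 (pderiv p) l (f l) \<noteq> 0"
    unfolding eventually_at_right_0_iff by blast
  define e where "e = min e0 1"
  have e: "0 < e" "e \<le> 1" "e \<le> e0" using e0(1) by (auto simp: e_def)
  define Pl where "Pl = map_poly pderiv p"
  define f' where "f' l = - poly2 Pl l (f l) / poly2 (pderiv p) l (f l)" for l
  have d: "(f has_real_derivative f' l) (at l)" if "0 < l" "l < e" for l
    unfolding f'_def Pl_def
  proof (rule algebraic_has_derivative)
    show "isCont f l" using that e by (intro cont) auto
    show "\<forall>\<^sub>F x in nhds l. poly2 p x (f x) = 0"
      using that e e0 by (intro eventually_nhds_in_open[of "{0<..<e}", THEN eventually_mono]) auto
    show "poly2 (pderiv p) l (f l) \<noteq> 0" using that e e0 by auto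
  qed
  define w where "w l = l * f' l" for l
  have contw: "continuous_on {0<..<e} w"
  proof (intro continuous_at_imp_continuous_on ballI)
    fix l assume "l \<in> {0<..<e}"
    then have l: "0 < l" "l < e0" "l < 1" using e by auto
    show "isCont w l"
      unfolding w_def f'_def using e0(3)[OF l(1,2)]
      by (intro continuous_intros isCont_poly2 cont l) auto
  qed
  have tri: "(\<forall>\<^sub>F l in at_right 0. w l
    = c) \<or> (\<forall>\<^sub>F l in at_right 0. w l > c) \<or> (\<forall>\<^sub>F l in at_right 0. w l < c)" for c
  proof -
    \<comment> \<open>The equation \<open>w l = c\<close> with the denominator of \<open>f'\<close>
      cleared.\<close>
    define Q where "Q = [:[:0, 1:]:] * Pl + [:[:c:]:] * pderiv p"
    have Q: "w l = c \<longleftrightarrow> poly2 Q l (f l) = 0" if "0 < l" "l < e" for l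
      using e0(3)[OF that(1)] that e
      by (auto simp: w_def f'_def Q_def field_simps)
    show ?thesis
    proof (cases "p dvd Q")
      case True
      then obtain q where "Q = p * q" by auto
      then have "\<forall>l. 0 < l \<and> l < e \<longrightarrow> w l = c" using Q e0(2) e by auto
      then show ?thesis unfolding eventually_at_right_0_iff using e(1) by blast
    next
      case False
      from prime_eventually_no_common_zero[OF p(1) this] obtain e1 where
        e1: "e1 > 0" "\<And>l. 0 < l \<Longrightarrow> l < e1 \<Longrightarrow> poly2 p l (f l) = 0 \<longrightarrow> poly2 Q l (f l) \<noteq> 0"
        unfolding eventually_at_right_0_iff by blast
      define e2 where "e2 = min e e1"
      have "(\<forall>l\<in>{0<..<e2}. w l > c) \<or> (\<forall>l\<in>{0<..<e2}. w l < c)"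
      proof (rule continuous_nonvanishing_sign)
        show "continuous_on {0<..<e2} w" by (rule continuous_on_subset[OF contw]) (auto simp: e2_def)
        show "w l \<noteq> c" if "l \<in> {0<..<e2}" for l
          using that Q[of l] e0(2)[of l] e1(2)[of l] e by (auto simp: e2_def)
      qed auto
      moreover have "e2 > 0" using e e1 by (auto simp: e2_def)
      ultimately show ?thesis unfolding eventually_at_right_0_iff by (meson greaterThanLessThan_iff)
    qed
  qed
  have upper: "\<forall>\<^sub>F l in at_right 0. w l < c" if c: "c > 0" for c
  proof (rule ccontr)
    assume "\<not> ?thesis"
    with tri[of c] have "\<forall>\<^sub>F l in at_right 0. c \<le> w l" by (auto elim!: eventually_mono)
    then obtain e1 where e1: "e1 > 0" "\<And>l. 0 < l \<Longrightarrow> l < e1 \<Longrightarrow> c \<le> w l"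
      unfolding eventually_at_right_0_iff by blast
    show False
      using not_log_derivative_ge[of "min e e1" f f' C c] d bound e e1 c by (auto simp: w_def)
  qed
  have lower: "\<forall>\<^sub>F l in at_right 0. - c < w l" if c: "c > 0" for c
  proof (rule ccontr)
    assume "\<not> ?thesis"
    with tri[of "- c"] have "\<forall>\<^sub>F l in at_right 0. w l \<le> - c" by (auto elim!: eventually_mono)
    then obtain e1 where e1: "e1 > 0" "\<And>l. 0 < l \<Longrightarrow> l < e1 \<Longrightarrow> w l \<le> - c"
      unfolding eventually_at_right_0_iff by blast
    have "((\<lambda>l. - f l) has_real_derivative - f' l) (at l)" if "0 < l" "l < e" for l
      by (intro derivative_intros d that)
    moreover have "c \<le> l * - f' l" if "0 < l" "l < e1" for l
      using e1(2)[OF that] by (simp add: w_def)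
    ultimately show False
      using not_log_derivative_ge[of "min e e1" "\<lambda>l. - f l" "\<lambda>l. - f' l" C c] bound e e1 c by auto
  qed
  have w0: "(w \<longlongrightarrow> 0) (at_right 0)"
  proof (rule tendstoI)
    fix r :: real assume "r > 0"
    from upper[OF this] lower[OF this] show "\<forall>\<^sub>F l in at_right 0. dist (w l) 0 < r"
      by eventually_elim (auto simp: dist_real_def)
  qed
  have limit: "\<exists>L. (g \<longlongrightarrow> L) (at_right 0)" if
    g: "r > 0" "\<And>l. 0 < l \<Longrightarrow> l < r \<Longrightarrow> (g has_real_derivative g' l) (at l)" "\<And>l. 0 < l \<Longrightarrow> l < r \<Longrightarrow> 0 \<le> g' l"
      "\<And>l. 0 < l \<Longrightarrow> l < r \<Longrightarrow> \<bar>g l\<bar> \<le> C" for g g' :: "real \<Rightarrow> real" and r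
  proof -
    have mono: "g a \<le> g b" if "0 < a" "a \<le> b" "b < r" for a b
    proof (rule DERIV_nonneg_imp_nondecreasing[where f=g])
      fix x assume "a \<le> x" "x \<le> b"
      then have "0 < x" "x < r" using that by auto
      then show "\<exists>y. (g has_real_derivative y) (at x) \<and> 0 \<le> y" using g(2,3) by blast
    qed (use that in simp)
    define L where "L = Inf (g ` {0<..<r})"
    have bdd: "bdd_below (g ` {0<..<r})"
      using g(4) by (intro bdd_belowI[of _ "- C"]) (force simp: abs_le_iff minus_le_iff)
    have "(g \<longlongrightarrow> L) (at_right 0)"
    proof (rule tendstoI)
      fix d :: real assume "d > 0"
      have ne: "g ` {0<..<r} \<noteq> {}" using g(1) by simp
      have "L < L + d" using \<open>d > 0\<close> by simp
      then obtain b where b: "0 < b" "b < r" "g b < L + d"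
        unfolding L_def using cInf_lessD[OF ne, of "L + d"] unfolding L_def by auto
      have "dist (g l) L < d" if "0 < l" "l < b" for l
      proof -
        have "L \<le> g l" unfolding L_def using that b bdd by (intro cInf_lower) auto
        moreover have "g l \<le> g b" using that b by (intro mono) auto
        ultimately show ?thesis using b by (simp add: dist_real_def)
      qed
      then show "\<forall>\<^sub>F l in at_right 0. dist (g l) L < d"
        unfolding eventually_at_right_0_iff using b by blast
    qed
    then show ?thesis by blast
  qed
  have "\<exists>L. (f \<longlongrightarrow> L) (at_right 0)"
  proof -
    \<comment> \<open>For \<open>c = 0\<close> the trichotomy fixes the sign of the derivative near
      \<open>0\<close>, so \<open>f\<close> is monotone there.\<close>
    have "(\<forall>\<^sub>F l in at_right 0. 0 \<le> w l) \<or> (\<forall>\<^sub>F l in at_right 0. w l \<le> 0)"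
      using tri[of 0] eventually_mono[of "\<lambda>l. w l = 0" "at_right 0" "\<lambda>l. w l \<le> 0"]
        eventually_mono[of "\<lambda>l. w l > 0" "at_right 0" "\<lambda>l. 0 \<le> w l"]
        eventually_mono[of "\<lambda>l. w l < 0" "at_right 0" "\<lambda>l. w l \<le> 0"]
      by (auto simp del: not_eventually)
    then consider (inc) r where "r > 0" "\<And>l. 0 < l \<Longrightarrow> l < r \<Longrightarrow> 0 \<le> w l"
      | (dec) r where "r > 0" "\<And>l. 0 < l \<Longrightarrow> l < r \<Longrightarrow> w l \<le> 0"
      unfolding eventually_at_right_0_iff by blast
    then show ?thesis
    proof cases
      case inc
      show ?thesis
        by (rule limit[of "min r e" f f']) (use inc e d bound in \<open>auto simp: w_def zero_le_mult_iff
          dest: less_imp_le\<close>)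
    next
      case dec
      have "((\<lambda>l. - f l) has_real_derivative - f' l) (at l)" if "0 < l" "l < e" for l
        by (intro derivative_intros d that)
      then have "\<exists>L. ((\<lambda>l. - f l) \<longlongrightarrow> L) (at_right 0)"
        using dec e bound
        by (intro limit[of "min r e" "\<lambda>l. - f l" "\<lambda>l. - f' l"]) (auto simp: w_def mult_le_0_iff)
      then show ?thesis by (metis tendsto_minus_cancel_left)
    qed
  qed
  then show ?thesis using that[OF e(1,2) d] w0 unfolding w_def by blast
qed

section \<open>Algebraicity of the discounted value\<close>

text \<open>The vertex is a maximizer of \<open>e\<close> with the largest number of tight constraints.\<close>

lemma polyhedron_vertex:
  fixes n :: "'c::finite \<Rightarrow> real^'b" and \<beta> :: "'c \<Rightarrow> real" and e :: "real^'b"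
  defines "F \<equiv> {p. \<forall>c. n c \<bullet> p \<le> \<beta> c}"
  assumes bnd: "bounded F" and p0: "p0 \<in> F"
  obtains p f where "p \<in> F" "e \<bullet> p0 \<le> e \<bullet> p" "det (\<chi> i. n (f i)) \<noteq> 0" "\<And>i :: 'b. n (f i) \<bullet> p = \<beta> (f i)"
proof -
  have "F = (\<Inter>c. {p. n c \<bullet> p \<le> \<beta> c})" unfolding F_def by auto
  then have "closed F" by (simp add: closed_INT closed_halfspace_le)
  with bnd have "compact F" by (simp add: compact_eq_bounded_closed)
  moreover have "continuous_on F (\<lambda>p. e \<bullet> p)" by (intro continuous_intros)
  ultimately obtain p1 where p1: "p1 \<in> F" "\<And>q. q \<in> F \<Longrightarrow> e \<bullet> q \<le> e \<bullet> p1"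
    using continuous_attains_sup[of F "\<lambda>p. e \<bullet> p"] p0 by auto
  define T where "T p = {c. n c \<bullet> p = \<beta> c}" for p
  define O' where "O' p \<longleftrightarrow> p \<in> F \<and> (\<forall>q\<in>F. e \<bullet> q \<le> e \<bullet> p)" for p
  have "O' p1" using p1 by (auto simp: O'_def)
  moreover have "\<forall>p. O' p \<longrightarrow> card (T p) < Suc (CARD('c))" by (auto intro: card_mono simp: less_Suc_eq_le)
  ultimately obtain p where p: "O' p" "\<And>q. O' q \<Longrightarrow> card (T q) \<le> card (T p)"
    using ex_has_greatest_nat[of O' p1 "\<lambda>p. card (T p)" "Suc (CARD('c))"] by auto
  have pF: "p \<in> F" using p(1) by (simp add: O'_def)
  have span: "span (n ` T p) = UNIV"
  proof (rule ccontr)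
    assume "span (n ` T p) \<noteq> UNIV"
    then obtain u0 where u0: "u0 \<noteq> 0" "\<And>x. x \<in> span (n ` T p) \<Longrightarrow> u0 \<bullet> x = 0"
      using span_not_UNIV_orthogonal[of "n ` T p"] by blast
    \<comment> \<open>A direction along which all tight constraints stay tight, with the sign for
      which \<open>e\<close> does not decrease.\<close>
    define u where "u = (if 0 \<le> e \<bullet> u0 then u0 else - u0)"
    have u: "u \<noteq> 0" "\<And>c. c \<in> T p \<Longrightarrow> n c \<bullet> u = 0" "0 \<le> e \<bullet> u"
    proof -
      have "u0 \<bullet> n c = 0" if "c \<in> T p" for c by (rule u0(2)[OF span_base]) (use that in simp)
      then show "\<And>c. c \<in> T p \<Longrightarrow> n c \<bullet> u = 0" by (simp add: u_def inner_commute)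
    qed (use u0(1) in \<open>auto simp: u_def\<close>)
    define K where "K = {c. n c \<bullet> u > 0}"
    have "K \<noteq> {}"
    proof
      assume "K = {}"
      then have neg: "n c \<bullet> u \<le> 0" for c unfolding K_def by (auto simp: not_less)
      have "p + t *\<^sub>R u \<in> F" if "t \<ge> 0" for t
      proof -
        have "n c \<bullet> (p + t *\<^sub>R u) \<le> \<beta> c" for c
        proof -
          have "n c \<bullet> p \<le> \<beta> c" using pF by (simp add: F_def)
          moreover have "t * (n c \<bullet> u) \<le> 0" using that neg[of c] by (rule mult_nonneg_nonpos)
          ultimately show ?thesis by (simp add: inner_add_right)
        qed
        then show ?thesis by (simp add: F_def)
      qed
      moreover obtain b where b: "\<And>q. q \<in> F \<Longrightarrow> norm q \<le> b" using bnd by (auto simp: bounded_iff)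
      ultimately have *: "norm (p + t *\<^sub>R u) \<le> b" if "t \<ge> 0" for t using that by blast
      define t where "t = (b + norm p + 1) / norm u"
      have "b \<ge> 0" using b[OF pF] norm_ge_zero[of p] by linarith
      then have t: "t \<ge> 0" using u(1) by (auto simp: t_def intro!: divide_nonneg_nonneg add_nonneg_nonneg)
      have "norm (t *\<^sub>R u) = t * norm u" using t by simp
      then have "norm (t *\<^sub>R u) = b + norm p + 1" using u(1) by (simp add: t_def)
      moreover have "norm (t *\<^sub>R u) \<le> norm (p + t *\<^sub>R u) + norm p"
        using norm_triangle_ineq4[of "p + t *\<^sub>R u" p] by simp
      ultimately show False using *[OF t] by linarith
    qed
    \<comment> \<open>The step length at which constraint \<open>c\<close> becomes tight. The
      smallest one keeps the point feasible and adds a tight constraint, against the choice of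
      \<open>p\<close>. Boundedness of \<open>F\<close> is what makes some constraint block the
      way.\<close>
    define r where "r c = (\<beta> c - n c \<bullet> p) / (n c \<bullet> u)" for c
    define t where "t = Min (r ` K)"
    have "t \<in> r ` K" unfolding t_def using \<open>K \<noteq> {}\<close> by (intro Min_in) auto
    then obtain c0 where c0: "c0 \<in> K" "t = r c0" by auto
    have tle: "t \<le> r c" if "c \<in> K" for c unfolding t_def using that by (intro Min_le) auto
    have t0: "t \<ge> 0" unfolding c0(2) r_def using c0(1) pF by (auto simp: K_def F_def)
    have "n c \<bullet> (p + t *\<^sub>R u) \<le> \<beta> c" for c
    proof (cases "c \<in> K")
      case True
      then have "t * (n c \<bullet> u) \<le> \<beta> c - n c \<bullet> p"
        using tle[OF True] by (simp add: r_def K_def field_simps)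
      then show ?thesis by (simp add: inner_add_right)
    next
      case False
      then have "n c \<bullet> u \<le> 0" by (simp add: K_def)
      with t0 have "t * (n c \<bullet> u) \<le> 0" by (rule mult_nonneg_nonpos)
      moreover have "n c \<bullet> p \<le> \<beta> c" using pF by (simp add: F_def)
      ultimately show ?thesis by (simp add: inner_add_right)
    qed
    then have F': "p + t *\<^sub>R u \<in> F" by (simp add: F_def)
    have "e \<bullet> p \<le> e \<bullet> (p + t *\<^sub>R u)" using t0 u(3) by (simp add: inner_add_right)
    then have "O' (p + t *\<^sub>R u)" using F' p(1) by (auto simp: O'_def intro: order_trans)
    from p(2)[OF this] have "card (T (p + t *\<^sub>R u)) \<le> card (T p)" .
    moreover have "T p \<subset> T (p + t *\<^sub>R u)"
    proof
      show "T p \<subseteq> T (p + t *\<^sub>R u)" using u(2) by (auto simp: T_def inner_add_right)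
      have "c0 \<in> T (p + t *\<^sub>R u)" using c0 by (auto simp: T_def K_def inner_add_right r_def)
      moreover have "c0 \<notin> T p" using u(2)[of c0] c0(1) by (auto simp: K_def)
      ultimately show "T p \<noteq> T (p + t *\<^sub>R u)" by blast
    qed
    then have "card (T p) < card (T (p + t *\<^sub>R u))" by (intro psubset_card_mono) auto
    ultimately show False by simp
  qed
  obtain B where B: "B \<subseteq> n ` T p" "independent B" "n ` T p \<subseteq> span B" "card B = dim (n ` T p)"
    using basis_exists[of "n ` T p"] by blast
  have "span B = UNIV" using span B(1,3) by (metis span_mono span_span top.extremum_uniqueI)
  have "dim (n ` T p) = CARD('b)" using span
    by (metis dim_UNIV dim_span DIM_cart DIM_real mult.right_neutral)
  then have "card B = CARD('b)" using B(4) by simp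
  moreover have "finite B" using B(2) independent_imp_finite by blast
  ultimately obtain h where h: "bij_betw h (UNIV :: 'b set) B"
    using finite_same_card_bij[of "UNIV :: 'b set" B] by auto
  have "\<exists>c\<in>T p. n c = h i" for i
    using B(1) bij_betwE[OF h] by (metis UNIV_I image_iff subsetD)
  then obtain f where f: "\<And>i. f i \<in> T p" "\<And>i. n (f i) = h i" by metis
  have "rows (\<chi> i. n (f i)) = B"
    using bij_betw_imp_surj_on[OF h] by (auto simp: rows_def row_def f(2) vec_lambda_eta)
  then have "det (\<chi> i. n (f i)) \<noteq> 0"
    using \<open>span B = UNIV\<close> matrix_left_invertible_span_rows[of "\<chi> i. n (f i)"]
    by (metis invertible_det_nz invertible_left_inverse)
  moreover have "e \<bullet> p0 \<le> e \<bullet> p" using p(1) p0 by (auto simp: O'_def)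
  ultimately show ?thesis using that[OF pF] f(1) by (auto simp: T_def)
qed

text \<open>Row \<open>s\<close> depends on the index \<open>a s\<close> alone. In the Leibniz
  formula a product over rows of averages is therefore an average over functions \<open>a\<close> of
  products.\<close>

lemma det_average_rows:
  fixes R :: "'w::finite \<Rightarrow> 'c::finite \<Rightarrow> 'w \<Rightarrow> real"
  shows "(\<Sum>a\<in>UNIV. (\<Prod>s\<in>UNIV. p s (a s)) * det (\<chi> s s'. R s (a s) s'))
    = det (\<chi> s s'. \<Sum>c\<in>UNIV. p s c * R s c s')"
proof -
  have "det (\<chi> s s'. \<Sum>c\<in>UNIV. p s c * R s c s')
    = (\<Sum>\<pi> | \<pi> permutes UNIV. of_int (sign \<pi>) * (\<Prod>s\<in>UNIV. \<Sum>c\<in>UNIV. p s c * R s c (\<pi> s)))"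
    by (simp add: det_def)
  also have "\<dots> = (\<Sum>\<pi> | \<pi> permutes UNIV. \<Sum>a\<in>UNIV. (\<Prod>s\<in>UNIV. p s (a s)) * (of_int (sign \<pi>) * (\<Prod>s\<in>UNIV. R s
    (a s) (\<pi> s))))"
    by (subst prod_sum_PiE) (auto simp: prod.distrib sum_distrib_left mult_ac)
  also have "\<dots> = (\<Sum>a\<in>UNIV. (\<Prod>s\<in>UNIV. p s (a s)) * det (\<chi> s s'. R s (a s) s'))"
    by (subst sum.swap) (simp add: det_def sum_distrib_left)
  finally show ?thesis by simp
qed

lemma sum_prod_pmf:
  fixes x :: "'w::finite \<Rightarrow> 'c::finite pmf"
  shows "(\<Sum>a\<in>UNIV. \<Prod>s\<in>UNIV. pmf (x s) (a s)) = 1"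
  using prod_sum_PiE[of "UNIV :: 'w set" "\<lambda>_. UNIV :: 'c set" "\<lambda>s. pmf (x s)"] by simp

text \<open>Minimum principle: where \<open>u\<close> attains its minimum \<open>m\<close>, the
  average \<open>Q *v u\<close> is at least \<open>m\<close>, so that \<open>(1 - t) * m\<close> is
  nonnegative.\<close>

lemma discounted_resolvent_nonneg:
  fixes Q :: "real^'w^'w"
  assumes Q: "\<And>s s'. 0 \<le> Q $ s $ s'" "\<And>s. (\<Sum>s'\<in>UNIV. Q $ s $ s') = 1" and t: "0 \<le> t" "t < 1"
    and u: "\<And>s. 0 \<le> ((mat 1 - t *\<^sub>R Q) *v u) $ s"
  shows "0 \<le> u $ s"
proof -
  define m where "m = Min (range (\<lambda>s. u $ s))"
  have "m \<in> range (\<lambda>s. u $ s)" unfolding m_def by (rule Min_in) auto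
  then obtain s0 where s0: "u $ s0 = m" by auto
  have m: "m \<le> u $ s" for s unfolding m_def by (rule Min_le) auto
  have "m = (\<Sum>s'\<in>UNIV. Q $ s0 $ s' * m)" by (simp add: sum_distrib_right[symmetric] Q)
  also have "\<dots> \<le> (\<Sum>s'\<in>UNIV. Q $ s0 $ s' * u $ s')" by (intro sum_mono mult_left_mono m Q)
  also have "\<dots> = (Q *v u) $ s0" by (simp add: matrix_vector_mult_def)
  finally have "t * m \<le> t * (Q *v u) $ s0" using t by (intro mult_left_mono)
  moreover have "0 \<le> m - t * (Q *v u) $ s0"
    using u[of s0] s0 by (simp add: matrix_vector_mult_diff_rdistrib scaleR_matrix_vector_assoc[symmetric])
  ultimately have "0 \<le> (1 - t) * m" by (simp add: algebra_simps)
  then have "0 \<le> m" using t by (simp add: zero_le_mult_iff)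
  then show ?thesis using m[of s] by linarith
qed

text \<open>The minimum principle, applied to a kernel vector and to its negative, excludes a zero
  determinant on the whole segment from \<open>0\<close> to \<open>t\<close>. The sign is therefore
  the one at \<open>0\<close>, where the determinant is \<open>1\<close>.\<close>

lemma det_discounted_pos:
  fixes Q :: "real^'w^'w"
  assumes Q: "\<And>s s'. 0 \<le> Q $ s $ s'" "\<And>s. (\<Sum>s'\<in>UNIV. Q $ s $ s') = 1" and t: "0 \<le> t" "t < 1"
  shows "0 < det (mat 1 - t *\<^sub>R Q)"
proof -
  have nz: "det (mat 1 - t *\<^sub>R Q) \<noteq> 0" if t: "0 \<le> t" "t < 1" for t
  proof
    assume "det (mat 1 - t *\<^sub>R Q) = 0"
    then obtain u where u: "u \<noteq> 0" "(mat 1 - t *\<^sub>R Q) *v u = 0"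
      using invertible_det_nz[of "mat 1 - t *\<^sub>R Q"]
      unfolding invertible_left_inverse matrix_left_invertible_ker by auto
    have "0 \<le> u $ s" for s by (rule discounted_resolvent_nonneg[OF Q t]) (use u in auto)
    moreover have "0 \<le> (- u) $ s" for s
      by (rule discounted_resolvent_nonneg[OF Q t]) (use u in \<open>auto simp: matrix_vector_mult_def
        sum_negf vec_eq_iff\<close>)
    ultimately have "u = 0" by (auto simp: vec_eq_iff intro: antisym)
    with u show False by simp
  qed
  have "continuous_on {0..t} (\<lambda>t. det (mat 1 - t *\<^sub>R Q))"
    unfolding det_def by (intro continuous_intros)
  then have "continuous_on {0..t} (\<lambda>t. det (mat 1 - t *\<^sub>R Q))" .
  from continuous_nonvanishing_sign[OF this, of 0] nz t
  have "(\<forall>l\<in>{0..t}. 0 < det (mat 1 - l *\<^sub>R Q)) \<or> (\<forall>l\<in>{0..t}. det (mat 1 - l *\<^sub>R Q) < 0)"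
    by auto
  moreover have "det (mat 1 - 0 *\<^sub>R Q) = 1" by simp
  ultimately show ?thesis using t
    by (metis atLeastAtMost_iff order_refl not_less_iff_gr_or_eq zero_less_one)
qed

text \<open>Cramer's rule for the vector \<open>\<gamma> - z *\<^sub>R axis k 1\<close>, whose
  coordinate \<open>k\<close> is \<open>\<gamma> $ k - z\<close>.\<close>

lemma replace_column_det:
  fixes A :: "real^'w^'w"
  assumes "A *v \<gamma> = h"
  shows "det (\<chi> s s'. if s' = k then h $ s - z * A $ s $ k else A $ s $ s') = (\<gamma> $ k - z) * det A"
proof -
  have "(A *v (\<gamma> - z *\<^sub>R axis k 1)) $ s = h $ s - z * A $ s $ k" for s
    using assms by (simp add: matrix_vector_mult_diff_distrib matrix_vector_mult_scaleR
      matrix_vector_mul_component inner_axis)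
  then show ?thesis
    using cramer_lemma[of k A "\<gamma> - z *\<^sub>R axis k 1"] by (simp cong: if_cong)
qed

text \<open>The row of state \<open>s\<close> in the matrix whose determinant is, by Cramer's rule, the product of
  \<open>det (I - (1 - l) Q)\<close> and of the difference between the payoff from state \<open>k\<close> and \<open>z\<close>.\<close>

definition cramer_row ::
  "('w::finite, 'i, 'j) stochastic_game \<Rightarrow> 'w \<Rightarrow> real \<Rightarrow> real \<Rightarrow> 'w \<Rightarrow> 'i \<Rightarrow> 'j \<Rightarrow> 'w \<Rightarrow> real" where
  "cramer_row \<Gamma> k l z s i j s' =
    (if s' = k then l * payoff \<Gamma> s i j - z * ((if s
      = k then 1 else 0) - (1 - l) * pmf (transition \<Gamma> s i j) k)
     else (if s = s' then 1 else 0) - (1 - l) * pmf (transition \<Gamma> s i j) s')"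

text \<open>The actions are pure stationary strategies. Subtracting \<open>z\<close> from the payoff
  of state \<open>k\<close> would give entries rational in \<open>l\<close>; the factor
  \<open>det (I - (1 - l) Q)\<close> is positive, so it keeps the sign, and it makes the entries
  polynomial.\<close>

definition cramer_game ::
  "('w::finite, 'i, 'j) stochastic_game \<Rightarrow> 'w \<Rightarrow> real \<Rightarrow> real \<Rightarrow> ('w \<Rightarrow> 'i) \<Rightarrow> ('w \<Rightarrow> 'j) \<Rightarrow> real" where
  "cramer_game \<Gamma> k l z a b = det (\<chi> s s'. cramer_row \<Gamma> k l z s (a s) (b s) s')"

definition product_weight :: "('w::finite \<Rightarrow> 'c::finite pmf) \<Rightarrow> ('w \<Rightarrow> 'c) \<Rightarrow> real" where
  "product_weight x a = (\<Prod>s\<in>UNIV. pmf (x s) (a s))"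

text \<open>One player is frozen at a pure stationary strategy, and the other mixes with
  \<open>x\<close> in the resulting one-player problem with rewards \<open>g\<close> and transitions
  \<open>q\<close>. Then \<open>\<gamma>\<close> is the vector of discounted payoffs. The last two
  clauses are the minimum principle: subsolutions of the payoff equation lie below
  \<open>\<gamma>\<close> and supersolutions above. Stated without reference to a player, so that it
  serves both.\<close>

lemma det_averaged_rows:
  fixes x :: "'w::finite \<Rightarrow> 'c::finite pmf" and g :: "'w \<Rightarrow> 'c \<Rightarrow> real" and q :: "'w \<Rightarrow> 'c \<Rightarrow> 'w pmf"
  assumes l: "0 < l" "l \<le> 1"
  defines "A \<equiv> mat 1 - (1 - l) *\<^sub>R (\<chi> s s'. \<Sum>c\<in>UNIV. pmf (x s) c * pmf (q s c) s')"
  shows "\<exists>\<gamma>. A *v \<gamma> = (\<chi> s. l * (\<Sum>c\<in>UNIV. pmf (x s) c * g s c)) \<and> 0 < det A \<and>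
    (\<Sum>a\<in>UNIV. product_weight x a * det (\<chi> s s'. if s' = k then l * g s (a s) - z * ((if s
      = k then 1 else 0) - (1 - l) * pmf (q s (a s)) k)
     else (if s = s' then 1 else 0) - (1 - l) * pmf (q s (a s)) s')) = (\<gamma> $ k - z) * det A \<and>
    (\<forall>v. (\<forall>s. v s \<le> (\<Sum>c\<in>UNIV. pmf (x s) c * (l * g s c + (1 - l) * (\<Sum>s'\<in>UNIV. pmf (q s c) s' * v s'))))
      \<longrightarrow> v k \<le> \<gamma> $ k) \<and>
    (\<forall>v. (\<forall>s. (\<Sum>c\<in>UNIV. pmf (x s) c * (l * g s c + (1 - l) * (\<Sum>s'\<in>UNIV. pmf (q s c) s' * v s')))
      \<le> v s) \<longrightarrow> \<gamma> $ k \<le> v k)"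
proof -
  define Q where "Q = (\<chi> s s'. \<Sum>c\<in>UNIV. pmf (x s) c * pmf (q s c) s')"
  define h where "h = (\<chi> s. l * (\<Sum>c\<in>UNIV. pmf (x s) c * g s c))"
  have A: "A = mat 1 - (1 - l) *\<^sub>R Q" unfolding A_def Q_def ..
  have Q: "0 \<le> Q $ s $ s'" "(\<Sum>s'\<in>UNIV. Q $ s $ s') = 1" for s s'
    unfolding Q_def vec_lambda_beta
    by (auto intro: sum_nonneg) (subst sum.swap, simp add: sum_distrib_left[symmetric])
  have t: "0 \<le> 1 - l" "1 - l < 1" using l by auto
  have pos: "0 < det A" unfolding A by (rule det_discounted_pos[OF Q t])
  then have "invertible A" by (simp add: invertible_det_nz)
  then obtain A' where "A ** A' = mat 1" unfolding invertible_def by blast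
  then have "A *v (A' *v h) = h" by (simp add: matrix_vector_mul_assoc)
  then obtain \<gamma> where \<gamma>: "A *v \<gamma> = h" by blast
  have Av: "(A *v (\<chi> s. v s)) $ s
    = v s - (1 - l) * (\<Sum>c\<in>UNIV. pmf (x s) c * (\<Sum>s'\<in>UNIV. pmf (q s c) s' * v s'))" for v s
  proof -
    have "(Q *v (\<chi> s. v s)) $ s = (\<Sum>c\<in>UNIV. pmf (x s) c * (\<Sum>s'\<in>UNIV. pmf (q s c) s' * v s'))"
      unfolding matrix_vector_mult_def Q_def
      by (simp add: sum_distrib_right sum_distrib_left mult.assoc) (rule sum.swap)
    then show ?thesis
      by (simp add: A matrix_vector_mult_diff_rdistrib scaleR_matrix_vector_assoc[symmetric])
  qed
  have expand: "(\<Sum>c\<in>UNIV. pmf (x s) c * (l * g s c + (1 - l) * (\<Sum>s'\<in>UNIV. pmf (q s c) s' * v s')))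
    = h $ s + v s - (A *v (\<chi> s. v s)) $ s" for v s
    unfolding Av h_def by (simp add: distrib_left sum.distrib sum_distrib_left mult_ac)
  have "v k \<le> \<gamma> $ k" if "\<And>s. v s
    \<le> (\<Sum>c\<in>UNIV. pmf (x s) c * (l * g s c + (1 - l) * (\<Sum>s'\<in>UNIV. pmf (q s c) s' * v s')))" for v
  proof -
    have "0 \<le> (\<gamma> - (\<chi> s. v s)) $ k"
      by (rule discounted_resolvent_nonneg[OF Q t])
        (use that in \<open>simp add: A[symmetric] matrix_vector_mult_diff_distrib \<gamma> expand\<close>)
    then show ?thesis by simp
  qed
  moreover have "\<gamma> $ k
    \<le> v k" if "\<And>s. (\<Sum>c\<in>UNIV. pmf (x s) c * (l * g s c + (1 - l) * (\<Sum>s'\<in>UNIV. pmf (q s c) s' * v s')))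
      \<le> v s" for v
  proof -
    have "0 \<le> ((\<chi> s. v s) - \<gamma>) $ k"
      by (rule discounted_resolvent_nonneg[OF Q t])
        (use that in \<open>simp add: A[symmetric] matrix_vector_mult_diff_distrib \<gamma> expand\<close>)
    then show ?thesis by simp
  qed
  moreover have "(\<Sum>a\<in>UNIV. product_weight x a * det (\<chi> s s'. if s' = k then l * g s (a s) - z * ((if s
    = k then 1 else 0) - (1 - l) * pmf (q s (a s)) k)
     else (if s = s' then 1 else 0) - (1 - l) * pmf (q s (a s)) s')) = (\<gamma> $ k - z) * det A"
  proof -
    have lin: "(\<Sum>c\<in>UNIV. pmf (x s) c * (d * G c - e * F c))
      = d * (\<Sum>c\<in>UNIV. pmf (x s) c * G c) - e * (\<Sum>c\<in>UNIV. pmf (x s) c * F c)" for s d e F G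
      by (simp only: right_diff_distrib sum_subtractf mult.left_commute sum_distrib_left)
    have aff: "(\<Sum>c\<in>UNIV. pmf (x s) c * (d - e * F c)) = d - e * (\<Sum>c\<in>UNIV. pmf (x s) c * F c)" for s d e F
      using lin[of s d "\<lambda>_. 1" e F] by simp
    have avg: "(\<Sum>c\<in>UNIV. pmf (x s) c * (if s' = k then l * g s c - z * ((if s
      = k then 1 else 0) - (1 - l) * pmf (q s c) k)
       else (if s = s' then 1 else 0) - (1 - l) * pmf (q s c) s'))
      = (if s' = k then h $ s - z * A $ s $ k else A $ s $ s')" for s s'
    proof (cases "s' = k")
      case True
      have "(\<Sum>c\<in>UNIV. pmf (x s) c * (l * g s c - z * ((if s = k then 1 else 0) - (1 - l) * pmf (q s c) k)))
        = h $ s - z * (\<Sum>c\<in>UNIV. pmf (x s) c * ((if s = k then 1 else 0) - (1 - l) * pmf (q s c) k))"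
        unfolding lin by (simp add: h_def)
      also have "\<dots> = h $ s - z * A $ s $ k"
        unfolding aff by (simp add: A Q_def mat_def)
      finally show ?thesis using True by simp
    next
      case False
      then show ?thesis by (simp only: if_False aff) (simp add: A Q_def mat_def)
    qed
    show ?thesis
      unfolding product_weight_def replace_column_det[OF \<gamma>, of k z, symmetric] avg[symmetric]
      by (rule det_average_rows)
  qed
  ultimately show ?thesis using \<gamma> pos unfolding h_def by blast
qed

lemma product_weight_nonneg: "0 \<le> product_weight x a"
  unfolding product_weight_def by (auto intro: prod_nonneg)

lemma sum_product_weight [simp]: "(\<Sum>a\<in>UNIV. product_weight x a) = 1"
  unfolding product_weight_def by (rule sum_prod_pmf)

text \<open>By the saddle inequality, \<open>v\<close> is a subsolution when \<open>x\<close> meets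
  the pure stationary \<open>b\<close>. The average is thus at least \<open>v k - z\<close> times a
  positive determinant.\<close>

lemma cramer_game_guarantee1:
  fixes \<Gamma> :: "('w::finite, 'i::finite, 'j::finite) stochastic_game"
  assumes s: "shapley_solution \<Gamma> l v x y" and l: "0 < l" "l \<le> 1" and z: "z < v k"
  shows "0 < (\<Sum>a\<in>UNIV. product_weight x a * cramer_game \<Gamma> k l z a b)"
proof -
  have "v s \<le> (\<Sum>i\<in>UNIV. pmf (x s) i * (l * payoff \<Gamma> s i (b s) + (1 - l) * (\<Sum>s'\<in>UNIV. pmf (transition \<Gamma> s
    i (b s)) s' * v s')))" for s
    using s unfolding shapley_solution_def saddle_def local_game_def next_value_def by auto
  with det_averaged_rows[OF l, of x "\<lambda>s i. transition \<Gamma> s i (b s)" "\<lambda>s i. payoff \<Gamma> s i (b s)" k z]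
  obtain \<gamma> d where "(\<Sum>a\<in>UNIV. product_weight x a * cramer_game \<Gamma> k l z a b) = (\<gamma> - z) * d" "v k
    \<le> \<gamma>" "0 < (d::real)"
    unfolding cramer_game_def cramer_row_def by blast
  then show ?thesis using z by simp
qed

text \<open>Together with the previous guarantee, this squeezes the value of the matrix game between
  \<open>0\<close> and \<open>(v k - z) * B\<close>, which vanishes as \<open>z\<close> increases to
  \<open>v k\<close>.\<close>

lemma cramer_game_guarantee2:
  fixes \<Gamma> :: "('w::finite, 'i::finite, 'j::finite) stochastic_game"
  assumes s: "shapley_solution \<Gamma> l v x y" and l: "0 < l" "l \<le> 1"
  obtains B where "0 < B" "\<And>a z. z < v k \<Longrightarrow>
    (\<Sum>b\<in>UNIV. product_weight y b * cramer_game \<Gamma> k l z a b) \<le> (v k - z) * B"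
proof -
  define d where "d a
    = det (mat 1 - (1 - l) *\<^sub>R (\<chi> s s'. \<Sum>j\<in>UNIV. pmf (y s) j * pmf (transition \<Gamma> s (a s) j) s'))" for a
  have key: "0 < d a \<and> (\<Sum>b\<in>UNIV. product_weight y b * cramer_game \<Gamma> k l z a b) \<le> (v k - z) * d a" for a z
  proof -
    have "(\<Sum>j\<in>UNIV. pmf (y s) j * (l * payoff \<Gamma> s (a s) j + (1 - l) * (\<Sum>s'\<in>UNIV. pmf (transition \<Gamma> s (a
      s) j) s' * v s'))) \<le> v s" for s
      using s unfolding shapley_solution_def saddle_def local_game_def next_value_def by auto
    with det_averaged_rows[OF l, of y "\<lambda>s j. transition \<Gamma> s (a s) j" "\<lambda>s j. payoff \<Gamma> s (a s) j" k z]
    obtain \<gamma> where "(\<Sum>b\<in>UNIV. product_weight y b * cramer_game \<Gamma> k l z a b) = (\<gamma> - z) * d a" "\<gamma>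
      \<le> v k" "0 < d a"
      unfolding cramer_game_def cramer_row_def d_def by blast
    then show ?thesis by (simp add: mult_right_mono)
  qed
  \<comment> \<open>All these determinants are positive, so their sum dominates each of them and
    gives one constant for all \<open>a\<close> and \<open>z\<close>.\<close>
  define B where "B = (\<Sum>a\<in>UNIV. d a)"
  have dB: "d a \<le> B" for a unfolding B_def using key by (intro member_le_sum) (auto intro: less_imp_le)
  have "0 < B" using key dB less_le_trans by blast
  moreover have "(\<Sum>b\<in>UNIV. product_weight y b * cramer_game \<Gamma> k l z a b)
    \<le> (v k - z) * B" if "z < v k" for a z
    using key[of a z] mult_left_mono[OF dB[of a], of "v k - z"] that by linarith
  ultimately show ?thesis using that by blast
qed

section \<open>Polynomial entries and the linear program of the matrix game\<close>

lemma poly2_of_int [simp]: "poly2 (of_int m) l z = of_int m"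
  by (cases m) (simp_all add: poly2_def)

lemma poly2_det: "poly2 (det A) l z = det (\<chi> i j. poly2 (A $ i $ j) l z)"
  by (simp add: det_def poly2_sum poly2_prod)

lemma isCont_det:
  fixes F :: "real \<Rightarrow> 'b::finite \<Rightarrow> 'b \<Rightarrow> real"
  assumes "\<And>i j. isCont (\<lambda>z. F z i j) z0"
  shows "isCont (\<lambda>z. det (\<chi> i j. F z i j)) z0"
  unfolding det_def by (auto intro!: continuous_intros assms)

text \<open>Here \<open>[:[:0, 1:]:]\<close> is the indeterminate \<open>l\<close> and
  \<open>[:0, 1:]\<close> is the indeterminate \<open>z\<close>.\<close>

definition cramer_row_poly ::
  "('w::finite, 'i, 'j) stochastic_game \<Rightarrow> 'w \<Rightarrow> 'w \<Rightarrow> 'i \<Rightarrow> 'j \<Rightarrow> 'w \<Rightarrow> real poly poly" where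
  "cramer_row_poly \<Gamma> k s i j s' =
    (if s' = k then [:[:0, 1:]:] * [:[:payoff \<Gamma> s i j:]:]
        - [:0, 1:] * ([:[:if s
          = k then 1 else 0:]:] - (1 - [:[:0, 1:]:]) * [:[:pmf (transition \<Gamma> s i j) k:]:])
     else [:[:if s = s' then 1 else 0:]:] - (1 - [:[:0, 1:]:]) * [:[:pmf (transition \<Gamma> s i j) s':]:])"

definition cramer_game_poly ::
  "('w::finite, 'i, 'j) stochastic_game \<Rightarrow> 'w \<Rightarrow> ('w \<Rightarrow> 'i) \<Rightarrow> ('w \<Rightarrow> 'j) \<Rightarrow> real poly poly" where
  "cramer_game_poly \<Gamma> k a b = det (\<chi> s s'. cramer_row_poly \<Gamma> k s (a s) (b s) s')"

lemma poly2_cramer_row: "poly2 (cramer_row_poly \<Gamma> k s i j s') l z = cramer_row \<Gamma> k l z s i j s'"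
  by (simp add: cramer_row_poly_def cramer_row_def algebra_simps)

lemma poly2_cramer_game: "poly2 (cramer_game_poly \<Gamma> k a b) l z = cramer_game \<Gamma> k l z a b"
  by (simp add: cramer_game_poly_def cramer_game_def poly2_det poly2_cramer_row)

text \<open>The constraints \<open>cramer_game \<cdot> p \<le> 1\<close> and \<open>p \<ge> 0\<close> of the linear program whose maximum is the
  inverse of the value of \<open>cramer_game\<close>.\<close>

definition constraint :: "('w::finite, 'i::finite, 'j::finite) stochastic_game \<Rightarrow> 'w \<Rightarrow> real \<Rightarrow> real
    \<Rightarrow> ('w \<Rightarrow> 'i) + ('w \<Rightarrow> 'j) \<Rightarrow> real^('w \<Rightarrow> 'j)" where
  "constraint \<Gamma> k l z c = (case c of Inl a \<Rightarrow> \<chi> b. cramer_game \<Gamma> k l z a b | Inr b' \<Rightarrow> - axis b' 1)"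

definition constraint_poly :: "('w::finite, 'i::finite, 'j::finite) stochastic_game \<Rightarrow> 'w
    \<Rightarrow> ('w \<Rightarrow> 'i) + ('w \<Rightarrow> 'j) \<Rightarrow> (real poly poly)^('w \<Rightarrow> 'j)" where
  "constraint_poly \<Gamma> k c = (case c of Inl a \<Rightarrow> \<chi> b. cramer_game_poly \<Gamma> k a b | Inr b' \<Rightarrow> \<chi> b. if b
    = b' then - 1 else 0)"

definition constraint_rhs :: "'a + 'b \<Rightarrow> real" where
  "constraint_rhs c = (case c of Inl _ \<Rightarrow> 1 | Inr _ \<Rightarrow> 0)"

lemma poly2_constraint: "poly2 (constraint_poly \<Gamma> k c $ b) l z = constraint \<Gamma> k l z c $ b"
  by (auto simp: constraint_poly_def constraint_def poly2_cramer_game axis_def split: sum.split)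

lemma isCont_poly2_second: "isCont (\<lambda>z. poly2 P l z) z"
  using poly2_pderiv by (rule DERIV_isCont)

text \<open>Write \<open>K\<close> for \<open>(v k - z) * B\<close>. The guarantee of Player 1 makes
  the feasible set bounded, and that of Player 2 makes the point with weights
  \<open>product_weight y b / K\<close> feasible, with total mass \<open>1 / K\<close>. Some vertex
  does at least as well; by Cramer's rule its total mass is the sum over \<open>j\<close> divided by
  the vertex determinant, so this determinant is at most \<open>K\<close> times that sum.\<close>

lemma constraint_vertex:
  fixes \<Gamma> :: "('w::finite, 'i::finite, 'j::finite) stochastic_game"
  assumes s: "shapley_solution \<Gamma> l v x y" and l: "0 < l" "l \<le> 1" and z: "z < v k"
    and B: "0 < B" "\<And>a. (\<Sum>b\<in>UNIV. product_weight y b * cramer_game \<Gamma> k l z a b) \<le> (v k - z) * B"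
  shows "\<exists>f. det (\<chi> i. constraint \<Gamma> k l z (f i)) \<noteq> 0 \<and>
    \<bar>det (\<chi> i. constraint \<Gamma> k l z (f i))\<bar> \<le> (v k - z) * B *
      \<bar>\<Sum>j\<in>UNIV. det (\<chi> i j'. if j' = j then constraint_rhs (f i) else constraint \<Gamma> k l z (f i) $ j')\<bar>"
proof -
  define n where "n = constraint \<Gamma> k l z"
  define F where "F = {p. \<forall>c. n c \<bullet> p \<le> constraint_rhs c}"
  define e :: "real^('w \<Rightarrow> 'j)" where "e = (\<chi> b. 1)"
  have ep: "e \<bullet> p = (\<Sum>b\<in>UNIV. p $ b)" for p by (simp add: e_def inner_vec_def)
  have nInl: "n (Inl a) \<bullet> p = (\<Sum>b\<in>UNIV. p $ b * cramer_game \<Gamma> k l z a b)" for a p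
    by (simp add: n_def constraint_def inner_vec_def mult.commute)
  have nInr: "n (Inr b) \<bullet> p = - p $ b" for b p
    by (simp add: n_def constraint_def inner_axis')
  have F: "p \<in> F \<longleftrightarrow> (\<forall>b. 0 \<le> p $ b) \<and> (\<forall>a. (\<Sum>b\<in>UNIV. p $ b * cramer_game \<Gamma> k l z a b) \<le> 1)" for p
  proof -
    have "p \<in> F \<longleftrightarrow> (\<forall>a. n (Inl a) \<bullet> p \<le> constraint_rhs (Inl a :: ('w \<Rightarrow> 'i) + ('w \<Rightarrow> 'j)))
        \<and> (\<forall>b. n (Inr b) \<bullet> p \<le> constraint_rhs (Inr b :: ('w \<Rightarrow> 'i) + ('w \<Rightarrow> 'j)))"
      unfolding F_def mem_Collect_eq by (metis sum.exhaust)
    then show ?thesis unfolding nInl nInr constraint_rhs_def by auto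
  qed
  define c where "c = Min (range (\<lambda>b. \<Sum>a\<in>UNIV. product_weight x a * cramer_game \<Gamma> k l z a b))"
  have c0: "0 < c" unfolding c_def
    by (subst Min_gr_iff) (auto intro: cramer_game_guarantee1[OF s l z])
  have c: "c \<le> (\<Sum>a\<in>UNIV. product_weight x a * cramer_game \<Gamma> k l z a b)" for b
    unfolding c_def by (rule Min_le) auto
  have "norm p \<le> 1 / c" if p: "p \<in> F" for p
  proof -
    have "c * (\<Sum>b\<in>UNIV. p $ b) \<le> (\<Sum>b\<in>UNIV. p $ b * (\<Sum>a\<in>UNIV. product_weight x a * cramer_game \<Gamma> k l z a b))"
      using p c by (subst sum_distrib_left, subst mult.commute) (auto simp: F intro!: sum_mono
        mult_left_mono)
    also have "\<dots> = (\<Sum>a\<in>UNIV. product_weight x a * (\<Sum>b\<in>UNIV. p $ b * cramer_game \<Gamma> k l z a b))"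
      unfolding sum_distrib_left by (subst sum.swap) (simp add: mult_ac)
    also have "\<dots> \<le> (\<Sum>a\<in>UNIV. product_weight x a * 1)"
      using p by (intro sum_mono mult_left_mono product_weight_nonneg) (auto simp: F)
    finally have "(\<Sum>b\<in>UNIV. p $ b) \<le> 1 / c" using c0 by (simp add: field_simps)
    moreover have "norm p \<le> (\<Sum>b\<in>UNIV. \<bar>p $ b\<bar>)" by (rule norm_le_l1_cart)
    moreover have "(\<Sum>b\<in>UNIV. \<bar>p $ b\<bar>) = (\<Sum>b\<in>UNIV. p $ b)" using p by (simp add: F)
    ultimately show ?thesis by linarith
  qed
  then have bnd: "bounded F" unfolding bounded_iff by blast
  define K where "K = (v k - z) * B"
  have K: "0 < K" unfolding K_def using z B(1) by simp
  define p0 :: "real^('w \<Rightarrow> 'j)" where "p0 = (\<chi> b. product_weight y b / K)"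
  have "p0 \<in> F"
    unfolding F p0_def using K B(2) product_weight_nonneg[of y]
    by (auto simp: sum_divide_distrib[symmetric] K_def[symmetric])
  from polyhedron_vertex[OF bnd[unfolded F_def] this[unfolded F_def], of e]
  obtain p f where p: "p \<in> F" "e \<bullet> p0 \<le> e \<bullet> p" "det (\<chi> i. n (f i)) \<noteq> 0" "\<And>i. n (f i) \<bullet> p
    = constraint_rhs (f i)"
    unfolding F_def by blast
  have "e \<bullet> p0 = 1 / K" unfolding ep p0_def by (simp add: sum_divide_distrib[symmetric])
  with p(2) have sp: "1 / K \<le> (\<Sum>b\<in>UNIV. p $ b)" by (simp add: ep)
  define C where "C = (\<chi> i. n (f i))"
  have "(C *v p) $ i = constraint_rhs (f i)" for i
    using p(4)[of i] by (simp add: C_def matrix_vector_mul_component)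
  then have "det (\<chi> i j'. if j' = j then constraint_rhs (f i) else n (f i) $ j') = p $ j * det C" for j
    using cramer_lemma[of j C p] by (simp add: C_def cong: if_cong)
  then have "(\<Sum>j\<in>UNIV. det (\<chi> i j'. if j' = j then constraint_rhs (f i) else n (f i) $ j'))
    = (\<Sum>b\<in>UNIV. p $ b) * det C"
    by (simp add: sum_distrib_right)
  then have "K * \<bar>\<Sum>j\<in>UNIV. det (\<chi> i j'. if j' = j then constraint_rhs (f i) else n (f i) $ j')\<bar>
    = (K * \<bar>\<Sum>b\<in>UNIV. p $ b\<bar>) * \<bar>det C\<bar>"
    by (simp add: abs_mult)
  moreover have "1 \<le> K * (\<Sum>b\<in>UNIV. p $ b)" using sp K by (simp add: field_simps)
  then have "1 \<le> K * \<bar>\<Sum>b\<in>UNIV. p $ b\<bar>"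
    using K by (rule order_trans[OF _ mult_left_mono[OF abs_ge_self less_imp_le]])
  then have "1 * \<bar>det C\<bar> \<le> (K * \<bar>\<Sum>b\<in>UNIV. p $ b\<bar>) * \<bar>det C\<bar>" by (rule mult_right_mono) simp
  ultimately have "\<bar>det C\<bar> \<le> K * \<bar>\<Sum>j\<in>UNIV. det (\<chi> i j'. if j'
    = j then constraint_rhs (f i) else n (f i) $ j')\<bar>"
    by linarith
  then show ?thesis
    using p(3) unfolding C_def n_def K_def by blast
qed

text \<open>As \<open>z\<close> increases to \<open>v k\<close>, the maximum of the linear program tends to infinity. By Cramer's rule it
  is a quotient of determinants at some vertex, so the denominator vanishes at \<open>z = v k\<close>.\<close>

lemma vertex_determinant_zero:
  fixes \<Gamma> :: "('w::finite, 'i::finite, 'j::finite) stochastic_game"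
  assumes s: "shapley_solution \<Gamma> l v x y" and l: "0 < l" "l \<le> 1"
  shows "\<exists>f. det (\<chi> i. constraint_poly \<Gamma> k (f i)) \<noteq> 0
    \<and> poly2 (det (\<chi> i. constraint_poly \<Gamma> k (f i))) l (v k) = 0"
proof -
  define D where "D f z = det (\<chi> i. constraint \<Gamma> k l z (f i))" for f z
  define H where "H f z = (\<Sum>j\<in>UNIV. det (\<chi> i j'. if j'
    = j then constraint_rhs (f i) else constraint \<Gamma> k l z (f i) $ j'))" for f z
  obtain B where B: "0 < B" "\<And>a z. z < v k \<Longrightarrow>
    (\<Sum>b\<in>UNIV. product_weight y b * cramer_game \<Gamma> k l z a b) \<le> (v k - z) * B"
    using cramer_game_guarantee2[OF s l] by blast
  have Dp: "D f z = poly2 (det (\<chi> i. constraint_poly \<Gamma> k (f i))) l z" for f z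
    unfolding D_def poly2_det by (simp add: poly2_constraint vec_lambda_eta)
  have contD: "isCont (D f) z" for f z unfolding Dp by (rule isCont_poly2_second)
  have contn: "isCont (\<lambda>z. constraint \<Gamma> k l z c $ b) z" for c b z
    unfolding poly2_constraint[symmetric] by (rule isCont_poly2_second)
  have contH: "isCont (H f) z" for f z
  proof -
    have "isCont (\<lambda>z. if j' = j then constraint_rhs (f i) else constraint \<Gamma> k l z (f i) $ j') z" for i j j'
      by (cases "j' = j") (auto intro: contn)
    then show ?thesis unfolding H_def by (intro continuous_intros isCont_det)
  qed
  have "\<forall>\<^sub>F z in at_left (v k). z < v k" by (simp add: eventually_at_filter)
  then have "\<forall>\<^sub>F z in at_left (v k). \<exists>f\<in>UNIV. D f z \<noteq> 0 \<and> \<bar>D f z\<bar> \<le> (v k - z) * B * \<bar>H f z\<bar>"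
    by eventually_elim (use constraint_vertex[OF s l _ B] in \<open>simp add: D_def H_def\<close>)
  then have "\<exists>\<^sub>F z in at_left (v k). \<exists>f\<in>UNIV. D f z \<noteq> 0 \<and> \<bar>D f z\<bar> \<le> (v k - z) * B * \<bar>H f z\<bar>"
    by (rule eventually_frequently[rotated]) simp
  \<comment> \<open>The vertex may change with \<open>z\<close>, but there are only finitely many
    maps \<open>f\<close>, so one of them serves for \<open>z\<close> arbitrarily close to
    \<open>v k\<close>.\<close>
  from frequently_bex_finite[OF finite_class.finite_UNIV this]
  obtain f where f: "\<exists>\<^sub>F z in at_left (v k). D f z \<noteq> 0 \<and> \<bar>D f z\<bar> \<le> (v k - z) * B * \<bar>H f z\<bar>"
    by auto
  have "D f (v k) = 0"
  proof (rule ccontr)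
    assume nz: "D f (v k) \<noteq> 0"
    have "isCont (D f) (v k)" "isCont (H f) (v k)" by (rule contD, rule contH)
    then have [tendsto_intros]: "(D f \<longlongrightarrow> D f (v k)) (at_left (v k))" "(H f \<longlongrightarrow> H f (v k)) (at_left (v k))"
      unfolding isCont_def by (auto intro: tendsto_mono[OF at_le])
    have "((\<lambda>z. \<bar>D f z\<bar> - (v k - z) * B * \<bar>H f z\<bar>)
      \<longlongrightarrow> \<bar>D f (v k)\<bar> - (v k - v k) * B * \<bar>H f (v k)\<bar>) (at_left (v k))"
      by (intro tendsto_intros)
    then have "\<forall>\<^sub>F z in at_left (v k). 0 < \<bar>D f z\<bar> - (v k - z) * B * \<bar>H f z\<bar>"
      by (rule order_tendstoD) (use nz in simp)
    then have "\<forall>\<^sub>F z in at_left (v k). \<not> (D f z \<noteq> 0 \<and> \<bar>D f z\<bar> \<le> (v k - z) * B * \<bar>H f z\<bar>)"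
      by eventually_elim simp
    with f show False by (simp add: frequently_def)
  qed
  \<comment> \<open>The determinant vanishes at \<open>v k\<close> without being the zero
    polynomial: it is nonzero at some nearby \<open>z\<close>.\<close>
  moreover obtain z where "D f z \<noteq> 0" using frequently_ex[OF f] by auto
  then have "det (\<chi> i. constraint_poly \<Gamma> k (f i)) \<noteq> 0" unfolding Dp by auto
  ultimately show ?thesis unfolding Dp by blast
qed

text \<open>The vertex depends on the rate. Multiplying the nonzero determinants of all candidate
  vertices gives one polynomial that works for every rate.\<close>

theorem discounted_value_algebraic:
  fixes \<Gamma> :: "('w::finite, 'i::finite, 'j::finite) stochastic_game"
  shows "\<exists>P. P \<noteq> 0 \<and> (\<forall>l. 0 < l \<and> l \<le> 1 \<longrightarrow> poly2 P l (discounted_value \<Gamma> l k) = 0)"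
proof -
  define G where "G = {f :: ('w \<Rightarrow> 'j) \<Rightarrow> ('w \<Rightarrow> 'i) + ('w \<Rightarrow> 'j). det (\<chi> i. constraint_poly \<Gamma> k (f i)) \<noteq> 0}"
  define P where "P = (\<Prod>f\<in>G. det (\<chi> i. constraint_poly \<Gamma> k (f i)))"
  have "P \<noteq> 0" unfolding P_def G_def by simp
  moreover have "poly2 P l (discounted_value \<Gamma> l k) = 0" if l: "0 < l" "l \<le> 1" for l
  proof -
    obtain v x y where s: "shapley_solution \<Gamma> l v x y" using shapley_solution_exists[of l \<Gamma>] l by auto
    obtain f where "f \<in> G" "poly2 (det (\<chi> i. constraint_poly \<Gamma> k (f i))) l (v k) = 0"
      using vertex_determinant_zero[OF s l, of k] unfolding G_def by auto
    then show ?thesis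
      unfolding shapley_solution_discounted_value[OF s l] P_def poly2_prod by (auto intro!: prod_zero)
  qed
  ultimately show ?thesis by blast
qed

section \<open>Derivative of the discounted value\<close>

lemma pmf_sequence_compact:
  fixes X :: "nat \<Rightarrow> 's::finite \<Rightarrow> 'c::finite pmf"
  obtains r x where "strict_mono r" "\<And>s c. (\<lambda>n. pmf (X (r n) s) c) \<longlonglongrightarrow> pmf (x s) c"
proof -
  define f where "f n = (\<chi> p. pmf (X n (fst p)) (snd p))" for n
  have "f n \<in> cbox 0 (\<chi> p. 1)" for n
    by (auto simp: f_def mem_box_cart pmf_le_1)
  then obtain u r where u: "u \<in> cbox 0 (\<chi> p. 1)" "strict_mono (r :: nat \<Rightarrow> nat)" "(f \<circ> r) \<longlonglongrightarrow> u"
    using compact_cbox[of 0 "\<chi> p. 1"] unfolding compact_def by blast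
  have lim: "(\<lambda>n. pmf (X (r n) s) c) \<longlonglongrightarrow> u $ (s, c)" for s c
    using tendsto_vec_nth[OF u(3), of "(s, c)"] by (simp add: f_def comp_def)
  have "\<exists>p. \<forall>c. pmf p c = u $ (s, c)" for s
  proof -
    have "0 \<le> u $ (s, c)" for c using u(1) by (auto simp: mem_box_cart)
    moreover have "(\<lambda>n. \<Sum>c\<in>UNIV. pmf (X (r n) s) c) \<longlonglongrightarrow> (\<Sum>c\<in>UNIV. u $ (s, c))"
      by (intro tendsto_sum lim)
    then have "(\<Sum>c\<in>UNIV. u $ (s, c)) = 1" by (simp add: LIMSEQ_const_iff)
    ultimately show ?thesis using pmf_of_weights[of "\<lambda>c. u $ (s, c)"] by metis
  qed
  then obtain x where "\<And>s c. pmf (x s) c = u $ (s, c)" by metis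
  with that[OF u(2), of x] lim show ?thesis by simp
qed

lemma shapley_solution_discounted_value_exists:
  assumes "0 < l" "l \<le> 1"
  shows "\<exists>x y. shapley_solution \<Gamma> l (discounted_value \<Gamma> l) x y"
  using shapley_solution_exists[of l \<Gamma>] shapley_solution_discounted_value[of \<Gamma> l] assms by fastforce

lemma next_value_abs_le: "(\<And>s. \<bar>v s\<bar> \<le> c) \<Longrightarrow> \<bar>next_value \<Gamma> v s i j\<bar> \<le> c"
  unfolding next_value_def by (rule pmf_avg_abs_le)

lemma next_value_diff: "next_value \<Gamma> (\<lambda>s. v s - w s) s i j = next_value \<Gamma> v s i j - next_value \<Gamma> w s i j"
  by (simp add: next_value_def right_diff_distrib sum_subtractf)

lemma next_value_cmult: "next_value \<Gamma> (\<lambda>s. c * v s) s i j = c * next_value \<Gamma> v s i j"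
  by (simp add: next_value_def sum_distrib_left mult_ac)

lemma discounted_value_abs_le:
  assumes "0 < l" "l \<le> 1"
  shows "\<bar>discounted_value \<Gamma> l s\<bar> \<le> payoff_bound \<Gamma>"
  using shapley_solution_discounted_value_exists[OF assms, of \<Gamma>] shapley_solution_abs_le[OF _ assms]
    by blast

text \<open>Arranged for division by \<open>m - l\<close>, which turns the last term into a
  difference quotient of the continuation values.\<close>

lemma local_game_diff:
  "local_game \<Gamma> m w s i j - local_game \<Gamma> l v s i j
    = (m - l) * (payoff \<Gamma> s i j - next_value \<Gamma> v s i j) + (1 - m) * next_value \<Gamma> (\<lambda>s. w s - v s) s i j"
  by (simp add: local_game_def next_value_diff algebra_simps)

text \<open>At a state where the difference \<open>d\<close> is largest, comparison of the local
  games gives \<open>d \<le> 2 * C * \<bar>l - m\<bar> + (1 - l) * d\<close>, and solving for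
  \<open>d\<close> divides by \<open>l\<close>.\<close>

lemma discounted_value_diff_le:
  assumes l: "0 < l" "l \<le> 1" and m: "0 < m" "m \<le> 1"
  shows "\<bar>discounted_value \<Gamma> l s - discounted_value \<Gamma> m s\<bar> \<le> 2 * payoff_bound \<Gamma> * \<bar>l - m\<bar> / l"
proof -
  define V where "V = discounted_value \<Gamma>"
  define C where "C = payoff_bound \<Gamma>"
  define d where "d = Max (range (\<lambda>s. \<bar>V l s - V m s\<bar>))"
  have d: "\<bar>V l s - V m s\<bar> \<le> d" for s unfolding d_def by (rule Max_ge) auto
  have "d \<in> range (\<lambda>s. \<bar>V l s - V m s\<bar>)" unfolding d_def by (rule Max_in) auto
  then obtain s0 where s0: "d = \<bar>V l s0 - V m s0\<bar>" by auto
  obtain x y x' y' where sol: "shapley_solution \<Gamma> l (V l) x y" "shapley_solution \<Gamma> m (V m) x' y'"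
    using shapley_solution_discounted_value_exists[OF l, of \<Gamma>]
      shapley_solution_discounted_value_exists[OF m, of \<Gamma>]
    unfolding V_def by blast
  define e where "e = 2 * C * \<bar>l - m\<bar> + (1 - l) * d"
  have e: "\<bar>local_game \<Gamma> l (V l) s i j - local_game \<Gamma> m (V m) s i j\<bar> \<le> e" for s i j
  proof -
    have "\<bar>payoff \<Gamma> s i j - next_value \<Gamma> (V m) s i j\<bar> \<le> C + C"
      using payoff_bound[of \<Gamma> s i j] next_value_abs_le[of "V m" C \<Gamma> s i j] discounted_value_abs_le[OF m]
      unfolding C_def V_def by fastforce
    then have "\<bar>(l - m) * (payoff \<Gamma> s i j - next_value \<Gamma> (V m) s i j)\<bar> \<le> \<bar>l - m\<bar> * (C + C)"
      unfolding abs_mult by (rule mult_left_mono) simp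
    moreover have "\<bar>(1 - l) * next_value \<Gamma> (\<lambda>s. V l s - V m s) s i j\<bar> \<le> (1 - l) * d"
      unfolding abs_mult using l by (intro mult_mono next_value_abs_le d) auto
    ultimately show ?thesis unfolding local_game_diff e_def by (simp add: algebra_simps)
  qed
  have sad: "saddle (local_game \<Gamma> l (V l) s0) (V l s0) (x s0) (y s0)"
    "saddle (local_game \<Gamma> m (V m) s0) (V m s0) (x' s0) (y' s0)"
    using sol unfolding shapley_solution_def by auto
  have "V l s0 \<le> V m s0 + e"
    by (rule saddle_value_mono[OF sad]) (use e in \<open>simp add: abs_le_iff diff_le_eq add.commute\<close>)
  moreover have "V m s0 \<le> V l s0 + e"
    by (rule saddle_value_mono[OF sad(2,1)]) (use e in \<open>simp add: abs_le_iff diff_le_eq add.commute\<close>)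
  ultimately have "d \<le> e" unfolding s0 by linarith
  then have "d \<le> 2 * C * \<bar>l - m\<bar> / l" unfolding e_def using l by (simp add: field_simps)
  with d[of s] show ?thesis unfolding V_def C_def by linarith
qed

lemma isCont_discounted_value:
  assumes l: "0 < l" "l < 1"
  shows "isCont (\<lambda>l. discounted_value \<Gamma> l s) l"
proof -
  have "((\<lambda>m. discounted_value \<Gamma> m s - discounted_value \<Gamma> l s) \<longlongrightarrow> 0) (at l)"
  proof (rule Lim_null_comparison)
    have "\<forall>\<^sub>F m in at l. m \<in> {0<..<1}"
      using l by (intro eventually_at_in_open') auto
    then show "\<forall>\<^sub>F m in at l. norm (discounted_value \<Gamma> m s - discounted_value \<Gamma> l s)
      \<le> 2 * payoff_bound \<Gamma> * \<bar>l - m\<bar> / l"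
      by eventually_elim (use discounted_value_diff_le[of l _ \<Gamma> s] l in \<open>auto simp: abs_minus_commute\<close>)
    show "((\<lambda>m. 2 * payoff_bound \<Gamma> * \<bar>l - m\<bar> / l) \<longlongrightarrow> 0) (at l)"
      by (rule tendsto_eq_intros refl | use l in simp)+
  qed
  then show ?thesis unfolding isCont_def by (rule LIM_zero_cancel)
qed

lemma tendsto_bilinear_payoff:
  assumes "\<And>i j. (\<lambda>n. A n i j) \<longlonglongrightarrow> B i j" "\<And>i. (\<lambda>n. pmf (x n) i) \<longlonglongrightarrow> pmf x' i" "\<And>j. (\<lambda>n. pmf (y n) j)
    \<longlonglongrightarrow> pmf y' j"
  shows "(\<lambda>n. bilinear_payoff (A n) (x n) (y n)) \<longlonglongrightarrow> bilinear_payoff B x' y'"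
  unfolding bilinear_payoff_def by (intro tendsto_intros assms)

text \<open>The pair is a limit of optimal pairs for rates \<open>\<mu>\<close> decreasing to \<open>l\<close>. Playing the optimal strategy
  for \<open>\<mu>\<close> against the one for \<open>l\<close>, in either role, and dividing by \<open>\<mu> - l\<close> gives the two inequalities.\<close>

lemma shapley_solution_derivative:
  fixes \<Gamma> :: "('w::finite, 'i::finite, 'j::finite) stochastic_game"
  assumes l: "0 < l" "l < 1"
    and D: "\<And>s. ((\<lambda>l. discounted_value \<Gamma> l s) has_real_derivative D s) (at l)"
  obtains x y where "shapley_solution \<Gamma> l (discounted_value \<Gamma> l) x y"
    "\<And>s. bilinear_payoff (\<lambda>i j. payoff \<Gamma> s i j - next_value \<Gamma> (discounted_value \<Gamma> l) s i j + (1 - l) *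
      next_value \<Gamma> D s i j) (x s) (y s) = D s"
proof -
  define V where "V = discounted_value \<Gamma>"
  define \<mu>' where "\<mu>' n = l + (1 - l) / real (n + 2)" for n
  have \<mu>': "l < \<mu>' n" "\<mu>' n < 1" for n
  proof -
    have "(1 - l) / real (n + 2) < 1 - l" using l by (simp add: divide_less_eq)
    then show "\<mu>' n < 1" by (simp add: \<mu>'_def)
    show "l < \<mu>' n" using l by (simp add: \<mu>'_def)
  qed
  have "(\<lambda>n. inverse (real (n + 2))) \<longlonglongrightarrow> 0"
    by (rule LIMSEQ_ignore_initial_segment[OF lim_inverse_n])
  from tendsto_add[OF tendsto_const[of l] tendsto_mult[OF tendsto_const[of "1 - l"] this]]
  have \<mu>'_lim: "\<mu>' \<longlonglongrightarrow> l" by (simp add: \<mu>'_def[abs_def] divide_inverse)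
  have "\<exists>x y. shapley_solution \<Gamma> (\<mu>' n) (V (\<mu>' n)) x y" for n
    unfolding V_def using \<mu>'[of n] l by (intro shapley_solution_discounted_value_exists) auto
  then obtain X' Y' where XY': "\<And>n. shapley_solution \<Gamma> (\<mu>' n) (V (\<mu>' n)) (X' n) (Y' n)" by metis
  obtain r x where r: "strict_mono r" "\<And>s c. (\<lambda>n. pmf (X' (r n) s) c) \<longlonglongrightarrow> pmf (x s) c"
    using pmf_sequence_compact[of X'] by blast
  obtain q y where q: "strict_mono q" "\<And>s c. (\<lambda>n. pmf (Y' (r (q n)) s) c) \<longlonglongrightarrow> pmf (y s) c"
    using pmf_sequence_compact[of "\<lambda>n. Y' (r n)"] by blast
  define p where "p n = r (q n)" for n
  have p: "strict_mono p" unfolding p_def using r(1) q(1) by (simp add: strict_mono_def)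
  define \<mu> where "\<mu> n = \<mu>' (p n)" for n
  define X where "X n = X' (p n)" for n
  define Y where "Y n = Y' (p n)" for n
  have \<mu>: "l < \<mu> n" "\<mu> n < 1" "0 < \<mu> n" for n unfolding \<mu>_def using \<mu>'[of "p n"] l by auto
  have \<mu>_lim: "\<mu> \<longlonglongrightarrow> l" using LIMSEQ_subseq_LIMSEQ[OF \<mu>'_lim p] by (simp add: \<mu>_def[abs_def] comp_def)
  have Xlim: "(\<lambda>n. pmf (X n s) c) \<longlonglongrightarrow> pmf (x s) c" for s c
    using LIMSEQ_subseq_LIMSEQ[OF r(2) q(1)] by (simp add: X_def p_def comp_def)
  have Ylim: "(\<lambda>n. pmf (Y n s) c) \<longlonglongrightarrow> pmf (y s) c" for s c using q(2) by (simp add: Y_def p_def)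
  have XY: "shapley_solution \<Gamma> (\<mu> n) (V (\<mu> n)) (X n) (Y n)" for n unfolding \<mu>_def X_def Y_def by (rule XY')
  have \<mu>_at: "filterlim \<mu> (at l) sequentially"
    unfolding filterlim_at using \<mu>_lim \<mu>(1)
      by (auto intro!: always_eventually simp: less_imp_neq[symmetric])
  have Vlim: "(\<lambda>n. V (\<mu> n) s) \<longlonglongrightarrow> V l s" for s
    unfolding V_def by (rule isCont_tendsto_compose[OF isCont_discounted_value[OF l] \<mu>_lim])
  have nlim: "(\<lambda>n. next_value \<Gamma> (w n) s i j) \<longlonglongrightarrow> next_value \<Gamma> w' s i j" if "\<And>s. (\<lambda>n. w n s)
    \<longlonglongrightarrow> w' s" for w w' s i j
    unfolding next_value_def by (intro tendsto_intros that)
  have Glim: "(\<lambda>n. local_game \<Gamma> (\<mu> n) (V (\<mu> n)) s i j) \<longlonglongrightarrow> local_game \<Gamma> l (V l) s i j" for s i j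
    unfolding local_game_def by (intro tendsto_intros nlim Vlim \<mu>_lim)
  have sol: "shapley_solution \<Gamma> l (V l) x y"
    unfolding shapley_solution_def saddle_def
  proof (intro allI conjI)
    fix s j
    show "V l s \<le> (\<Sum>i\<in>UNIV. pmf (x s) i * local_game \<Gamma> l (V l) s i j)"
    proof (rule LIMSEQ_le[OF Vlim])
      show "(\<lambda>n. \<Sum>i\<in>UNIV. pmf (X n s) i * local_game \<Gamma> (\<mu> n) (V (\<mu> n)) s i j)
        \<longlonglongrightarrow> (\<Sum>i\<in>UNIV. pmf (x s) i * local_game \<Gamma> l (V l) s i j)"
        by (intro tendsto_intros Xlim Glim)
    qed (use XY in \<open>auto simp: shapley_solution_def saddle_def\<close>)
  next
    fix s i
    show "(\<Sum>j\<in>UNIV. pmf (y s) j * local_game \<Gamma> l (V l) s i j) \<le> V l s"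
    proof (rule LIMSEQ_le[OF _ Vlim])
      show "(\<lambda>n. \<Sum>j\<in>UNIV. pmf (Y n s) j * local_game \<Gamma> (\<mu> n) (V (\<mu> n)) s i j)
        \<longlonglongrightarrow> (\<Sum>j\<in>UNIV. pmf (y s) j * local_game \<Gamma> l (V l) s i j)"
        by (intro tendsto_intros Ylim Glim)
    qed (use XY in \<open>auto simp: shapley_solution_def saddle_def\<close>)
  qed
  define dq where "dq n s = (V (\<mu> n) s - V l s) / (\<mu> n - l)" for n s
  have dq: "(\<lambda>n. dq n s) \<longlonglongrightarrow> D s" for s
    using D[of s] \<mu>_at unfolding has_field_derivative_iff dq_def V_def by (rule filterlim_compose)
  \<comment> \<open>The difference quotient of the local games between the rates \<open>l\<close>
    and \<open>\<mu> n\<close>; its limit \<open>M'\<close> is the derivative of the local game at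
    \<open>l\<close>.\<close>
  define M where "M n s i j
    = payoff \<Gamma> s i j - next_value \<Gamma> (V l) s i j + (1 - \<mu> n) * next_value \<Gamma> (dq n) s i j" for n s i j
  define M' where "M' s i j
    = payoff \<Gamma> s i j - next_value \<Gamma> (V l) s i j + (1 - l) * next_value \<Gamma> D s i j" for s i j
  have Mlim: "(\<lambda>n. M n s i j) \<longlonglongrightarrow> M' s i j" for s i j
    unfolding M_def M'_def by (intro tendsto_intros nlim dq \<mu>_lim)
  have M: "local_game \<Gamma> (\<mu> n) (V (\<mu> n)) s i j
    = local_game \<Gamma> l (V l) s i j + (\<mu> n - l) * M n s i j" for n s i j
  proof -
    have "(\<lambda>s. V (\<mu> n) s - V l s) = (\<lambda>s. (\<mu> n - l) * dq n s)"
      using \<mu>(1)[of n] by (auto simp: dq_def)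
    note this[THEN arg_cong, of "\<lambda>w. next_value \<Gamma> w s i j", unfolded next_value_cmult]
    then show ?thesis
      using local_game_diff[of \<Gamma> "\<mu> n" "V (\<mu> n)" s i j l "V l"]
      by (simp only: M_def) (simp add: ring_distribs mult_ac)
  qed
  have bil: "bilinear_payoff (local_game \<Gamma> (\<mu> n) (V (\<mu> n)) s) a b
    = bilinear_payoff (local_game \<Gamma> l (V l) s) a b + (\<mu> n - l) * bilinear_payoff (M n s) a b" for n s a b
    unfolding M[abs_def] by (simp add: bilinear_payoff_add bilinear_payoff_cmult)
  have "bilinear_payoff (M' s) (x s) (y s) = D s" for s
  proof (rule antisym)
    show "D s \<le> bilinear_payoff (M' s) (x s) (y s)"
    proof (rule LIMSEQ_le[OF dq])
      show "(\<lambda>n. bilinear_payoff (M n s) (X n s) (y s)) \<longlonglongrightarrow> bilinear_payoff (M' s) (x s) (y s)"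
        by (intro tendsto_bilinear_payoff Mlim Xlim tendsto_const)
      have "dq n s \<le> bilinear_payoff (M n s) (X n s) (y s)" for n
      proof -
        have "V (\<mu> n) s \<le> bilinear_payoff (local_game \<Gamma> (\<mu> n) (V (\<mu> n)) s) (X n s) (y s)"
          using XY[of n] by (auto simp: shapley_solution_def intro: saddle_le)
        moreover have "bilinear_payoff (local_game \<Gamma> l (V l) s) (X n s) (y s) \<le> V l s"
          using sol by (auto simp: shapley_solution_def intro: saddle_ge)
        ultimately have "V (\<mu> n) s - V l s \<le> (\<mu> n - l) * bilinear_payoff (M n s) (X n s) (y s)"
          unfolding bil by linarith
        then show ?thesis using \<mu>(1)[of n] by (simp add: dq_def field_simps)
      qed
      then show "\<exists>N. \<forall>n\<ge>N. dq n s \<le> bilinear_payoff (M n s) (X n s) (y s)" by blast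
    qed
    show "bilinear_payoff (M' s) (x s) (y s) \<le> D s"
    proof (rule LIMSEQ_le[OF _ dq])
      show "(\<lambda>n. bilinear_payoff (M n s) (x s) (Y n s)) \<longlonglongrightarrow> bilinear_payoff (M' s) (x s) (y s)"
        by (intro tendsto_bilinear_payoff Mlim Ylim tendsto_const)
      have "bilinear_payoff (M n s) (x s) (Y n s) \<le> dq n s" for n
      proof -
        have "bilinear_payoff (local_game \<Gamma> (\<mu> n) (V (\<mu> n)) s) (x s) (Y n s) \<le> V (\<mu> n) s"
          using XY[of n] by (auto simp: shapley_solution_def intro: saddle_ge)
        moreover have "V l s \<le> bilinear_payoff (local_game \<Gamma> l (V l) s) (x s) (Y n s)"
          using sol by (auto simp: shapley_solution_def intro: saddle_le)
        ultimately have "(\<mu> n - l) * bilinear_payoff (M n s) (x s) (Y n s) \<le> V (\<mu> n) s - V l s"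
          unfolding bil by linarith
        then show ?thesis using \<mu>(1)[of n] by (simp add: dq_def field_simps)
      qed
      then show "\<exists>N. \<forall>n\<ge>N. bilinear_payoff (M n s) (x s) (Y n s) \<le> dq n s" by blast
    qed
  qed
  then show ?thesis using that[of x y] sol unfolding V_def M'_def by blast
qed

section \<open>The limit value\<close>

lemma discounted_value_asymptotics:
  fixes \<Gamma> :: "('w::finite, 'i::finite, 'j::finite) stochastic_game"
  obtains e D L where "0 < e" "e \<le> 1"
    "\<And>l s. 0 < l \<Longrightarrow> l < e \<Longrightarrow> ((\<lambda>l. discounted_value \<Gamma> l s) has_real_derivative D l s) (at l)"
    "\<And>s. ((\<lambda>l. l * D l s) \<longlongrightarrow> 0) (at_right 0)"
    "\<And>s. ((\<lambda>l. discounted_value \<Gamma> l s) \<longlongrightarrow> L s) (at_right 0)"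
proof -
  define G where "G s e f' L \<longleftrightarrow> 0 < e \<and> e \<le> 1
    \<and> (\<forall>l. 0 < l \<longrightarrow> l < e \<longrightarrow> ((\<lambda>l. discounted_value \<Gamma> l s) has_real_derivative f' l) (at l))
    \<and> ((\<lambda>l. l * f' l) \<longlongrightarrow> 0) (at_right 0) \<and> ((\<lambda>l. discounted_value \<Gamma> l s) \<longlongrightarrow> L) (at_right 0)" for s e f' L
  have "\<exists>e f' L. G s e f' L" for s
  proof -
    obtain P where P: "P \<noteq> 0" "\<And>l. 0 < l \<Longrightarrow> l \<le> 1 \<Longrightarrow> poly2 P l (discounted_value \<Gamma> l s) = 0"
      using discounted_value_algebraic[of \<Gamma> s] by blast
    have b: "\<bar>discounted_value \<Gamma> l s\<bar> \<le> payoff_bound \<Gamma>" if "0 < l" "l < 1" for l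
      using that by (intro discounted_value_abs_le) auto
    show ?thesis
    proof (rule bounded_algebraic_function[where f="\<lambda>l. discounted_value \<Gamma> l s", OF P
      isCont_discounted_value b])
      fix e f' L
      assume "0 < e" "e \<le> 1" "\<And>l. 0 < l \<Longrightarrow> l < e \<Longrightarrow>
        ((\<lambda>l. discounted_value \<Gamma> l s) has_real_derivative f' l) (at l)"
        "((\<lambda>l. l * f' l) \<longlongrightarrow> 0) (at_right 0)" "((\<lambda>l. discounted_value \<Gamma> l s) \<longlongrightarrow> L) (at_right 0)"
      then have "G s e f' L" unfolding G_def by blast
      then show "\<exists>e f' L. G s e f' L" by blast
    qed
  qed
  then obtain e D L where "\<And>s. G s (e s) (D s) (L s)" by metis
  note e = this[unfolded G_def]
  define e0 where "e0 = Min (range e)"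
  have e0: "e0 \<le> e s" for s unfolding e0_def by (rule Min_le) auto
  have "0 < e0" unfolding e0_def using e by (subst Min_gr_iff) auto
  moreover have "e0 \<le> 1" using e0[of undefined] e[of undefined] by linarith
  moreover have "((\<lambda>l. discounted_value \<Gamma> l s) has_real_derivative D s l) (at l)" if "0 < l" "l < e0"
    for l s
    using e[of s] e0[of s] that by auto
  ultimately show ?thesis using that[of e0 "\<lambda>l s. D s l" L] e by auto
qed

lemma cesaro_mean_null:
  fixes c :: "nat \<Rightarrow> real"
  assumes "c \<longlonglongrightarrow> 0"
  shows "(\<lambda>n. (\<Sum>k<n. c k) / n) \<longlonglongrightarrow> 0"
proof (rule LIMSEQ_I)
  fix r :: real assume r: "0 < r"
  then obtain N where N: "\<And>k. N \<le> k \<Longrightarrow> \<bar>c k\<bar> < r / 2"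
    using LIMSEQ_D[OF assms, of "r / 2"] by auto
  define B where "B = (\<Sum>k<N. \<bar>c k\<bar>)"
  have "norm ((\<Sum>k<n. c k) / n - 0) < r" if n: "n \<ge> N + nat \<lceil>2 * B / r\<rceil> + 1" for n
  proof -
    have "\<bar>\<Sum>k<n. c k\<bar> \<le> (\<Sum>k<n. \<bar>c k\<bar>)" by (rule sum_abs)
    also have "\<dots> = B + (\<Sum>k\<in>{N..<n}. \<bar>c k\<bar>)"
      unfolding B_def using n by (subst sum.union_disjoint[symmetric]) (auto intro!: sum.cong)
    also have "(\<Sum>k\<in>{N..<n}. \<bar>c k\<bar>) \<le> (\<Sum>k\<in>{N..<n}. r / 2)"
      by (intro sum_mono, rule less_imp_le, rule N) simp
    also have "\<dots> \<le> n * (r / 2)" using r by (simp add: mult_right_mono)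
    finally have "\<bar>\<Sum>k<n. c k\<bar> \<le> B + n * (r / 2)" by simp
    moreover have "2 * B / r < n" using n by linarith
    then have "B < n * (r / 2)" using r by (simp add: field_simps)
    ultimately have "\<bar>\<Sum>k<n. c k\<bar> < n * r" by linarith
    moreover have "0 < real n" using n by simp
    ultimately show ?thesis by (simp add: field_simps)
  qed
  then show "\<exists>no. \<forall>n\<ge>no. norm ((\<Sum>k<n. c k) / n - 0) < r" by blast
qed

text \<open>For \<open>i = 0\<close> the junk rate \<open>1 / 0\<close> is harmless because of the factor \<open>i\<close>.\<close>

definition value_increment :: "('w::finite, 'i::finite, 'j::finite) stochastic_game \<Rightarrow> nat \<Rightarrow> real" where
  "value_increment \<Gamma> i
    = real i * (\<Sum>s\<in>UNIV. \<bar>discounted_value \<Gamma> (1 / real (Suc i)) s - discounted_value \<Gamma> (1 / real i) s\<bar>)"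

text \<open>By the mean value theorem the increment is the derivative at some \<open>\<xi>\<close>
  between the two rates, divided by \<open>i * (i + 1)\<close>. The factor \<open>i\<close> leaves
  \<open>1 / (i + 1)\<close>, which is less than \<open>\<xi>\<close>, so the product of
  \<open>\<xi>\<close> and the derivative at \<open>\<xi>\<close> dominates.\<close>

lemma value_increment_null: "value_increment \<Gamma> \<longlonglongrightarrow> 0"
proof -
  obtain e D where e: "0 < e" "e \<le> 1"
    "\<And>l s. 0 < l \<Longrightarrow> l < e \<Longrightarrow> ((\<lambda>l. discounted_value \<Gamma> l s) has_real_derivative D l s) (at l)"
    "\<And>s. ((\<lambda>l. l * D l s) \<longlongrightarrow> 0) (at_right 0)"
    by (rule discounted_value_asymptotics[of \<Gamma>]) blast
  define V where "V = discounted_value \<Gamma>"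
  have "(\<lambda>i. real i * \<bar>V (1 / real (Suc i)) s - V (1 / real i) s\<bar>) \<longlonglongrightarrow> 0" for s
  proof (rule LIMSEQ_I)
    fix r :: real assume r: "0 < r"
    have "\<forall>\<^sub>F l in at_right 0. \<bar>l * D l s\<bar> < r"
      using tendstoD[OF e(4) r, of s] by (simp add: dist_real_def)
    then obtain d where d: "d > 0" "\<And>l. 0 < l \<Longrightarrow> l < d \<Longrightarrow> \<bar>l * D l s\<bar> < r"
      unfolding eventually_at_right_0_iff by blast
    define N where "N = nat \<lceil>1 / min d e\<rceil> + 1"
    have "norm (real i * \<bar>V (1 / real (Suc i)) s - V (1 / real i) s\<bar> - 0) < r" if "i \<ge> N" for i
    proof -
      have i: "0 < real i" "1 / min d e < real i" using that unfolding N_def by linarith+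
      have "0 < min d e" using d(1) e(1) by simp
      with i(2) have "1 < real i * min d e" by (metis pos_divide_less_eq)
      then have il: "1 / real i < min d e" using i(1) by (metis mult.commute pos_divide_less_eq)
      have lt: "1 / real (Suc i) < 1 / real i" using i by (simp add: field_simps)
      have pos: "0 < 1 / real (Suc i)" by simp
      obtain \<xi> where \<xi>: "1 / real (Suc i) < \<xi>" "\<xi> < 1 / real i"
        "V (1 / real i) s - V (1 / real (Suc i)) s = (1 / real i - 1 / real (Suc i)) * D \<xi> s"
        using MVT2[OF lt, of "\<lambda>l. V l s" "\<lambda>l. D l s"] e(3)[of _ s] il pos unfolding V_def
        by (meson le_less_trans less_le_trans min_less_iff_conj)
      have \<xi>0: "0 < \<xi>" using \<xi>(1) pos by linarith
      have "1 / real i - 1 / real (Suc i) = 1 / (real i * real (Suc i))" using i by (simp add: field_simps)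
      then have "real i * \<bar>V (1 / real (Suc i)) s - V (1 / real i) s\<bar> = (1 / real (Suc i)) * \<bar>D \<xi> s\<bar>"
        unfolding abs_minus_commute[of "V (1 / real (Suc i)) s"] \<xi>(3) using i by (simp add: abs_mult)
      also have "\<dots> \<le> \<xi> * \<bar>D \<xi> s\<bar>" using \<xi>(1) by (intro mult_right_mono) auto
      also have "\<dots> < r" using d(2)[of \<xi>] \<xi>0 \<xi>(2) il by (simp add: abs_mult)
      finally show ?thesis by simp
    qed
    then show "\<exists>no. \<forall>i\<ge>no. norm (real i * \<bar>V (1 / real (Suc i)) s - V (1 / real i) s\<bar> - 0) < r" by blast
  qed
  then have "(\<lambda>i. \<Sum>s\<in>UNIV. real i * \<bar>V (1 / real (Suc i)) s - V (1 / real i) s\<bar>) \<longlonglongrightarrow> (\<Sum>s::'a\<in>UNIV. 0)"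
    by (intro tendsto_sum)
  then show ?thesis unfolding value_increment_def[abs_def] V_def by (simp add: sum_distrib_left)
qed

section \<open>The \<open>n\<close>-stage values follow the discounted values\<close>

lemma value_increment_bound:
  "real i * \<bar>discounted_value \<Gamma> (1 / real (Suc i)) s - discounted_value \<Gamma> (1 / real i) s\<bar>
    \<le> value_increment \<Gamma> i"
  unfolding value_increment_def
  by (intro mult_left_mono member_le_sum[where f="\<lambda>s. \<bar>discounted_value \<Gamma> (1 / real (Suc i)) s -
    discounted_value \<Gamma> (1 / real i) s\<bar>"]) auto

lemma nstage_payoff_abs_le: "\<bar>nstage_payoff \<Gamma> n \<omega> \<sigma> \<rho>\<bar> \<le> payoff_bound \<Gamma>"
proof -
  have "\<bar>\<Sum>k<n. expected_payoff \<Gamma> \<omega> \<sigma> \<rho> k\<bar> \<le> (\<Sum>k<n. payoff_bound \<Gamma>)"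
    by (rule order_trans[OF sum_abs sum_mono[OF expected_payoff_abs_le]])
  then show ?thesis
    using payoff_bound_nonneg[of \<Gamma>] unfolding nstage_payoff_eq
    by (cases "n = 0") (auto simp: field_simps)
qed

lemma telescoping_bound:
  fixes T g c :: "nat \<Rightarrow> real"
  assumes "\<And>k. k < n \<Longrightarrow> T k \<le> g k + T (Suc k) + c k"
  shows "T 0 \<le> (\<Sum>k<n. g k) + T n + (\<Sum>k<n. c k)"
  using assms
proof (induction n)
  case (Suc n)
  then have "T 0 \<le> (\<Sum>k<n. g k) + T n + (\<Sum>k<n. c k)" "T n \<le> g n + T (Suc n) + c n" by auto
  then show ?case by simp
qed simp

lemma expected_value_change_bound:
  assumes "\<And>s. real i * \<bar>v s - w s\<bar> \<le> c"
  shows "real i * expected_value \<Gamma> \<omega> \<sigma> \<rho> k v \<le> real i * expected_value \<Gamma> \<omega> \<sigma> \<rho> k w + c"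
proof -
  have "\<bar>stage_expectation \<Gamma> \<omega> \<sigma> \<rho> k (\<lambda>t. real i * (v (fst t) - w (fst t)))\<bar> \<le> c"
    by (rule stage_expectation_abs_le) (use assms in \<open>simp add: abs_mult\<close>)
  then show ?thesis
    unfolding stage_expectation_cmult stage_expectation_diff by (simp add: algebra_simps abs_le_iff)
qed

text \<open>With \<open>i + 1\<close> stages left, each player uses an optimal stationary action for
  the rate \<open>1 / (i + 1)\<close>. Multiplied by \<open>i + 1\<close>, the Shapley equation at
  this rate becomes the recursion of the finite game, except that the continuation is valued at the
  rate \<open>1 / (i + 1)\<close> rather than \<open>1 / i\<close>. Each such mismatch costs
  \<open>value_increment\<close>.\<close>

lemma nstage_value_bounds:
  fixes \<Gamma> :: "('w::finite, 'i::finite, 'j::finite) stochastic_game"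
  assumes n: "0 < n"
  shows "\<bar>nstage_value \<Gamma> n \<omega> - discounted_value \<Gamma> (1 / real n) \<omega>\<bar> \<le> (\<Sum>i<n. value_increment \<Gamma> i) / n"
proof -
  define V where "V = discounted_value \<Gamma>"
  have "\<exists>x y. shapley_solution \<Gamma> (1 / real (Suc i)) (V (1 / real (Suc i))) x y" for i
    unfolding V_def by (rule shapley_solution_discounted_value_exists) (auto simp: field_simps)
  then obtain X Y where XY: "\<And>i. shapley_solution \<Gamma> (1 / real (Suc i)) (V (1 / real (Suc i))) (X i) (Y
    i)" by metis
  have local: "bilinear_payoff (local_game \<Gamma> (1 / real (Suc i)) v s) a b
    = (1 / real (Suc i)) * bilinear_payoff (\<lambda>i' j. 1 * payoff \<Gamma> s i' j + real i * next_value \<Gamma> v s i' j)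
      a b" for i v s a b
    unfolding bilinear_payoff_cmult[symmetric]
  proof (rule arg_cong[of _ _ "\<lambda>A. bilinear_payoff A a b"], intro ext)
    have "1 - 1 / real (Suc i) = real i / real (Suc i)" by (simp add: field_simps)
    then show "local_game \<Gamma> (1 / real (Suc i)) v s i' j
      = 1 / real (Suc i) * (1 * payoff \<Gamma> s i' j + real i * next_value \<Gamma> v s i' j)" for i' j
      unfolding local_game_def by (simp add: distrib_left)
  qed
  \<comment> \<open>After a history of length \<open>k\<close> there are \<open>n - k\<close> stages
    to play, and \<open>X (n - Suc k)\<close> is optimal at the rate
    \<open>1 / (n - k)\<close>.\<close>
  define \<sigma> :: "('w, 'i, 'j, 'i) strategy" where "\<sigma> h s = X (n - Suc (length h)) s" for h s
  define \<rho> :: "('w, 'i, 'j, 'j) strategy" where "\<rho> h s = Y (n - Suc (length h)) s" for h s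
  define c where "c = value_increment \<Gamma>"
  have csum: "(\<Sum>k<n. c (n - Suc k)) = (\<Sum>i<n. c i)" by (rule sum.nat_diff_reindex)
  have ge: "V (1 / real n) \<omega> - (\<Sum>i<n. c i) / n \<le> nstage_payoff \<Gamma> n \<omega> \<sigma> \<rho>'" for \<rho>'
  proof -
    define T where "T k = real (n - k) * expected_value \<Gamma> \<omega> \<sigma> \<rho>' k (V (1 / real (n - k)))" for k
    have "T k \<le> expected_payoff \<Gamma> \<omega> \<sigma> \<rho>' k + T (Suc k) + c (n - Suc k)" if "k < n" for k
    proof -
      define i where "i = n - Suc k"
      have i: "n - k = Suc i" "n - Suc k = i" using that unfolding i_def by auto
      have "expected_value \<Gamma> \<omega> \<sigma> \<rho>' k (\<lambda>s. real (Suc i) * V (1 / real (Suc i)) s)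
        \<le> 1 * expected_payoff \<Gamma> \<omega> \<sigma> \<rho>' k + real i * expected_value \<Gamma> \<omega> \<sigma> \<rho>' (Suc k) (V (1 / real (Suc i)))"
      proof (rule one_step_ge)
        fix h :: "('w \<times> 'i \<times> 'j) list" and s assume "length h = k"
        then have "V (1 / real (Suc i)) s
          \<le> bilinear_payoff (local_game \<Gamma> (1 / real (Suc i)) (V (1 / real (Suc i))) s) (\<sigma> h s) (\<rho>' h s)"
          using XY[of i] i by (auto simp: \<sigma>_def shapley_solution_def intro: saddle_le)
        then show "real (Suc i) * V (1 / real (Suc i)) s
          \<le> bilinear_payoff (\<lambda>i' j. 1 * payoff \<Gamma> s i' j + real i * next_value \<Gamma> (V (1 / real (Suc i))) s
            i' j) (\<sigma> h s) (\<rho>' h s)"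
          unfolding local by (simp add: field_simps)
      qed
      moreover have "real i * expected_value \<Gamma> \<omega> \<sigma> \<rho>' (Suc k) (V (1 / real (Suc i)))
          \<le> real i * expected_value \<Gamma> \<omega> \<sigma> \<rho>' (Suc k) (V (1 / real i)) + c i"
        unfolding c_def V_def by (rule expected_value_change_bound) (rule value_increment_bound)
      ultimately show ?thesis unfolding T_def i stage_expectation_cmult by simp
    qed
    then have "T 0 \<le> (\<Sum>k<n. expected_payoff \<Gamma> \<omega> \<sigma> \<rho>' k) + T n + (\<Sum>k<n. c (n - Suc k))"
      by (rule telescoping_bound)
    moreover have "T 0 = real n * V (1 / real n) \<omega>" unfolding T_def by (simp add: stage_expectation_0)
    moreover have "T n = 0" unfolding T_def by simp
    ultimately show ?thesis unfolding nstage_payoff_eq csum using n by (simp add: field_simps)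
  qed
  have le: "nstage_payoff \<Gamma> n \<omega> \<sigma>' \<rho> \<le> V (1 / real n) \<omega> + (\<Sum>i<n. c i) / n" for \<sigma>'
  proof -
    define T where "T k = - (real (n - k) * expected_value \<Gamma> \<omega> \<sigma>' \<rho> k (V (1 / real (n - k))))" for k
    have "T k \<le> - expected_payoff \<Gamma> \<omega> \<sigma>' \<rho> k + T (Suc k) + c (n - Suc k)" if "k < n" for k
    proof -
      define i where "i = n - Suc k"
      have i: "n - k = Suc i" "n - Suc k = i" using that unfolding i_def by auto
      have "1 * expected_payoff \<Gamma> \<omega> \<sigma>' \<rho> k + real i * expected_value \<Gamma> \<omega> \<sigma>' \<rho> (Suc k) (V (1 / real (Suc i)))
        \<le> expected_value \<Gamma> \<omega> \<sigma>' \<rho> k (\<lambda>s. real (Suc i) * V (1 / real (Suc i)) s)"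
      proof (rule one_step_le)
        fix h :: "('w \<times> 'i \<times> 'j) list" and s assume "length h = k"
        then have "bilinear_payoff (local_game \<Gamma> (1 / real (Suc i)) (V (1 / real (Suc i))) s) (\<sigma>' h s)
          (\<rho> h s) \<le> V (1 / real (Suc i)) s"
          using XY[of i] i by (auto simp: \<rho>_def shapley_solution_def intro: saddle_ge)
        then show "bilinear_payoff (\<lambda>i' j. 1 * payoff \<Gamma> s i' j + real i * next_value \<Gamma> (V (1 / real (Suc
          i))) s i' j) (\<sigma>' h s) (\<rho> h s) \<le> real (Suc i) * V (1 / real (Suc i)) s"
          unfolding local by (simp add: field_simps)
      qed
      moreover have "real i * expected_value \<Gamma> \<omega> \<sigma>' \<rho> (Suc k) (V (1 / real i))
          \<le> real i * expected_value \<Gamma> \<omega> \<sigma>' \<rho> (Suc k) (V (1 / real (Suc i))) + c i"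
        unfolding c_def V_def
        by (rule expected_value_change_bound) (subst abs_minus_commute, rule value_increment_bound)
      ultimately show ?thesis unfolding T_def i stage_expectation_cmult by simp
    qed
    then have "T 0 \<le> (\<Sum>k<n. - expected_payoff \<Gamma> \<omega> \<sigma>' \<rho> k) + T n + (\<Sum>k<n. c (n - Suc k))"
      by (rule telescoping_bound)
    moreover have "T 0 = - real n * V (1 / real n) \<omega>" unfolding T_def by (simp add: stage_expectation_0)
    moreover have "T n = 0" unfolding T_def by simp
    ultimately show ?thesis unfolding nstage_payoff_eq csum using n
      by (simp add: sum_negf pos_divide_le_eq distrib_right) (simp add: mult.commute)
  qed
  have "V (1 / real n) \<omega> - (\<Sum>i<n. c i) / n \<le> nstage_value \<Gamma> n \<omega>"
    unfolding nstage_value_def by (rule SUP_INF_ge) (rule nstage_payoff_abs_le, rule ge)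
  moreover have "nstage_value \<Gamma> n \<omega> \<le> V (1 / real n) \<omega> + (\<Sum>i<n. c i) / n"
    unfolding nstage_value_def by (rule SUP_INF_le) (rule nstage_payoff_abs_le, rule le)
  ultimately show ?thesis unfolding V_def c_def by (simp add: abs_le_iff algebra_simps)
qed

lemma filterlim_inverse_nat_at_right: "filterlim (\<lambda>n. 1 / real n) (at_right 0) sequentially"
  unfolding filterlim_at
  using lim_1_over_n[where 'a=real] eventually_gt_at_top[of 0] by (auto elim!: eventually_mono)

lemma limit_value_eq:
  fixes \<Gamma> :: "('w::finite, 'i::finite, 'j::finite) stochastic_game"
  assumes L: "\<And>s. ((\<lambda>l. discounted_value \<Gamma> l s) \<longlongrightarrow> L s) (at_right 0)"
  shows "limit_value \<Gamma> = L"
proof -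
  have n: "(\<lambda>n. nstage_value \<Gamma> n \<omega>) \<longlonglongrightarrow> L \<omega>" for \<omega>
  proof -
    have "(\<lambda>n. nstage_value \<Gamma> n \<omega> - discounted_value \<Gamma> (1 / real n) \<omega>) \<longlonglongrightarrow> 0"
    proof (rule Lim_null_comparison)
      show "\<forall>\<^sub>F n in sequentially. norm (nstage_value \<Gamma> n \<omega> - discounted_value \<Gamma> (1 / real n) \<omega>)
        \<le> (\<Sum>i<n. value_increment \<Gamma> i) / n"
        using eventually_gt_at_top[of 0] by eventually_elim (simp add: nstage_value_bounds)
      show "(\<lambda>n. (\<Sum>i<n. value_increment \<Gamma> i) / n) \<longlonglongrightarrow> 0"
        by (rule cesaro_mean_null[OF value_increment_null])
    qed
    from tendsto_add[OF this filterlim_compose[OF L filterlim_inverse_nat_at_right, of \<omega>]] show ?thesis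
      by simp
  qed
  show ?thesis unfolding limit_value_def
  proof (rule the_equality)
    show "\<forall>\<omega>. (\<lambda>n. nstage_value \<Gamma> n \<omega>) \<longlonglongrightarrow> L \<omega> \<and> ((\<lambda>l. discounted_value \<Gamma> l \<omega>) \<longlongrightarrow> L \<omega>) (at_right 0)"
      using n L by blast
    fix v assume "\<forall>\<omega>. (\<lambda>n. nstage_value \<Gamma> n \<omega>) \<longlonglongrightarrow> v \<omega> \<and> ((\<lambda>l. discounted_value \<Gamma> l \<omega>) \<longlongrightarrow> v \<omega>) (at_right 0)"
    then show "v = L" using n LIMSEQ_unique by blast
  qed
qed

section \<open>Expected values along blocks of stages\<close>

lemma sum_upto_add:
  fixes g :: "nat \<Rightarrow> real"
  shows "(\<Sum>k<m + b. g k) = (\<Sum>k<m. g k) + (\<Sum>j<b. g (m + j))"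
  by (induction b) auto

text \<open>After \<open>K\<close> blocks \<open>E\<close> has moved by at most
  \<open>5 * K * \<eta>\<close>. Over a block of \<open>b \<le> a\<close> stages this displacement
  adds up to at most \<open>5 * \<eta> * n\<close>, because \<open>K * a \<le> n\<close>; with the
  block's own error \<open>7 * \<eta> * n\<close> this gives \<open>12 * \<eta> * n\<close> per
  block.\<close>

lemma block_sum_bound:
  fixes E g :: "nat \<Rightarrow> real" and n M a :: nat and \<eta> :: real
  assumes a: "0 < a" and M: "M \<le> n" and \<eta>: "0 \<le> \<eta>"
    and block: "\<And>K b. b \<le> a \<Longrightarrow> K * a < M \<Longrightarrow> K * a + b \<le> M \<Longrightarrow>
      \<bar>E (K * a + b) - E (K * a)\<bar> \<le> 5 * \<eta> \<and> \<bar>(\<Sum>j<b. g (K * a + j)) - b * E (K * a)\<bar> \<le> 7 * \<eta> * n"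
  shows "\<bar>(\<Sum>k<M. g k) - M * E 0\<bar> \<le> 12 * (real (M div a) + 1) * n * \<eta>"
proof -
  define P where "P m K \<longleftrightarrow> \<bar>E m - E 0\<bar> \<le> 5 * real K * \<eta>
    \<and> \<bar>(\<Sum>k<m. g k) - m * E 0\<bar> \<le> 12 * real K * n * \<eta>" for m K
  have step: "P (K * a + b) (Suc K)" if PK: "P (K * a) K" and b: "b \<le> a" "K * a + b \<le> M" for K b
  proof (cases "b = 0")
    \<comment> \<open>An empty last block occurs when \<open>a\<close> divides \<open>M\<close>; the
      hypothesis \<open>block\<close> speaks only of blocks that begin before
      \<open>M\<close>.\<close>
    case True
    have "5 * real K * \<eta> \<le> 5 * real (Suc K) * \<eta>" "12 * real K * n * \<eta> \<le> 12 * real (Suc K) * n * \<eta>"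
      using \<eta> by (auto intro!: mult_right_mono)
    with PK True show ?thesis unfolding P_def by auto
  next
    case False
    then have "K * a < M" using b by simp
    note bl = block[OF b(1) this b(2)]
    have p: "\<bar>E (K * a) - E 0\<bar> \<le> 5 * real K * \<eta>" "\<bar>(\<Sum>k<K * a. g k) - real (K * a) * E 0\<bar>
      \<le> 12 * real K * n * \<eta>"
      using PK unfolding P_def by auto
    have "b * K \<le> a * K" using b(1) by simp
    also have "\<dots> \<le> n" using b M by (simp add: mult.commute)
    finally have "real (b * K) \<le> real n" unfolding of_nat_le_iff .
    then have bK: "real b * real K \<le> real n" by simp
    have "\<bar>b * E (K * a) - b * E 0\<bar> = b * \<bar>E (K * a) - E 0\<bar>"
      by (simp add: abs_mult flip: right_diff_distrib)
    also have "\<dots> \<le> b * (5 * real K * \<eta>)" by (intro mult_left_mono p) simp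
    also have "\<dots> = 5 * \<eta> * (real b * real K)" by simp
    also have "\<dots> \<le> 5 * \<eta> * n" using \<eta> bK by (intro mult_left_mono) auto
    finally have q: "\<bar>b * E (K * a) - b * E 0\<bar> \<le> 5 * \<eta> * n" .
    have "(\<Sum>k<K * a + b. g k) - real (K * a + b) * E 0 = ((\<Sum>k<K * a. g k) - real (K * a) * E 0)
      + ((\<Sum>j<b. g (K * a + j)) - b * E (K * a)) + (b * E (K * a) - b * E 0)"
      unfolding sum_upto_add by (simp add: algebra_simps)
    then have "\<bar>(\<Sum>k<K * a + b. g k) - real (K * a + b) * E 0\<bar> \<le> 12 * real K * n * \<eta> + 7 * \<eta> * n + 5 * \<eta> * n"
      using p(2) bl q by linarith
    also have "\<dots> = 12 * real (Suc K) * n * \<eta>" by (simp add: algebra_simps)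
    finally have "\<bar>(\<Sum>k<K * a + b. g k) - real (K * a + b) * E 0\<bar> \<le> 12 * real (Suc K) * n * \<eta>" .
    moreover have "5 * real K * \<eta> + 5 * \<eta> = 5 * real (Suc K) * \<eta>" by (simp add: algebra_simps)
    then have "\<bar>E (K * a + b) - E 0\<bar> \<le> 5 * real (Suc K) * \<eta>"
      using p(1) bl by linarith
    ultimately show ?thesis unfolding P_def by blast
  qed
  have "K * a \<le> M \<Longrightarrow> P (K * a) K" for K
  proof (induction K)
    case (Suc K)
    then have "P (K * a) K" "K * a + a \<le> M" by auto
    from step[OF this(1) order_refl this(2)] show ?case by (simp add: add.commute)
  qed (simp add: P_def)
  then have "P (M div a * a) (M div a)" by simp
  from step[OF this, of "M mod a"] have "P M (Suc (M div a))" using a by (simp add: less_imp_le)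
  then show ?thesis by (simp add: P_def add.commute)
qed

text \<open>Here \<open>u\<close>, \<open>w\<close>, \<open>z\<close> are the expectations of the
  discounted value, of the drift term and of the limit value, and \<open>g\<close> that of the
  payoff. The first recursion telescopes to \<open>w j - w 0\<close> minus \<open>l\<close> times at
  most \<open>b\<close> terms, so \<open>u\<close> moves by at most \<open>3 * \<delta>\<close>;
  replacing \<open>u\<close> by \<open>z\<close> at both ends gives \<open>5 * \<delta>\<close>.
  Summing the second recursion gives \<open>4 * \<delta> + 3 * \<delta>\<close> for \<open>l\<close>
  times the payoff error.\<close>

lemma block_recursion_bound:
  fixes u w g :: "nat \<Rightarrow> real"
  assumes l: "0 < l" "l \<le> 1" "real b * l \<le> 1" and \<delta>: "0 \<le> \<delta>"
    and w: "\<And>k. \<bar>w k\<bar> \<le> \<delta>" and z: "\<And>k. \<bar>u k - z k\<bar> \<le> \<delta>"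
    and uw: "\<And>k. k < b \<Longrightarrow> u (Suc k) - (1 - l) * w (Suc k) = u k - w k"
    and g: "\<And>k. k < b \<Longrightarrow> l * g k + (1 - l) * u (Suc k) = u k"
  shows "\<bar>z b - z 0\<bar> \<le> 5 * \<delta>" "\<bar>(\<Sum>j<b. g j) - b * z 0\<bar> \<le> 7 * \<delta> / l"
proof -
  have u: "\<bar>u j - u 0\<bar> \<le> 3 * \<delta>" if "j \<le> b" for j
  proof -
    have eq: "u j - u 0 = w j - w 0 - l * (\<Sum>i<j. w (Suc i))"
      using that
    proof (induction j)
      case (Suc j)
      then show ?case using uw[of j] by (simp add: algebra_simps)
    qed simp
    have "\<bar>\<Sum>i<j. w (Suc i)\<bar> \<le> real j * \<delta>"
    proof -
      have "\<bar>\<Sum>i<j. w (Suc i)\<bar> \<le> (\<Sum>i<j. \<delta>)" by (rule order_trans[OF sum_abs sum_mono]) (rule w)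
      then show ?thesis by simp
    qed
    moreover have "real j * \<delta> \<le> real b * \<delta>" using that \<delta> by (intro mult_right_mono) auto
    ultimately have "\<bar>\<Sum>i<j. w (Suc i)\<bar> \<le> real b * \<delta>" by linarith
    then have "l * \<bar>\<Sum>i<j. w (Suc i)\<bar> \<le> l * (real b * \<delta>)"
      using l by (intro mult_left_mono) auto
    also have "\<dots> = (real b * l) * \<delta>" by simp
    also have "\<dots> \<le> 1 * \<delta>" using l \<delta> by (intro mult_right_mono)
    finally have "\<bar>l * (\<Sum>i<j. w (Suc i))\<bar> \<le> \<delta>" using l by (simp add: abs_mult)
    then show ?thesis unfolding eq using w[of j] w[of 0] by linarith
  qed
  show "\<bar>z b - z 0\<bar> \<le> 5 * \<delta>" using u[of b] z[of b] z[of 0] by linarith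
  have gsum: "l * (\<Sum>j<m. g j) = l * (\<Sum>j<m. u j) + (1 - l) * (u 0 - u m)" if "m \<le> b" for m
    using that
  proof (induction m)
    case (Suc m)
    then show ?case using g[of m] by (simp add: algebra_simps)
  qed simp
  have eq: "l * ((\<Sum>j<b. g j) - b * z 0) = l * (\<Sum>j<b. u j - z 0) + (1 - l) * (u 0 - u b)"
    using gsum[OF order_refl] by (simp add: sum_subtractf right_diff_distrib)
  have "\<bar>\<Sum>j<b. u j - z 0\<bar> \<le> (\<Sum>j<b. 4 * \<delta>)"
  proof (rule order_trans[OF sum_abs sum_mono])
    fix j assume "j \<in> {..<b}"
    then show "\<bar>u j - z 0\<bar> \<le> 4 * \<delta>" using u[of j] z[of 0] by auto
  qed
  then have "l * \<bar>\<Sum>j<b. u j - z 0\<bar> \<le> l * (b * (4 * \<delta>))" using l by (intro mult_left_mono) auto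
  then have "\<bar>l * (\<Sum>j<b. u j - z 0)\<bar> \<le> (real b * l) * (4 * \<delta>)" using l by (simp add: abs_mult mult_ac)
  also have "\<dots> \<le> 1 * (4 * \<delta>)" using l \<delta> by (intro mult_right_mono) auto
  finally have "\<bar>l * (\<Sum>j<b. u j - z 0)\<bar> \<le> 4 * \<delta>" by simp
  moreover have "\<bar>(1 - l) * (u 0 - u b)\<bar> \<le> 1 * (3 * \<delta>)"
    unfolding abs_mult using l u[of b] by (intro mult_mono) auto
  ultimately have "\<bar>l * ((\<Sum>j<b. g j) - b * z 0)\<bar> \<le> 7 * \<delta>" unfolding eq by linarith
  then show "\<bar>(\<Sum>j<b. g j) - b * z 0\<bar> \<le> 7 * \<delta> / l"
    using l by (simp add: abs_mult pos_le_divide_eq mult.commute)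
qed

text \<open>The witness for \<open>d\<close> will be \<open>l\<close> times the derivative of the discounted value.\<close>

definition drift_bounded ::
  "('w::finite, 'i::finite, 'j::finite) stochastic_game \<Rightarrow> real \<Rightarrow> ('w \<Rightarrow> 'i pmf) \<Rightarrow> ('w \<Rightarrow> 'j pmf) \<Rightarrow> real \<Rightarrow>
    bool" where
  "drift_bounded \<Gamma> l x y \<delta> \<longleftrightarrow> (\<forall>s. \<bar>discounted_value \<Gamma> l s - limit_value \<Gamma> s\<bar> \<le> \<delta>) \<and>
    (\<exists>d. \<forall>s. \<bar>d s\<bar> \<le> \<delta> \<and>
      bilinear_payoff (next_value \<Gamma> (\<lambda>s. discounted_value \<Gamma> l s - (1 - l) * d s) s) (x s) (y s)
        = discounted_value \<Gamma> l s - d s)"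

lemma shapley_solution_saddle_eq:
  "shapley_solution \<Gamma> l v x y \<Longrightarrow> bilinear_payoff (local_game \<Gamma> l v s) (x s) (y s) = v s"
  unfolding shapley_solution_def by (intro antisym saddle_le saddle_ge) auto

text \<open>Below \<open>e\<close> the pair is the one for which the Shapley equation may be
  differentiated; at the other rates in \<open>(0, 1]\<close> any optimal pair is taken. The sum
  over states in \<open>\<delta>\<close> dominates both the drift and the distance to the limit
  value.\<close>

lemma drift_bounded_profile:
  fixes \<Gamma> :: "('w::finite, 'i::finite, 'j::finite) stochastic_game"
  obtains x y \<delta> e where "\<And>l. 0 < l \<Longrightarrow> l \<le> 1 \<Longrightarrow> shapley_solution \<Gamma> l (discounted_value \<Gamma> l) (x l) (y l)"
    "(\<delta> \<longlongrightarrow> 0) (at_right 0)" "\<And>l. 0 \<le> \<delta> l" "0 < e"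
    "\<And>l. 0 < l \<Longrightarrow> l < e \<Longrightarrow> drift_bounded \<Gamma> l (x l) (y l) (\<delta> l)"
proof -
  obtain e D L where e: "0 < e" "e \<le> 1"
    and D: "\<And>l s. 0 < l \<Longrightarrow> l < e \<Longrightarrow> ((\<lambda>l. discounted_value \<Gamma> l s) has_real_derivative D l s) (at l)"
      "\<And>s. ((\<lambda>l. l * D l s) \<longlongrightarrow> 0) (at_right 0)"
    and L: "\<And>s. ((\<lambda>l. discounted_value \<Gamma> l s) \<longlongrightarrow> L s) (at_right 0)"
    by (rule discounted_value_asymptotics[of \<Gamma>]) blast
  have lim: "limit_value \<Gamma> = L" by (rule limit_value_eq[OF L])
  define V where "V = discounted_value \<Gamma>"
  define \<delta> where "\<delta> l = (\<Sum>s\<in>UNIV. \<bar>l * D l s\<bar> + \<bar>V l s - L s\<bar>)" for l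
  have "((\<lambda>l. \<bar>l * D l s\<bar> + \<bar>V l s - L s\<bar>) \<longlongrightarrow> \<bar>0\<bar> + \<bar>L s - L s\<bar>) (at_right 0)" for s
    unfolding V_def by (intro tendsto_intros D L)
  then have "(\<delta> \<longlongrightarrow> (\<Sum>s\<in>(UNIV :: 'w set). \<bar>0\<bar> + \<bar>L s - L s\<bar>)) (at_right 0)"
    unfolding \<delta>_def by (intro tendsto_sum)
  then have \<delta>0: "(\<delta> \<longlongrightarrow> 0) (at_right 0)" by simp
  have \<delta>: "\<bar>l * D l s\<bar> \<le> \<delta> l" "\<bar>V l s - L s\<bar> \<le> \<delta> l" for l s
    using member_le_sum[of s UNIV "\<lambda>s. \<bar>l * D l s\<bar> + \<bar>V l s - L s\<bar>"] unfolding \<delta>_def by auto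
  define Q where "Q l x y \<longleftrightarrow> (0 < l \<and> l \<le> 1 \<longrightarrow> shapley_solution \<Gamma> l (V l) x y) \<and>
     (0 < l \<and> l < e \<longrightarrow> drift_bounded \<Gamma> l x y (\<delta> l))" for l x y
  have "\<exists>x y. Q l x y" for l
  proof (cases "0 < l \<and> l < e")
    case True
    then have l: "0 < l" "l < 1" "l < e" using e by auto
    obtain x y where xy: "shapley_solution \<Gamma> l (V l) x y"
      "\<And>s. bilinear_payoff (\<lambda>i j. payoff \<Gamma> s i j - next_value \<Gamma> (V l) s i j + (1 - l) * next_value \<Gamma> (D
        l) s i j) (x s) (y s) = D l s"
      using shapley_solution_derivative[OF l(1,2) D(1)[OF l(1,3)]] unfolding V_def by blast
    have "bilinear_payoff (next_value \<Gamma> (\<lambda>s. V l s - (1 - l) * (l * D l s)) s) (x s) (y s)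
      = V l s - l * D l s" for s
    proof -
      define M where "M i j
        = payoff \<Gamma> s i j - next_value \<Gamma> (V l) s i j + (1 - l) * next_value \<Gamma> (D l) s i j" for i j
      have "next_value \<Gamma> (\<lambda>s. V l s - (1 - l) * (l * D l s)) s
        = (\<lambda>i j. local_game \<Gamma> l (V l) s i j + (- l) * M i j)"
        by (intro ext) (simp only: next_value_diff next_value_cmult local_game_def M_def, simp add:
          algebra_simps)
      moreover have "bilinear_payoff M (x s) (y s) = D l s" unfolding M_def[abs_def] by (rule xy(2))
      ultimately show ?thesis
        by (simp only: bilinear_payoff_add bilinear_payoff_cmult shapley_solution_saddle_eq[OF xy(1)])
    qed
    then have "drift_bounded \<Gamma> l x y (\<delta> l)"
      unfolding drift_bounded_def lim using \<delta> unfolding V_def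
        by (intro conjI allI exI[of _ "\<lambda>s. l * D l s"]) auto
    then show ?thesis unfolding Q_def using xy(1) by blast
  next
    case False
    then show ?thesis
      unfolding Q_def V_def using shapley_solution_discounted_value_exists[of l \<Gamma>] by blast
  qed
  then obtain x y where "\<And>l. Q l (x l) (y l)" by metis
  with \<delta>0 e(1) show ?thesis
    by (intro that[of x y \<delta> e]) (auto simp: Q_def V_def \<delta>_def intro: sum_nonneg)
qed

text \<open>The local identities hold at every state, so they pass to expectations under any
  behaviour before stage \<open>k0 + 1\<close>. Only the histories inside the block have to follow
  \<open>x\<close> and \<open>y\<close>.\<close>

lemma block_bound:
  fixes \<Gamma> :: "('w::finite, 'i::finite, 'j::finite) stochastic_game"
  assumes sol: "shapley_solution \<Gamma> l (discounted_value \<Gamma> l) x y" and drift: "drift_bounded \<Gamma> l x y \<delta>"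
    and l: "0 < l" "l \<le> 1" "real b * l \<le> 1"
    and play: "\<And>h s. k0 \<le> length h \<Longrightarrow> length h < k0 + b \<Longrightarrow> \<sigma> h s = x s \<and> \<rho> h s = y s"
  shows "\<bar>expected_value \<Gamma> \<omega> \<sigma> \<rho> (k0 + b) (limit_value \<Gamma>) - expected_value \<Gamma> \<omega> \<sigma> \<rho> k0 (limit_value \<Gamma>)\<bar>
    \<le> 5 * \<delta>"
    "\<bar>(\<Sum>j<b. expected_payoff \<Gamma> \<omega> \<sigma> \<rho> (k0 + j)) - b * expected_value \<Gamma> \<omega> \<sigma> \<rho> k0 (limit_value \<Gamma>)\<bar> \<le> 7 * \<delta> / l"
proof -
  define V where "V = discounted_value \<Gamma> l"
  obtain d where d: "\<And>s. \<bar>d s\<bar> \<le> \<delta>"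
    "\<And>s. bilinear_payoff (next_value \<Gamma> (\<lambda>s. V s - (1 - l) * d s) s) (x s) (y s) = V s - d s"
    and VL: "\<And>s. \<bar>V s - limit_value \<Gamma> s\<bar> \<le> \<delta>"
    using drift unfolding drift_bounded_def V_def by blast
  have \<delta>: "0 \<le> \<delta>" using d(1)[of undefined] by linarith
  define u where "u k = expected_value \<Gamma> \<omega> \<sigma> \<rho> (k0 + k) V" for k
  define w where "w k = expected_value \<Gamma> \<omega> \<sigma> \<rho> (k0 + k) d" for k
  define z where "z k = expected_value \<Gamma> \<omega> \<sigma> \<rho> (k0 + k) (limit_value \<Gamma>)" for k
  define g where "g k = expected_payoff \<Gamma> \<omega> \<sigma> \<rho> (k0 + k)" for k
  have wb: "\<bar>w k\<bar> \<le> \<delta>" for k unfolding w_def by (rule stage_expectation_abs_le) (rule d)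
  have zb: "\<bar>u k - z k\<bar> \<le> \<delta>" for k
    unfolding u_def z_def stage_expectation_diff[symmetric] by (rule stage_expectation_abs_le) (rule VL)
  have uw: "u (Suc k) - (1 - l) * w (Suc k) = u k - w k" if k: "k < b" for k
  proof -
    have "0 * expected_payoff \<Gamma> \<omega> \<sigma> \<rho> (k0 + k) + 1 * expected_value \<Gamma> \<omega> \<sigma> \<rho> (Suc (k0 + k)) (\<lambda>s. V s - (1
      - l) * d s)
      = expected_value \<Gamma> \<omega> \<sigma> \<rho> (k0 + k) (\<lambda>s. V s - d s)"
      by (rule one_step_eq) (use k play d(2) in simp)
    then show ?thesis unfolding u_def w_def by (simp add: stage_expectation_diff stage_expectation_cmult)
  qed
  have gb: "l * g k + (1 - l) * u (Suc k) = u k" if k: "k < b" for k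
  proof -
    have "l * expected_payoff \<Gamma> \<omega> \<sigma> \<rho> (k0 + k) + (1 - l) * expected_value \<Gamma> \<omega> \<sigma> \<rho> (Suc (k0 + k)) V
      = expected_value \<Gamma> \<omega> \<sigma> \<rho> (k0 + k) V"
      by (rule one_step_eq)
        (use k play shapley_solution_saddle_eq[OF sol] in \<open>simp add: local_game_def[abs_def] V_def\<close>)
    then show ?thesis unfolding u_def g_def by simp
  qed
  show "\<bar>expected_value \<Gamma> \<omega> \<sigma> \<rho> (k0 + b) (limit_value \<Gamma>) - expected_value \<Gamma> \<omega> \<sigma> \<rho> k0 (limit_value \<Gamma>)\<bar>
    \<le> 5 * \<delta>"
    using block_recursion_bound(1)[where u=u and w=w and g=g and z=z, OF l \<delta> wb zb uw gb]
      unfolding z_def by simp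
  show "\<bar>(\<Sum>j<b. expected_payoff \<Gamma> \<omega> \<sigma> \<rho> (k0 + j)) - b * expected_value \<Gamma> \<omega> \<sigma> \<rho> k0 (limit_value \<Gamma>)\<bar>
    \<le> 7 * \<delta> / l"
    using block_recursion_bound(2)[where u=u and w=w and g=g and z=z, OF l \<delta> wb zb uw gb]
      unfolding z_def g_def by simp
qed

text \<open>The rates \<open>l \<le> 1 / sqrt n\<close> are those of all but the last \<open>sqrt n\<close> of the \<open>n\<close> stages.\<close>

lemma uniform_null_majorant:
  fixes \<delta> :: "real \<Rightarrow> real"
  assumes \<delta>: "(\<delta> \<longlongrightarrow> 0) (at_right 0)" "\<And>l. 0 \<le> \<delta> l" and e: "0 < e"
  obtains \<eta> :: "nat \<Rightarrow> real" where "\<eta> \<longlonglongrightarrow> 0" "\<And>n. 0 \<le> \<eta> n"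
    "\<forall>\<^sub>F n in sequentially. \<forall>l. 0 < l \<and> l \<le> 1 / sqrt n \<longrightarrow> l < e \<and> \<delta> l \<le> \<eta> n"
proof -
  \<comment> \<open>The truncation at \<open>1\<close> keeps the supremum finite, since nothing
    bounds \<open>\<delta>\<close> away from \<open>0\<close>; for large \<open>n\<close> it is
    inactive. The shift by \<open>Suc\<close> avoids a division by zero.\<close>
  define S where "S n = (\<lambda>l. min 1 (\<delta> l)) ` {l. 0 < l \<and> l \<le> 1 / sqrt (real (Suc n))}" for n
  define \<eta> where "\<eta> n = Sup (S (n - 1))" for n
  have S: "S n \<noteq> {}" "bdd_above (S n)" for n
    unfolding S_def by (auto intro!: bdd_aboveI[of _ 1] exI[of _ "1 / sqrt (real (Suc n))"])
  have ub: "min 1 (\<delta> l) \<le> \<eta> n" if "0 < l" "l \<le> 1 / sqrt n" "0 < n" for l n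
    unfolding \<eta>_def using that by (intro cSup_upper S) (auto simp: S_def)
  have nonneg: "0 \<le> \<eta> n" for n
  proof -
    have "1 / sqrt (real (Suc (n - 1))) \<in> {l. 0 < l \<and> l \<le> 1 / sqrt (real (Suc (n - 1)))}" by simp
    then have "min 1 (\<delta> (1 / sqrt (real (Suc (n - 1))))) \<in> S (n - 1)" unfolding S_def by (rule imageI)
    then have "min 1 (\<delta> (1 / sqrt (real (Suc (n - 1))))) \<le> \<eta> n" unfolding \<eta>_def by (intro cSup_upper S)
    moreover have "0 \<le> min 1 (\<delta> (1 / sqrt (real (Suc (n - 1)))))" using \<delta>(2) by simp
    ultimately show ?thesis by linarith
  qed
  have sq: "(\<lambda>n. 1 / sqrt (real n)) \<longlonglongrightarrow> 0"
    using tendsto_real_sqrt[OF lim_1_over_n[where 'a=real]] by (simp add: real_sqrt_divide)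
  have ev: "\<forall>\<^sub>F n in sequentially. \<forall>l. 0 < l \<and> l \<le> 1 / sqrt n \<longrightarrow> l < e \<and> \<delta> l < r" if "0 < r" for r
  proof -
    have "\<forall>\<^sub>F l in at_right 0. \<delta> l < r" using order_tendstoD(2)[OF \<delta>(1) that] .
    then obtain d where d: "d > 0" "\<And>l. 0 < l \<Longrightarrow> l < d \<Longrightarrow> \<delta> l < r"
      unfolding eventually_at_right_0_iff by blast
    have "\<forall>\<^sub>F n in sequentially. 1 / sqrt (real n) < min d e"
      using order_tendstoD(2)[OF sq, of "min d e"] d(1) e by simp
    then show ?thesis by eventually_elim (use d(2) in auto)
  qed
  have "\<eta> \<longlonglongrightarrow> 0"
  proof (rule tendstoI)
    fix r :: real assume "0 < r"
    then have "0 < r / 2" by simp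
    from ev[OF this] eventually_gt_at_top[of 0]
    show "\<forall>\<^sub>F n in sequentially. dist (\<eta> n) 0 < r"
    proof eventually_elim
      case (elim n)
      have "\<eta> n \<le> r / 2"
        unfolding \<eta>_def using elim
          by (intro cSup_least S) (auto simp: S_def intro: less_imp_le min.coboundedI2)
      then show ?case using nonneg[of n] \<open>0 < r\<close> by (simp add: dist_real_def)
    qed
  qed
  moreover have "\<forall>\<^sub>F n in sequentially. \<forall>l. 0 < l \<and> l \<le> 1 / sqrt n \<longrightarrow> l < e \<and> \<delta> l \<le> \<eta> n"
    using ev[of 1, OF zero_less_one] eventually_gt_at_top[of 0]
    by eventually_elim (use ub in force)
  ultimately show ?thesis using that nonneg by blast
qed

theorem theorem1p7:
  fixes \<Gamma> :: "('w::finite, 'i::finite, 'j::finite) stochastic_game"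
  shows "\<exists>\<sigma> \<rho>. adapted_profile \<Gamma> \<sigma> \<rho> \<and> constant_payoff_property \<Gamma> \<sigma> \<rho>"
proof -
  obtain x y \<delta> e where sol: "\<And>l. 0 < l \<Longrightarrow> l \<le> 1 \<Longrightarrow> shapley_solution \<Gamma> l (discounted_value \<Gamma> l) (x l) (y l)"
    and \<delta>: "(\<delta> \<longlongrightarrow> 0) (at_right 0)" "\<And>l. 0 \<le> \<delta> l" and e: "0 < e"
    and drift: "\<And>l. 0 < l \<Longrightarrow> l < e \<Longrightarrow> drift_bounded \<Gamma> l (x l) (y l) (\<delta> l)"
    by (rule drift_bounded_profile[of \<Gamma>]) blast
  obtain \<eta> where \<eta>: "\<eta> \<longlonglongrightarrow> 0" "\<And>n. 0 \<le> \<eta> n"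
    "\<forall>\<^sub>F n in sequentially. \<forall>l. 0 < l \<and> l \<le> 1 / sqrt n \<longrightarrow> l < e \<and> \<delta> l \<le> \<eta> n"
    using uniform_null_majorant[OF \<delta> e] by blast
  \<comment> \<open>The added \<open>1\<close> keeps blocks nonempty when
    \<open>\<eta> n = 0\<close>.\<close>
  define a where "a n = nat \<lceil>real n * sqrt (\<eta> n)\<rceil> + 1" for n
  have a: "1 \<le> a n" "real n * sqrt (\<eta> n) \<le> real (a n)" "real (a n) \<le> real n * sqrt (\<eta> n) + 2" for n
  proof -
    have "0 \<le> real n * sqrt (\<eta> n)" using \<eta>(2) by simp
    then show "real n * sqrt (\<eta> n) \<le> real (a n)" "real (a n) \<le> real n * sqrt (\<eta> n) + 2"
      unfolding a_def by linarith+
  qed (simp add: a_def)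
  have sqrt\<eta>: "(\<lambda>n. sqrt (\<eta> n)) \<longlonglongrightarrow> 0" using tendsto_real_sqrt[OF \<eta>(1)] by simp
  define \<sigma> :: "nat \<Rightarrow> ('w, 'i, 'j, 'i) strategy"
    where "\<sigma> n h s = x (block_rate n (a n) (length h div a n)) s" for n h s
  define \<rho> :: "nat \<Rightarrow> ('w, 'i, 'j, 'j) strategy"
    where "\<rho> n h s = y (block_rate n (a n) (length h div a n)) s" for n h s
  have "(\<lambda>n. real (a n) / real n) \<longlonglongrightarrow> 0"
  proof (rule tendsto_sandwich[where f="\<lambda>_. 0" and h="\<lambda>n. sqrt (\<eta> n) + 2 * (1 / real n)"])
    show "\<forall>\<^sub>F n in sequentially. real (a n) / real n \<le> sqrt (\<eta> n) + 2 * (1 / real n)"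
      using eventually_gt_at_top[of 0]
    proof eventually_elim
      case (elim n)
      then show ?case
        using divide_right_mono[OF a(3)[of n], of "real n"] by (simp add: add_divide_distrib)
    qed
    show "(\<lambda>n. sqrt (\<eta> n) + 2 * (1 / real n)) \<longlonglongrightarrow> 0"
      using tendsto_add[OF sqrt\<eta> tendsto_mult[OF tendsto_const[of 2] lim_1_over_n[where 'a=real]]] by simp
  qed auto
  moreover have "discounted_optimal_profile \<Gamma> x y"
    unfolding discounted_optimal_profile_def using shapley_solution_optimal[OF sol] by auto
  ultimately have "adapted_profile \<Gamma> \<sigma> \<rho>"
    unfolding adapted_profile_def \<sigma>_def \<rho>_def using a(1) by (intro exI[of _ x] exI[of _ y] exI[of _ a]) auto
  moreover have "constant_payoff_property \<Gamma> \<sigma> \<rho>"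
    unfolding constant_payoff_property_def integral_sum_stage_payoff
  proof (intro ballI allI)
    fix t :: real and \<omega> assume "t \<in> {0<..<1}"
    then have t: "0 < t" "t < 1" by auto
    define L where "L = limit_value \<Gamma>"
    define M where "M n = nat \<lceil>t * real n\<rceil>" for n
    have M: "t * real n \<le> real (M n)" "real (M n) < t * real n + 1" for n
    proof -
      have "0 \<le> t * real n" using t by simp
      then show "t * real n \<le> real (M n)" "real (M n) < t * real n + 1" unfolding M_def by linarith+
    qed
    \<comment> \<open>Since \<open>t < 1\<close>, eventually at least \<open>sqrt n\<close> stages
      remain after the horizon \<open>M n\<close>, so every block that begins before it has a rate
      of at most \<open>1 / sqrt n\<close>.\<close>
    have large: "\<forall>\<^sub>F n in sequentially. sqrt (real n) \<le> real n - (t * real n + 1)"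
      using eventually_ge_at_top[of "nat \<lceil>(2 / (1 - t))\<^sup>2\<rceil>"]
    proof eventually_elim
      case (elim n)
      define q where "q = sqrt (real n)"
      have q: "0 \<le> q" "q * q = real n" unfolding q_def by simp_all
      have "(2 / (1 - t))\<^sup>2 \<le> real n" using elim by linarith
      then have "sqrt ((2 / (1 - t))\<^sup>2) \<le> q" unfolding q_def by (rule real_sqrt_le_mono)
      then have "2 / (1 - t) \<le> q" using t by simp
      then have q2: "2 \<le> (1 - t) * q" using t by (simp add: pos_divide_le_eq mult.commute)
      have "(1 - t) * q \<le> 1 * q" using t q by (intro mult_right_mono) auto
      then have "1 \<le> q" using q2 by simp
      have "2 * q \<le> (1 - t) * q * q" using mult_right_mono[OF q2 q(1)] .
      then have "2 * q \<le> real n - t * real n" using q(2) by (simp add: left_diff_distrib mult.assoc)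
      then show ?case unfolding q_def[symmetric] using \<open>1 \<le> q\<close> by simp
    qed
    have main: "\<forall>\<^sub>F n in sequentially.
      \<bar>(\<Sum>k<M n. expected_payoff \<Gamma> \<omega> (\<sigma> n) (\<rho> n) k) - M n * L \<omega>\<bar> \<le> 12 * (real (M n div a n) + 1) * n * \<eta> n"
      using large \<eta>(3) eventually_gt_at_top[of 0]
    proof eventually_elim
      case (elim n)
      define z where "z k = expected_value \<Gamma> \<omega> (\<sigma> n) (\<rho> n) k L" for k
      have "real (M n) \<le> real n"
        using elim(1) M(2)[of n] real_sqrt_ge_zero[of "real n"] by linarith
      then have Mn: "M n \<le> n" by simp
      have "z 0 = L \<omega>" unfolding z_def by (rule stage_expectation_0)
      moreover have "\<bar>(\<Sum>k<M n. expected_payoff \<Gamma> \<omega> (\<sigma> n) (\<rho> n) k) - M n * z 0\<bar>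
        \<le> 12 * (real (M n div a n) + 1) * n * \<eta> n"
      proof (rule block_sum_bound[OF _ Mn \<eta>(2)])
        show "0 < a n" using a(1)[of n] by simp
        fix K b assume b: "b \<le> a n" "K * a n < M n" "K * a n + b \<le> M n"
        define l where "l = block_rate n (a n) K"
        have r: "real (K * a n) + real b \<le> real (M n)" "real (K * a n) < real (M n)"
        proof -
          have "real (K * a n + b) \<le> real (M n)" using b(3) by (simp only: of_nat_le_iff)
          then show "real (K * a n) + real b \<le> real (M n)" by simp
          show "real (K * a n) < real (M n)" using b(2) by (simp only: of_nat_less_iff)
        qed
        have rn: "sqrt (real n) \<le> real n - real K * real (a n)" using r(2) M(2)[of n] elim(1) by simp
        have s1: "1 \<le> sqrt (real n)" using elim(3) by simp
        have l_eq: "l = 1 / (real n - real K * real (a n))" unfolding l_def block_rate_def ..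
        have p: "1 \<le> real n - real K * real (a n)" using rn s1 by linarith
        then have p0: "0 < real n - real K * real (a n)" by linarith
        with p have l: "0 < l" "l \<le> 1" unfolding l_eq by (simp_all add: pos_divide_le_eq)
        have "0 < sqrt (real n)" using s1 by linarith
        then have lsq: "l \<le> 1 / sqrt n"
          unfolding l_eq by (intro frac_le rn) simp_all
        \<comment> \<open>The inverse of the rate is the number of stages left when the block
          begins, so a block of stages to be played cannot be longer.\<close>
        have "real b \<le> real n - real K * real (a n)" using r(1) Mn by simp
        then have bl: "real b * l \<le> 1" using l(1) unfolding l_eq by (simp add: pos_divide_le_eq)
        have le: "l < e" "\<delta> l \<le> \<eta> n" using elim(2) l(1) lsq by auto
        have play: "\<sigma> n h s = x l s \<and> \<rho> n h s = y l s"
          if "K * a n \<le> length h" "length h < K * a n + b" for h s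
        proof -
          have "length h div a n = K"
            using that b(1) by (intro div_nat_eqI) (auto simp: mult.commute)
          then show ?thesis unfolding \<sigma>_def \<rho>_def l_def by simp
        qed
        have bb: "\<bar>z (K * a n + b) - z (K * a n)\<bar> \<le> 5 * \<delta> l"
          "\<bar>(\<Sum>j<b. expected_payoff \<Gamma> \<omega> (\<sigma> n) (\<rho> n) (K * a n + j)) - real b * z (K * a n)\<bar> \<le> 7 * \<delta> l / l"
          unfolding z_def L_def
          by (rule block_bound[OF sol[OF l] drift[OF l(1) le(1)] l bl]; rule play; assumption)+
        have "7 * \<delta> l / l = 7 * \<delta> l * (real n - real K * real (a n))" unfolding l_eq by simp
        also have "\<dots> \<le> 7 * \<eta> n * real n"
          using le(2) \<delta>(2)[of l] p0 \<eta>(2)[of n] by (intro mult_mono) auto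
        finally have "7 * \<delta> l / l \<le> 7 * \<eta> n * real n" .
        then show "\<bar>z (K * a n + b) - z (K * a n)\<bar> \<le> 5 * \<eta> n \<and>
          \<bar>(\<Sum>j<b. expected_payoff \<Gamma> \<omega> (\<sigma> n) (\<rho> n) (K * a n + j)) - real b * z (K * a n)\<bar> \<le> 7 * \<eta> n * real n"
          using bb le(2) by linarith
      qed
      ultimately show ?case by simp
    qed
    have "(\<lambda>n. 1 / (t * real n) * (\<Sum>k<M n. expected_payoff \<Gamma> \<omega> (\<sigma> n) (\<rho> n) k) - L \<omega>) \<longlonglongrightarrow> 0"
    proof (rule Lim_null_comparison)
      \<comment> \<open>The first term pays for rounding \<open>t * real n\<close> up to
        \<open>M n\<close>. In the second, the complete blocks together contribute
        \<open>sqrt (\<eta> n)\<close> and the last, possibly incomplete, one contributes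
        \<open>\<eta> n\<close>.\<close>
      show "\<forall>\<^sub>F n in sequentially. norm (1 / (t * real n) * (\<Sum>k<M n. expected_payoff \<Gamma> \<omega> (\<sigma> n) (\<rho> n) k)
        - L \<omega>)
        \<le> \<bar>L \<omega>\<bar> / t * (1 / real n) + 12 / t * (sqrt (\<eta> n) + \<eta> n)"
        using main large eventually_gt_at_top[of 0]
      proof eventually_elim
        case (elim n)
        define G where "G = (\<Sum>k<M n. expected_payoff \<Gamma> \<omega> (\<sigma> n) (\<rho> n) k)"
        have n: "0 < real n" "0 < t * real n" using elim(3) t by auto
        have "real (M n div a n) * real (a n) \<le> real (M n)"
          unfolding of_nat_mult[symmetric] of_nat_le_iff by simp
        also have "\<dots> \<le> real n" using elim(2) M(2)[of n] real_sqrt_ge_zero[of "real n"] by linarith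
        finally have "real (M n div a n) * real (a n) \<le> real n" .
        then have "real (M n div a n) * (real n * sqrt (\<eta> n)) \<le> real n"
          using mult_left_mono[OF a(2)[of n], of "real (M n div a n)"] by simp
        then have "real (M n div a n) * sqrt (\<eta> n) \<le> 1" using n(1) by (simp add: mult.left_commute)
        then have "real (M n div a n) * sqrt (\<eta> n) * sqrt (\<eta> n) \<le> 1 * sqrt (\<eta> n)"
          using \<eta>(2)[of n] by (intro mult_right_mono) auto
        then have "real (M n div a n) * \<eta> n \<le> sqrt (\<eta> n)" using \<eta>(2)[of n] by (simp add: mult.assoc)
        then have "12 * real n * ((real (M n div a n) + 1) * \<eta> n) \<le> 12 * real n * (sqrt (\<eta> n) + \<eta> n)"
          by (intro mult_left_mono) (auto simp: distrib_right)
        with elim(1) have "\<bar>G - M n * L \<omega>\<bar> \<le> 12 * real n * (sqrt (\<eta> n) + \<eta> n)"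
          unfolding G_def by (simp add: mult_ac)
        moreover have "\<bar>M n * L \<omega> - t * real n * L \<omega>\<bar> \<le> 1 * \<bar>L \<omega>\<bar>"
          unfolding left_diff_distrib[symmetric] abs_mult using M[of n] by (intro mult_right_mono) auto
        ultimately have "\<bar>G - t * real n * L \<omega>\<bar> \<le> \<bar>L \<omega>\<bar> + 12 * real n * (sqrt (\<eta> n) + \<eta> n)" by linarith
        then have "\<bar>G - t * real n * L \<omega>\<bar> / (t * real n)
          \<le> (\<bar>L \<omega>\<bar> + 12 * real n * (sqrt (\<eta> n) + \<eta> n)) / (t * real n)"
          using n by (intro divide_right_mono) auto
        also have "\<dots> = \<bar>L \<omega>\<bar> / t * (1 / real n) + 12 / t * (sqrt (\<eta> n) + \<eta> n)"
          using n t by (simp add: add_divide_distrib)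
        also have "\<bar>G - t * real n * L \<omega>\<bar> / (t * real n) = \<bar>1 / (t * real n) * G - L \<omega>\<bar>"
        proof -
          have "1 / (t * real n) * G - L \<omega> = (G - t * real n * L \<omega>) / (t * real n)"
            using n t by (simp add: diff_divide_distrib)
          then show ?thesis using n by (simp add: abs_divide)
        qed
        finally show ?case unfolding G_def by simp
      qed
      have "(\<lambda>n. \<bar>L \<omega>\<bar> / t * (1 / real n) + 12 / t * (sqrt (\<eta> n) + \<eta> n)) \<longlonglongrightarrow> \<bar>L \<omega>\<bar> / t * 0 + 12 / t * (0 + 0)"
        by (intro tendsto_add tendsto_mult tendsto_const lim_1_over_n sqrt\<eta> \<eta>(1))
      then show "(\<lambda>n. \<bar>L \<omega>\<bar> / t * (1 / real n) + 12 / t * (sqrt (\<eta> n) + \<eta> n)) \<longlonglongrightarrow> 0" by simp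
    qed
    then show "(\<lambda>n. 1 / (t * real n) * (\<Sum>k<nat \<lceil>t * real n\<rceil>. expected_payoff \<Gamma> \<omega> (\<sigma> n) (\<rho> n) k))
      \<longlonglongrightarrow> limit_value \<Gamma> \<omega>"
      unfolding M_def L_def by (rule LIM_zero_cancel)
  qed
  ultimately show ?thesis by blast
qed

end
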